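(* Let $M$ be a connected Riemannian manifold of dimension $n$, let $\varphi\in\Omega^p(M)$ be a parallel calibration on $M$, and let $\mathscr{P}\subset\Omega^p(M)$ be the associated space of $p$-forms (smooth sections of the sub-bundle $\Phi_M\subset\bigwedge^pT^*M$ defined in the context). Let $N\subset M$ be an oriented $p$-dimensional submanifold. Then $N$ is $\varphi$-critical if and only if $N$ is an integral manifold of $\mathscr{P}$. In particular, every calibrated submanifold of $M$ is an integral manifold of $\mathscr{P}$.
   Context: For a Euclidean vector space $V$, $\mathrm{Gr}_o(p,V)=\{e_1\wedge\cdots\wedge e_p : e_1,\dots,e_p \text{ orthonormal in } V\}\subset\bigwedge^pV$ is the set of unit decomposable $p$-vectors (oriented $p$-planes). $\mathrm{Gr}_o(p,TM)$ is the bundle over $M$ with fibres $\mathrm{Gr}_o(p,T_xM)$. For a $p$-form $\varphi$ and $\xi=e_1\wedge\cdots\wedge e_p$, put $\varphi(\xi)=\varphi(e_1,\dots,e_p)$. A calibration is a closed $p$-form $\varphi\in\Omega^p(M)$ with $\varphi\le 1$ on $\mathrm{Gr}_o(p,TM)$. It is parallel if $\nabla\varphi=0$ for the Levi-Civita connection. $C(\varphi)_x\subset\mathrm{Gr}_o(p,T_xM)$ is the set of critical points of the function $\varphi_x:\mathrm{Gr}_o(p,T_xM)\to\mathbb{R}$. An oriented $p$-dimensional submanifold $N\subset M$ is $\varphi$-critical if $T_xN\in C(\varphi)_x$ for all $x\in N$ (where $T_xN$ denotes the unit $p$-vector of the oriented tangent space), and calibrated if $\varphi(T_xN)=1$ for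 all $x\in N$. Definition of $\Phi$: for a Euclidean vector space $V$ and $\phi\in\bigwedge^pV^*$, let $\mathfrak{o}(V)$ be the Lie algebra of skew-symmetric endomorphisms of $V$, acting on $p$-forms by $(\theta.\phi)(v_1,\dots,v_p)=\sum_{a=1}^p\phi(v_1,\dots,v_{a-1},\theta v_a,v_{a+1},\dots,v_p)$ (up to an overall sign convention, which is irrelevant here), and set $\Phi=\{\theta.\phi : \theta\in\mathfrak{o}(V)\}\subset\bigwedge^pV^*$. Definition of $\Phi_M$ and $\mathscr{P}$: fix $x_0\in M$, $V=T_{x_0}M$, $\phi=\varphi_{x_0}$. Since $\varphi$ is parallel and $M$ is connected, for every $x\in M$ there is a linear isometry $u:T_xM\to V$ with $u^*\phi=\varphi_x$ (for example, obtained from parallel transport), and $\Phi_{M,x}:=u^*(\Phi)\subset\bigwedge^pT_x^*M$ is independent of the choice of such $u$; equivalently, $\Phi_{M,x}=\{\theta.\varphi_x : \theta\in\mathfrak{o}(T_xM)\}$. These fibres form a smooth sub-bundle $\Phi_M\subset\bigwedge^pT^*M$, and $\mathscr{P}\subset\Omega^p(M)$ is the space of its smooth sections. A $p$-dimensional submanifold $N\subset M$ is an integral manifold of $\mathscr{P}$ if $\psi|_N=0$ for every $\psi\in\mathscr{P}$. *)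

theory Defs
  imports "HOL-Analysis.Analysis" "HOL-Library.Function_Algebras"
begin

section \<open>Pointwise real vector space structure on functions\<close>

instantiation "fun" :: (type, real_vector) real_vector
begin

definition scaleR_fun :: "real \<Rightarrow> ('a \<Rightarrow> 'b) \<Rightarrow> 'a \<Rightarrow> 'b" where
  "scaleR_fun r f = (\<lambda>x. r *\<^sub>R f x)"

instance
  by standard (simp_all add: scaleR_fun_def plus_fun_def fun_eq_iff scaleR_add_right scaleR_add_left)

end


section \<open>Smooth maps between open subsets of normed spaces\<close>

primrec Ck_on :: "nat \<Rightarrow> 'a::real_normed_vector set \<Rightarrow> ('a \<Rightarrow> 'b::real_normed_vector) \<Rightarrow> bool" where
  "Ck_on 0 S f \<longleftrightarrow> continuous_on S f"
| "Ck_on (Suc k) S f \<longleftrightarrow> (\<forall>x\<in>S. f differentiable (at x)) \<and>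
      (\<forall>v. Ck_on k S (\<lambda>x. frechet_derivative f (at x) v))"

text \<open>Only used for open domains.\<close>

definition smooth_on :: "'a::real_normed_vector set \<Rightarrow> ('a \<Rightarrow> 'b::real_normed_vector) \<Rightarrow> bool" where
  "smooth_on S f \<longleftrightarrow> (\<forall>k. Ck_on k S f)"


section \<open>Exterior algebra of a Euclidean vector space\<close>

text \<open>
  A Euclidean vector space is a linear subspace \<open>V\<close> of some ambient real vector space together
  with an inner product \<open>ip\<close>, only its values on \<open>V\<close> being relevant. A \<open>p\<close>-form
  takes a list of vectors; its value is 0 unless the argument is a list of length \<open>p\<close> of
  vectors of \<open>V\<close>, so that two \<open>p\<close>-forms on \<open>V\<close> are equal as functions
  iff they agree on \<open>V\<close>.
\<close>

type_synonym 'v form = "'v list \<Rightarrow> real"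

text \<open>A \<open>p\<close>-vector, through the identification of the \<open>p\<close>-th exterior power of \<open>V\<close>
  with the dual of the space of \<open>p\<close>-forms.\<close>

type_synonym 'v mvec = "'v form \<Rightarrow> real"

definition tuples :: "nat \<Rightarrow> 'v set \<Rightarrow> 'v list set" where
  "tuples p V = {vs. length vs = p \<and> set vs \<subseteq> V}"

definition linear_between :: "'v::real_vector set \<Rightarrow> 'w::real_vector set \<Rightarrow> ('v \<Rightarrow> 'w) \<Rightarrow> bool" where
  "linear_between V W f \<longleftrightarrow> f ` V \<subseteq> W \<and>
     (\<forall>v\<in>V. \<forall>w\<in>V. f (v + w) = f v + f w) \<and> (\<forall>r. \<forall>v\<in>V. f (r *\<^sub>R v) = r *\<^sub>R f v)"

definition inner_product_on :: "'v::real_vector set \<Rightarrow> ('v \<Rightarrow> 'v \<Rightarrow> real) \<Rightarrow> bool" where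
  "inner_product_on V ip \<longleftrightarrow>
     (\<forall>v\<in>V. linear_between V UNIV (ip v)) \<and>
     (\<forall>v\<in>V. \<forall>w\<in>V. ip v w = ip w v) \<and>
     (\<forall>v\<in>V. v \<noteq> 0 \<longrightarrow> ip v v > 0)"

definition alt_forms :: "nat \<Rightarrow> 'v::real_vector set \<Rightarrow> 'v form set" where
  "alt_forms p V = {\<alpha>.
     (\<forall>vs. vs \<notin> tuples p V \<longrightarrow> \<alpha> vs = 0) \<and>
     (\<forall>vs\<in>tuples p V. \<forall>i<p. linear_between V UNIV (\<lambda>v. \<alpha> (vs[i := v]))) \<and>
     (\<forall>vs\<in>tuples p V. \<forall>i<p. \<forall>j<p. i \<noteq> j \<and> vs ! i = vs ! j \<longrightarrow> \<alpha> vs = 0)}"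

definition wedge :: "nat \<Rightarrow> 'v::real_vector set \<Rightarrow> 'v list \<Rightarrow> 'v mvec" where
  "wedge p V es = (\<lambda>\<alpha>. if \<alpha> \<in> alt_forms p V then \<alpha> es else 0)"

definition orthonormal :: "('v \<Rightarrow> 'v \<Rightarrow> real) \<Rightarrow> 'v list \<Rightarrow> bool" where
  "orthonormal ip es \<longleftrightarrow> (\<forall>i<length es. \<forall>j<length es. ip (es ! i) (es ! j) = (if i = j then 1 else 0))"

definition Gr_o :: "nat \<Rightarrow> 'v::real_vector set \<Rightarrow> ('v \<Rightarrow> 'v \<Rightarrow> real) \<Rightarrow> 'v mvec set" where
  "Gr_o p V ip = {wedge p V es | es. es \<in> tuples p V \<and> orthonormal ip es}"

text \<open>The value of a \<open>p\<close>-form on a \<open>p\<close>-vector is the evaluation pairing: for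
  \<open>\<phi> \<in> alt_forms p V\<close> one has \<open>pairing \<phi> (wedge p V es) = \<phi> es\<close>.\<close>

definition pairing :: "'v form \<Rightarrow> 'v mvec \<Rightarrow> real" where
  "pairing \<phi> \<xi> = \<xi> \<phi>"

text \<open>Smooth curves in \<open>Gr_o p V ip\<close>, regarded as a submanifold of the finite-dimensional space of
  \<open>p\<close>-vectors: since the \<open>p\<close>-forms are all the linear functionals on that space, smoothness is
  smoothness of the composition with each \<open>p\<close>-form.\<close>

definition Gr_curve :: "nat \<Rightarrow> 'v::real_vector set \<Rightarrow> ('v \<Rightarrow> 'v \<Rightarrow> real) \<Rightarrow> real \<Rightarrow> (real \<Rightarrow> 'v mvec) \<Rightarrow> bool" where
  "Gr_curve p V ip \<epsilon> \<gamma> \<longleftrightarrow>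
     (\<forall>t\<in>{-\<epsilon><..<\<epsilon>}. \<gamma> t \<in> Gr_o p V ip) \<and>
     (\<forall>\<alpha>\<in>alt_forms p V. smooth_on {-\<epsilon><..<\<epsilon>} (\<lambda>t. pairing \<alpha> (\<gamma> t)))"

text \<open>Critical points of \<open>\<phi> : Gr_o p V ip \<rightarrow> \<real>\<close>: the differential of \<open>\<phi>\<close> vanishes on the
  velocities of all smooth curves in \<open>Gr_o p V ip\<close> through the point.\<close>

definition critical_points :: "nat \<Rightarrow> 'v::real_vector set \<Rightarrow> ('v \<Rightarrow> 'v \<Rightarrow> real) \<Rightarrow> 'v form \<Rightarrow> 'v mvec set" where
  "critical_points p V ip \<phi> = {\<xi> \<in> Gr_o p V ip.
     \<forall>\<epsilon>>0. \<forall>\<gamma>. Gr_curve p V ip \<epsilon> \<gamma> \<and> \<gamma> 0 = \<xi> \<longrightarrow>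
       ((\<lambda>t. pairing \<phi> (\<gamma> t)) has_real_derivative 0) (at 0)}"

definition skew_endos :: "'v::real_vector set \<Rightarrow> ('v \<Rightarrow> 'v \<Rightarrow> real) \<Rightarrow> ('v \<Rightarrow> 'v) set" where
  "skew_endos V ip = {\<theta>. linear_between V V \<theta> \<and> (\<forall>v\<in>V. \<forall>w\<in>V. ip (\<theta> v) w = - ip v (\<theta> w))}"

definition act :: "nat \<Rightarrow> 'v set \<Rightarrow> ('v \<Rightarrow> 'v) \<Rightarrow> 'v form \<Rightarrow> 'v form" where
  "act p V \<theta> \<phi> = (\<lambda>vs. if vs \<in> tuples p V then \<Sum>a<p. \<phi> (vs[a := \<theta> (vs ! a)]) else 0)"

definition Phi :: "nat \<Rightarrow> 'v::real_vector set \<Rightarrow> ('v \<Rightarrow> 'v \<Rightarrow> real) \<Rightarrow> 'v form \<Rightarrow> 'v form set" where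
  "Phi p V ip \<phi> = {act p V \<theta> \<phi> | \<theta>. \<theta> \<in> skew_endos V ip}"

definition pullback :: "nat \<Rightarrow> 'v set \<Rightarrow> ('v \<Rightarrow> 'w) \<Rightarrow> 'w form \<Rightarrow> 'v form" where
  "pullback p V u \<alpha> = (\<lambda>vs. if vs \<in> tuples p V then \<alpha> (map u vs) else 0)"

definition linear_isometry :: "'v::real_vector set \<Rightarrow> ('v \<Rightarrow> 'v \<Rightarrow> real) \<Rightarrow>
    'w::real_vector set \<Rightarrow> ('w \<Rightarrow> 'w \<Rightarrow> real) \<Rightarrow> ('v \<Rightarrow> 'w) \<Rightarrow> bool" where
  "linear_isometry V ip W ip' u \<longleftrightarrow> linear_between V W u \<and> u ` V = W \<and>
     (\<forall>v\<in>V. \<forall>w\<in>V. ip' (u v) (u w) = ip v w)"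


section \<open>Smooth manifolds\<close>

text \<open>A chart of a topological space \<open>M\<close> is an open set with a homeomorphism onto an open
  subset of the model space \<open>'e\<close>; the dimension of the manifold is \<open>DIM('e)\<close>.\<close>

type_synonym ('m, 'e) chart = "'m set \<times> ('m \<Rightarrow> 'e)"

definition is_chart :: "'m topology \<Rightarrow> ('m, 'e::euclidean_space) chart \<Rightarrow> bool" where
  "is_chart M c \<longleftrightarrow> openin M (fst c) \<and> open (snd c ` fst c) \<and>
     homeomorphic_map (subtopology M (fst c)) (top_of_set (snd c ` fst c)) (snd c)"

definition chart_inv :: "('m, 'e) chart \<Rightarrow> 'e \<Rightarrow> 'm" where
  "chart_inv c = inv_into (fst c) (snd c)"

definition transition :: "('m, 'e) chart \<Rightarrow> ('m, 'e) chart \<Rightarrow> 'e \<Rightarrow> 'e" where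
  "transition c c' = snd c' \<circ> chart_inv c"

definition compatible :: "('m, 'e::euclidean_space) chart \<Rightarrow> ('m, 'e) chart \<Rightarrow> bool" where
  "compatible c c' \<longleftrightarrow>
     smooth_on (snd c ` (fst c \<inter> fst c')) (transition c c') \<and>
     smooth_on (snd c' ` (fst c \<inter> fst c')) (transition c' c)"

text \<open>\<open>A\<close> is the maximal smooth atlas.\<close>

definition smooth_manifold :: "'m topology \<Rightarrow> ('m, 'e::euclidean_space) chart set \<Rightarrow> bool" where
  "smooth_manifold M A \<longleftrightarrow>
     Hausdorff_space M \<and> second_countable M \<and>
     (\<forall>c\<in>A. is_chart M c) \<and> \<Union>(fst ` A) = topspace M \<and>
     (\<forall>c\<in>A. \<forall>c'\<in>A. compatible c c') \<and>
     (\<forall>c. is_chart M c \<and> (\<forall>c'\<in>A. compatible c c') \<longrightarrow> c \<in> A)"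

text \<open>A tangent vector at \<open>x\<close> is given by its coordinates in all charts around \<open>x\<close>, which are
  related by the differentials of the transition maps (and set to 0 in all other charts).\<close>

type_synonym ('m, 'e) tvec = "('m, 'e) chart \<Rightarrow> 'e"

definition charts_at :: "('m, 'e) chart set \<Rightarrow> 'm \<Rightarrow> ('m, 'e) chart set" where
  "charts_at A x = {c \<in> A. x \<in> fst c}"

definition tangent_space :: "('m, 'e::euclidean_space) chart set \<Rightarrow> 'm \<Rightarrow> ('m, 'e) tvec set" where
  "tangent_space A x = {v.
     (\<forall>c\<in>charts_at A x. \<forall>c'\<in>charts_at A x.
        v c' = frechet_derivative (transition c c') (at (snd c x)) (v c)) \<and>
     (\<forall>c. c \<notin> charts_at A x \<longrightarrow> v c = 0)}"

text \<open>The tangent vector at \<open>x\<close> whose coordinates in the chart \<open>c\<close> are \<open>e\<close>.\<close>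

definition coord_vec :: "('m, 'e::euclidean_space) chart set \<Rightarrow> ('m, 'e) chart \<Rightarrow> 'm \<Rightarrow> 'e \<Rightarrow> ('m, 'e) tvec" where
  "coord_vec A c x e = (\<lambda>c'. if c' \<in> charts_at A x
     then frechet_derivative (transition c c') (at (snd c x)) e else 0)"


section \<open>Riemannian metrics and differential forms\<close>

type_synonym ('m, 'e) metric = "'m \<Rightarrow> ('m, 'e) tvec \<Rightarrow> ('m, 'e) tvec \<Rightarrow> real"

type_synonym ('m, 'e) diff_form = "'m \<Rightarrow> ('m, 'e) tvec form"

definition local_metric :: "('m, 'e::euclidean_space) chart set \<Rightarrow> ('m, 'e) metric \<Rightarrow> ('m, 'e) chart \<Rightarrow>
    'e \<Rightarrow> 'e \<Rightarrow> 'e \<Rightarrow> real" where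
  "local_metric A g c y u w =
     g (chart_inv c y) (coord_vec A c (chart_inv c y) u) (coord_vec A c (chart_inv c y) w)"

definition riemannian_metric :: "'m topology \<Rightarrow> ('m, 'e::euclidean_space) chart set \<Rightarrow> ('m, 'e) metric \<Rightarrow> bool" where
  "riemannian_metric M A g \<longleftrightarrow>
     (\<forall>x\<in>topspace M. inner_product_on (tangent_space A x) (g x)) \<and>
     (\<forall>c\<in>A. \<forall>u w. smooth_on (snd c ` fst c) (\<lambda>y. local_metric A g c y u w))"

definition riemannian_manifold :: "'m topology \<Rightarrow> ('m, 'e::euclidean_space) chart set \<Rightarrow> ('m, 'e) metric \<Rightarrow> bool" where
  "riemannian_manifold M A g \<longleftrightarrow> smooth_manifold M A \<and> riemannian_metric M A g"

definition local_form :: "('m, 'e::euclidean_space) chart set \<Rightarrow> ('m, 'e) diff_form \<Rightarrow> ('m, 'e) chart \<Rightarrow>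
    'e \<Rightarrow> 'e list \<Rightarrow> real" where
  "local_form A \<omega> c y es = \<omega> (chart_inv c y) (map (coord_vec A c (chart_inv c y)) es)"

definition smooth_form :: "'m topology \<Rightarrow> ('m, 'e::euclidean_space) chart set \<Rightarrow> nat \<Rightarrow> ('m, 'e) diff_form \<Rightarrow> bool" where
  "smooth_form M A p \<omega> \<longleftrightarrow>
     (\<forall>x\<in>topspace M. \<omega> x \<in> alt_forms p (tangent_space A x)) \<and>
     (\<forall>c\<in>A. \<forall>es. length es = p \<longrightarrow> smooth_on (snd c ` fst c) (\<lambda>y. local_form A \<omega> c y es))"

text \<open>The exterior derivative of a \<open>p\<close>-form in the chart \<open>c\<close>, on constant vector fields
  \<open>es ! 0, \<dots>, es ! p\<close>.\<close>

definition local_ext_deriv :: "('m, 'e::euclidean_space) chart set \<Rightarrow> nat \<Rightarrow> ('m, 'e) diff_form \<Rightarrow> ('m, 'e) chart \<Rightarrow>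
    'e \<Rightarrow> 'e list \<Rightarrow> real" where
  "local_ext_deriv A p \<omega> c y es = (\<Sum>i\<le>p. (-1) ^ i *
     frechet_derivative (\<lambda>z. local_form A \<omega> c z (take i es @ drop (Suc i) es)) (at y) (es ! i))"

definition closed_form :: "('m, 'e::euclidean_space) chart set \<Rightarrow> nat \<Rightarrow> ('m, 'e) diff_form \<Rightarrow> bool" where
  "closed_form A p \<omega> \<longleftrightarrow> (\<forall>c\<in>A. \<forall>y\<in>snd c ` fst c. \<forall>es. length es = Suc p \<longrightarrow>
     local_ext_deriv A p \<omega> c y es = 0)"

text \<open>The Christoffel symbol of the Levi-Civita connection, as a bilinear map: with \<open>G\<close> the metric in
  the chart, \<open>2 G(\<Gamma>(u,w), e) = (D\<^sub>u G)(w,e) + (D\<^sub>w G)(u,e) - (D\<^sub>e G)(u,w)\<close> for all \<open>e\<close>. This is the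
  Koszul formula for constant vector fields, so \<open>\<Gamma>(u,w)\<close> is the covariant derivative of the constant
  field \<open>w\<close> in the direction \<open>u\<close>.\<close>

definition christoffel :: "('m, 'e::euclidean_space) chart set \<Rightarrow> ('m, 'e) metric \<Rightarrow> ('m, 'e) chart \<Rightarrow>
    'e \<Rightarrow> 'e \<Rightarrow> 'e \<Rightarrow> 'e" where
  "christoffel A g c y u w = (THE z. \<forall>e.
     2 * local_metric A g c y z e =
       frechet_derivative (\<lambda>t. local_metric A g c t w e) (at y) u +
       frechet_derivative (\<lambda>t. local_metric A g c t u e) (at y) w -
       frechet_derivative (\<lambda>t. local_metric A g c t u w) (at y) e)"

text \<open>The covariant derivative of a \<open>p\<close>-form in the chart \<open>c\<close> in the direction \<open>u\<close>.\<close>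

definition local_cov_deriv :: "('m, 'e::euclidean_space) chart set \<Rightarrow> ('m, 'e) metric \<Rightarrow> nat \<Rightarrow> ('m, 'e) diff_form \<Rightarrow>
    ('m, 'e) chart \<Rightarrow> 'e \<Rightarrow> 'e \<Rightarrow> 'e list \<Rightarrow> real" where
  "local_cov_deriv A g p \<omega> c y u es =
     frechet_derivative (\<lambda>z. local_form A \<omega> c z es) (at y) u -
     (\<Sum>a<p. local_form A \<omega> c y (es[a := christoffel A g c y u (es ! a)]))"

definition parallel_form :: "('m, 'e::euclidean_space) chart set \<Rightarrow> ('m, 'e) metric \<Rightarrow> nat \<Rightarrow> ('m, 'e) diff_form \<Rightarrow> bool" where
  "parallel_form A g p \<omega> \<longleftrightarrow> (\<forall>c\<in>A. \<forall>y\<in>snd c ` fst c. \<forall>u es. length es = p \<longrightarrow>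
     local_cov_deriv A g p \<omega> c y u es = 0)"

definition calibration :: "'m topology \<Rightarrow> ('m, 'e::euclidean_space) chart set \<Rightarrow> ('m, 'e) metric \<Rightarrow> nat \<Rightarrow>
    ('m, 'e) diff_form \<Rightarrow> bool" where
  "calibration M A g p \<phi> \<longleftrightarrow> smooth_form M A p \<phi> \<and> closed_form A p \<phi> \<and>
     (\<forall>x\<in>topspace M. \<forall>\<xi>\<in>Gr_o p (tangent_space A x) (g x). pairing (\<phi> x) \<xi> \<le> 1)"

definition parallel_calibration :: "'m topology \<Rightarrow> ('m, 'e::euclidean_space) chart set \<Rightarrow> ('m, 'e) metric \<Rightarrow> nat \<Rightarrow>
    ('m, 'e) diff_form \<Rightarrow> bool" where
  "parallel_calibration M A g p \<phi> \<longleftrightarrow> calibration M A g p \<phi> \<and> parallel_form A g p \<phi>"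


section \<open>The bundle associated with a parallel calibration and its sections\<close>

text \<open>The fibre at \<open>x\<close> is the pullback of \<open>Phi\<close> at the base point \<open>x0\<close> under a linear isometry
  \<open>u\<close> from the tangent space at \<open>x\<close> to the one at \<open>x0\<close> that pulls \<open>\<phi> x0\<close> back to \<open>\<phi> x\<close>. As
  this pullback does not depend on \<open>u\<close>, it is written as the union over all admissible \<open>u\<close>.\<close>

definition Phi_M :: "('m, 'e::euclidean_space) chart set \<Rightarrow> ('m, 'e) metric \<Rightarrow> nat \<Rightarrow> ('m, 'e) diff_form \<Rightarrow> 'm \<Rightarrow>
    'm \<Rightarrow> ('m, 'e) tvec form set" where
  "Phi_M A g p \<phi> x0 x =
     (\<Union>u\<in>{u. linear_isometry (tangent_space A x) (g x) (tangent_space A x0) (g x0) u \<and>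
              pullback p (tangent_space A x) u (\<phi> x0) = \<phi> x}.
        pullback p (tangent_space A x) u ` Phi p (tangent_space A x0) (g x0) (\<phi> x0))"

definition P_forms :: "'m topology \<Rightarrow> ('m, 'e::euclidean_space) chart set \<Rightarrow> ('m, 'e) metric \<Rightarrow> nat \<Rightarrow>
    ('m, 'e) diff_form \<Rightarrow> 'm \<Rightarrow> ('m, 'e) diff_form set" where
  "P_forms M A g p \<phi> x0 = {\<psi>. smooth_form M A p \<psi> \<and> (\<forall>x\<in>topspace M. \<psi> x \<in> Phi_M A g p \<phi> x0 x)}"


section \<open>Oriented submanifolds\<close>

text \<open>
  A submanifold is a subset of \<open>M\<close> carrying its own topology \<open>N\<close> such that every point has an
  \<open>N\<close>-open neighbourhood \<open>W\<close> that is an embedded slice of some chart: \<open>W\<close> corresponds to a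
  \<open>p\<close>-dimensional linear subspace \<open>S\<close> and has the topology induced from \<open>M\<close>. These are the
  injectively immersed submanifolds; the embedded ones are those whose topology is globally the
  subspace topology.
\<close>

definition slice :: "'m topology \<Rightarrow> ('m, 'e::euclidean_space) chart set \<Rightarrow> nat \<Rightarrow> 'm topology \<Rightarrow>
    ('m, 'e) chart \<Rightarrow> 'e set \<Rightarrow> 'm set \<Rightarrow> bool" where
  "slice M A p N c S W \<longleftrightarrow> c \<in> A \<and> subspace S \<and> dim S = p \<and>
     openin N W \<and> W \<subseteq> fst c \<and> snd c ` W = snd c ` fst c \<inter> S \<and>
     subtopology N W = subtopology M W"

definition submanifold :: "'m topology \<Rightarrow> ('m, 'e::euclidean_space) chart set \<Rightarrow> nat \<Rightarrow> 'm topology \<Rightarrow> bool" where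
  "submanifold M A p N \<longleftrightarrow> topspace N \<subseteq> topspace M \<and> second_countable N \<and>
     (\<forall>x\<in>topspace N. \<exists>c S W. slice M A p N c S W \<and> x \<in> W)"

definition tangent_sub :: "'m topology \<Rightarrow> ('m, 'e::euclidean_space) chart set \<Rightarrow> nat \<Rightarrow> 'm topology \<Rightarrow>
    'm \<Rightarrow> ('m, 'e) tvec set" where
  "tangent_sub M A p N x = {v \<in> tangent_space A x. \<exists>c S W. slice M A p N c S W \<and> x \<in> W \<and> v c \<in> S}"

text \<open>An orientation is the choice of one of the two unit \<open>p\<close>-vectors \<open>\<xi> x\<close> of each tangent space
  of \<open>N\<close> such that, locally, the coordinate frames of a slice chart are positively oriented.\<close>

definition orientation :: "'m topology \<Rightarrow> ('m, 'e::euclidean_space) chart set \<Rightarrow> ('m, 'e) metric \<Rightarrow> nat \<Rightarrow>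
    'm topology \<Rightarrow> ('m \<Rightarrow> ('m, 'e) tvec mvec) \<Rightarrow> bool" where
  "orientation M A g p N \<xi> \<longleftrightarrow>
     (\<forall>x\<in>topspace N. \<exists>es\<in>tuples p (tangent_sub M A p N x).
        orthonormal (g x) es \<and> \<xi> x = wedge p (tangent_space A x) es) \<and>
     (\<forall>x\<in>topspace N. \<exists>c S W. slice M A p N c S W \<and> x \<in> W \<and>
        (\<exists>bs\<in>tuples p S. \<forall>y\<in>W. \<exists>r>0.
           wedge p (tangent_space A y) (map (coord_vec A c y) bs) = r *\<^sub>R \<xi> y))"

definition oriented_submanifold :: "'m topology \<Rightarrow> ('m, 'e::euclidean_space) chart set \<Rightarrow> ('m, 'e) metric \<Rightarrow> nat \<Rightarrow>
    'm topology \<Rightarrow> ('m \<Rightarrow> ('m, 'e) tvec mvec) \<Rightarrow> bool" where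
  "oriented_submanifold M A g p N \<xi> \<longleftrightarrow> submanifold M A p N \<and> orientation M A g p N \<xi>"

definition critical_submanifold :: "('m, 'e::euclidean_space) chart set \<Rightarrow> ('m, 'e) metric \<Rightarrow> nat \<Rightarrow>
    ('m, 'e) diff_form \<Rightarrow> 'm topology \<Rightarrow> ('m \<Rightarrow> ('m, 'e) tvec mvec) \<Rightarrow> bool" where
  "critical_submanifold A g p \<phi> N \<xi> \<longleftrightarrow>
     (\<forall>x\<in>topspace N. \<xi> x \<in> critical_points p (tangent_space A x) (g x) (\<phi> x))"

definition calibrated_submanifold :: "('m, 'e) diff_form \<Rightarrow> 'm topology \<Rightarrow> ('m \<Rightarrow> ('m, 'e) tvec mvec) \<Rightarrow> bool" where
  "calibrated_submanifold \<phi> N \<xi> \<longleftrightarrow> (\<forall>x\<in>topspace N. pairing (\<phi> x) (\<xi> x) = 1)"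

definition integral_manifold :: "'m topology \<Rightarrow> ('m, 'e::euclidean_space) chart set \<Rightarrow> nat \<Rightarrow>
    ('m, 'e) diff_form set \<Rightarrow> 'm topology \<Rightarrow> bool" where
  "integral_manifold M A p P N \<longleftrightarrow>
     (\<forall>\<psi>\<in>P. \<forall>x\<in>topspace N. \<forall>vs\<in>tuples p (tangent_sub M A p N x). \<psi> x vs = 0)"

end

(*
  Let es be an orthonormal frame of a p-plane in V. The tangent space of the Grassmannian at es is
  spanned by the velocities of es[a := cos t e_a + sin t w] with w orthogonal to es, so es is critical
  for phi iff phi(es[a := w]) = 0 for all such a and w. A smooth curve of p-vectors near es equals
  D(t) h_1(t) /\ ... /\ h_p(t), where h_a - e_a is orthogonal to es and D^2 det(h_a . h_b) = 1, which
  forces D'(0) = 0; this shows that these curves suffice.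

  On the other hand (theta.phi)(es) only involves the components of theta e_a orthogonal to es, and
  the rotations theta in the plane of e_a and w give exactly the values phi(es[a := w]).

  To realise phi(es[a := w]) by a global section of the bundle, cut the field of rotations with
  constant coordinates in a chart off by a bump function. It takes values in Phi_M because parallel
  transport (a linear ODE in charts, and connectedness of M) provides isometries between all
  tangent spaces that respect phi.
*)
theory Submission
  imports Defs "Jordan_Normal_Form.Determinant"
begin

section \<open>Multilinear maps along curves\<close>

text \<open>Two obstacles shape the proof. A curve in \<open>Gr_o\<close> is known only through its
  pairings with forms, so no frame moving along it is given: one is reconstructed by Cramer's rule,
  with quotients of determinant forms as coordinates, before anything can be differentiated. And
  tangent vectors, being functions on the set of charts, carry no norm, so moving vectors are
  differentiated through real coefficients in a fixed finite family. One product rule of this kind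
  serves three times: for \<phi> along a curve of planes, for the Gram matrix of the moving frame,
  and for the constancy of parallel tensors. The fibre of \<open>Phi_M\<close> is a union over
  isometries and would be empty if there were none. An element of it brings its own isometry, so
  passing from critical to integral works with that one; only the converse uses transport. Short
  straight segments in charts suffice there, because the existence of a suitable isometry is an
  equivalence relation with open classes. The isometry must respect metric and form at once, hence
  the metric is read as a parallel function of two-element lists.\<close>

lemma linear_between_sum:
  assumes "subspace V" "linear_between V W f" "\<And>j. j \<in> J \<Longrightarrow> b j \<in> V"
  shows "f (\<Sum>j\<in>J. c j *\<^sub>R b j) = (\<Sum>j\<in>J. c j *\<^sub>R f (b j))"
proof -
  have f0: "f 0 = 0"
    using assms(1,2) subspace_0[of V] unfolding linear_between_def by (metis scale_zero_left)
  show ?thesis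
    using assms(3)
  proof (induction J rule: infinite_finite_induct)
    case (insert x F)
    have "(\<Sum>j\<in>F. c j *\<^sub>R b j) \<in> V" "c x *\<^sub>R b x \<in> V" "b x \<in> V"
      using insert assms(1) by (auto intro!: subspace_sum subspace_mul)
    then show ?case using insert assms(2) unfolding linear_between_def by simp
  qed (use f0 in auto)
qed

lemma tuples_length: "vs \<in> tuples p V \<Longrightarrow> length vs = p"
  by (simp add: tuples_def)

lemma tuples_nth: "vs \<in> tuples p V \<Longrightarrow> i < p \<Longrightarrow> vs ! i \<in> V"
  unfolding tuples_def using nth_mem by blast

lemma tuples_iff: "vs \<in> tuples p V \<longleftrightarrow> length vs = p \<and> (\<forall>i<p. vs ! i \<in> V)"
  unfolding tuples_def set_conv_nth by blast

lemma tuples_update: "vs \<in> tuples p V \<Longrightarrow> v \<in> V \<Longrightarrow> vs[i := v] \<in> tuples p V"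
  unfolding tuples_iff by (metis length_list_update nth_list_update_eq nth_list_update_neq)

text \<open>Weaker than membership in \<open>alt_forms\<close>: symmetric functions such as the
  metric, read as a function of a two-element list, are to be covered by the same product
  rule.\<close>

definition multilin :: "nat \<Rightarrow> 'v::real_vector set \<Rightarrow> ('v list \<Rightarrow> real) \<Rightarrow> bool" where
  "multilin p V \<alpha> \<longleftrightarrow> (\<forall>vs\<in>tuples p V. \<forall>i<p. linear_between V UNIV (\<lambda>v. \<alpha> (vs[i := v])))"

lemma alt_forms_multilin: "\<alpha> \<in> alt_forms p V \<Longrightarrow> multilin p V \<alpha>"
  by (simp add: alt_forms_def multilin_def)

lemma multilin_sum:
  assumes "subspace V" "multilin p V \<alpha>" "vs \<in> tuples p V" "i < p" "\<And>j. j \<in> J \<Longrightarrow> b j \<in> V"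
  shows "\<alpha> (vs[i := \<Sum>j\<in>J. c j *\<^sub>R b j]) = (\<Sum>j\<in>J. c j * \<alpha> (vs[i := b j]))"
  using linear_between_sum[OF assms(1), of UNIV "\<lambda>v. \<alpha> (vs[i := v])" J b c] assms(2-)
  unfolding multilin_def by simp

lemma multilin_add:
  assumes "multilin p V \<alpha>" "vs \<in> tuples p V" "i < p" "v \<in> V" "w \<in> V"
  shows "\<alpha> (vs[i := v + w]) = \<alpha> (vs[i := v]) + \<alpha> (vs[i := w])"
  using assms unfolding multilin_def linear_between_def by blast

lemma multilin_scaleR:
  assumes "multilin p V \<alpha>" "vs \<in> tuples p V" "i < p" "v \<in> V"
  shows "\<alpha> (vs[i := r *\<^sub>R v]) = r * \<alpha> (vs[i := v])"
  using assms unfolding multilin_def linear_between_def by (metis real_scaleR_def)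

text \<open>Differentiating the expansion of \<open>\<alpha> t\<close> in slot \<open>k\<close>
  gives the same expansion for \<open>\<alpha>'\<close>, because derivatives are unique; this is the
  purpose of \<open>nb\<close>.\<close>

lemma derivative_multilin_sum:
  assumes V: "subspace V" and b: "\<And>j. j \<in> J \<Longrightarrow> b j \<in> V"
    and t0: "t0 \<in> T" and nb: "at t0 within T \<noteq> bot"
    and ml: "\<And>t. t \<in> T \<Longrightarrow> multilin p V (\<alpha> t)"
    and d: "\<And>vs. vs \<in> tuples p V \<Longrightarrow> ((\<lambda>t. \<alpha> t vs) has_real_derivative \<alpha>' vs) (at t0 within T)"
    and vs: "vs \<in> tuples p V" and k: "k < p"
  shows "\<alpha>' (vs[k := \<Sum>j\<in>J. c j *\<^sub>R b j]) = (\<Sum>j\<in>J. c j * \<alpha>' (vs[k := b j]))"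
proof -
  have "(\<Sum>j\<in>J. c j *\<^sub>R b j) \<in> V" using V b by (auto intro!: subspace_sum subspace_mul)
  then have 1: "((\<lambda>t. \<alpha> t (vs[k := \<Sum>j\<in>J. c j *\<^sub>R b j])) has_real_derivative \<alpha>' (vs[k := \<Sum>j\<in>J. c j *\<^sub>R b j])) (at t0 within T)"
    by (intro d tuples_update vs)
  have "((\<lambda>t. \<Sum>j\<in>J. c j * \<alpha> t (vs[k := b j])) has_real_derivative (\<Sum>j\<in>J. c j * \<alpha>' (vs[k := b j]))) (at t0 within T)"
    by (intro DERIV_sum DERIV_cmult d tuples_update vs b)
  then have 2: "((\<lambda>t. \<alpha> t (vs[k := \<Sum>j\<in>J. c j *\<^sub>R b j])) has_real_derivative (\<Sum>j\<in>J. c j * \<alpha>' (vs[k := b j]))) (at t0 within T)"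
    by (rule has_field_derivative_transform_within[where d = 1]) (use t0 in \<open>simp_all add: multilin_sum[OF V ml vs k b]\<close>)
  show ?thesis using has_field_derivative_unique[OF 1 2 nb] by simp
qed

text \<open>Product rule with the form and its arguments both moving. The arguments move through
  real coefficients \<open>m a j\<close> in the fixed family \<open>b\<close>, since
  \<open>'v\<close> has no norm in which \<open>H\<close> itself could be differentiated.\<close>

lemma multilin_has_derivative:
  assumes V: "subspace V" and b: "\<And>j. j \<in> J \<Longrightarrow> b j \<in> V"
    and t0: "t0 \<in> T" and nb: "at t0 within T \<noteq> bot"
    and ml: "\<And>t. t \<in> T \<Longrightarrow> multilin p V (\<alpha> t)"
    and d: "\<And>vs. vs \<in> tuples p V \<Longrightarrow> ((\<lambda>t. \<alpha> t vs) has_real_derivative \<alpha>' vs) (at t0 within T)"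
    and m: "\<And>a j. a < p \<Longrightarrow> j \<in> J \<Longrightarrow> ((\<lambda>t. m a j t) has_real_derivative m' a j) (at t0 within T)"
    and H: "\<And>t. t \<in> T \<Longrightarrow> H t \<in> tuples p V"
    and Hm: "\<And>t a. t \<in> T \<Longrightarrow> a < p \<Longrightarrow> H t ! a = (\<Sum>j\<in>J. m a j t *\<^sub>R b j)"
  shows "((\<lambda>t. \<alpha> t (H t)) has_real_derivative
            \<alpha>' (H t0) + (\<Sum>a<p. \<alpha> t0 ((H t0)[a := \<Sum>j\<in>J. m' a j *\<^sub>R b j]))) (at t0 within T)"
proof -
  define h where "h a = (\<Sum>j\<in>J. m' a j *\<^sub>R b j)" for a
  have hV: "h a \<in> V" for a unfolding h_def using V b by (auto intro!: subspace_sum subspace_mul)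
  define L where "L k vs t = take k (H t) @ drop k vs" for k vs t
  have LV: "L k vs t \<in> tuples p V" if "t \<in> T" "vs \<in> tuples p V" "k \<le> p" for k vs t
    using H[OF that(1)] that(2,3) set_take_subset[of k "H t"] set_drop_subset[of k vs] unfolding L_def tuples_def by auto
  \<comment> \<open>Induction on the number of slots that vary with \<open>t\<close>: the last one is expanded in the vectors \<open>b j\<close>,
    which makes it constant.\<close>
  have "((\<lambda>t. \<alpha> t (L k vs t)) has_real_derivative
           \<alpha>' (L k vs t0) + (\<Sum>a<k. \<alpha> t0 ((L k vs t0)[a := h a]))) (at t0 within T)"
    if "k \<le> p" "vs \<in> tuples p V" for k vs
    using that
  proof (induction k arbitrary: vs)
    case 0
    then show ?case using d[of vs] by (simp add: L_def)
  next
    case (Suc k)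
    then have k: "k < p" and vs: "vs \<in> tuples p V" by auto
    have upd: "(L k vs t)[k := v] = L k (vs[k := v]) t" if "t \<in> T" for t v
      using tuples_length[OF H[OF that]] tuples_length[OF vs] k
      by (intro nth_equalityI) (auto simp: L_def nth_append nth_list_update)
    have LS: "L (Suc k) vs t = (L k vs t)[k := H t ! k]" if "t \<in> T" for t
      using tuples_length[OF H[OF that]] tuples_length[OF vs] k
      by (intro nth_equalityI) (auto simp: L_def nth_append nth_list_update less_Suc_eq)
    have LSu: "(L (Suc k) vs t0)[k := v] = L k (vs[k := v]) t0" for v
      by (simp add: LS[OF t0] upd[OF t0, symmetric])
    have L0: "L k vs t \<in> tuples p V" if "t \<in> T" for t using LV[OF that vs] k by simp
    have LS0: "L (Suc k) vs t0 \<in> tuples p V" using LV[OF t0 vs] k by simp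
    have split: "\<alpha> t (L (Suc k) vs t) = (\<Sum>j\<in>J. m k j t * \<alpha> t (L k (vs[k := b j]) t))" if "t \<in> T" for t
      using multilin_sum[OF V ml[OF that] L0[OF that] k b] by (simp add: LS Hm that k upd)
    have "((\<lambda>t. \<Sum>j\<in>J. m k j t * \<alpha> t (L k (vs[k := b j]) t)) has_real_derivative
       (\<Sum>j\<in>J. m k j t0 * (\<alpha>' (L k (vs[k := b j]) t0) + (\<Sum>a<k. \<alpha> t0 ((L k (vs[k := b j]) t0)[a := h a])))
          + m' k j * \<alpha> t0 (L k (vs[k := b j]) t0))) (at t0 within T)"
      by (intro DERIV_sum DERIV_mult' m k Suc.IH tuples_update vs b) (use k in auto)
    then have D: "((\<lambda>t. \<alpha> t (L (Suc k) vs t)) has_real_derivative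
       (\<Sum>j\<in>J. m k j t0 * (\<alpha>' (L k (vs[k := b j]) t0) + (\<Sum>a<k. \<alpha> t0 ((L k (vs[k := b j]) t0)[a := h a])))
          + m' k j * \<alpha> t0 (L k (vs[k := b j]) t0))) (at t0 within T)"
      by (rule has_field_derivative_transform_within[where d = 1]) (use t0 in \<open>simp_all add: split\<close>)
    have e1: "(\<Sum>j\<in>J. m k j t0 * \<alpha>' (L k (vs[k := b j]) t0)) = \<alpha>' (L (Suc k) vs t0)"
      using derivative_multilin_sum[OF V b t0 nb ml d LS0 k, where c = "\<lambda>j. m k j t0"]
      by (simp add: LSu) (simp add: LS[OF t0] upd[OF t0] Hm[OF t0 k])
    have e2: "(\<Sum>j\<in>J. m' k j * \<alpha> t0 (L k (vs[k := b j]) t0)) = \<alpha> t0 ((L (Suc k) vs t0)[k := h k])"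
      using multilin_sum[OF V ml[OF t0] LS0 k b, where c = "m' k"] by (simp add: LSu h_def)
    \<comment> \<open>In a slot \<open>a < k\<close> the update commutes with that of slot
      \<open>k\<close>, so the sum over \<open>j\<close> recombines to \<open>H t0 ! k\<close>,
      which slot \<open>k\<close> of \<open>L (Suc k) vs t0\<close> already holds.\<close>
    have e3: "(\<Sum>j\<in>J. m k j t0 * \<alpha> t0 ((L k (vs[k := b j]) t0)[a := h a])) = \<alpha> t0 ((L (Suc k) vs t0)[a := h a])"
      if "a < k" for a
    proof -
      have sw: "(L k (vs[k := v]) t0)[a := h a] = (L (Suc k) vs t0)[a := h a, k := v]" for v
        using that by (simp add: LSu[symmetric] list_update_swap)
      have "H t0 ! k = (L (Suc k) vs t0)[a := h a] ! k"
        using that k tuples_length[OF LS0] LS[OF t0] tuples_length[OF L0[OF t0]] by simp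
      then have "(L (Suc k) vs t0)[a := h a, k := H t0 ! k] = (L (Suc k) vs t0)[a := h a]"
        by (metis list_update_id)
      then show ?thesis
        using multilin_sum[where J = J and b = b and c = "\<lambda>j. m k j t0", OF V ml[OF t0] tuples_update[OF LS0 hV[of a], of a] k b]
        unfolding sw Hm[OF t0 k] by simp
    qed
    have "(\<Sum>j\<in>J. m k j t0 * (\<Sum>a<k. \<alpha> t0 ((L k (vs[k := b j]) t0)[a := h a])))
        = (\<Sum>a<k. \<Sum>j\<in>J. m k j t0 * \<alpha> t0 ((L k (vs[k := b j]) t0)[a := h a]))"
      by (subst sum.swap) (simp add: sum_distrib_left)
    also have "\<dots> = (\<Sum>a<k. \<alpha> t0 ((L (Suc k) vs t0)[a := h a]))"
      by (intro sum.cong refl) (simp add: e3)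
    finally show ?case using D by (simp add: distrib_left sum.distrib e1 e2 add_ac)
  qed
  moreover have "L p (H t0) t = H t" if "t \<in> T" for t
    using that t0 by (simp add: L_def tuples_length[OF H])
  ultimately have "((\<lambda>t. \<alpha> t (L p (H t0) t)) has_real_derivative
           \<alpha>' (H t0) + (\<Sum>a<p. \<alpha> t0 ((H t0)[a := h a]))) (at t0 within T)"
    using H[OF t0] t0 by (metis order_refl)
  then show ?thesis unfolding h_def
    by (rule has_field_derivative_transform_within[where d = 1])
       (use t0 \<open>\<And>t. t \<in> T \<Longrightarrow> L p (H t0) t = H t\<close> in simp_all)
qed

section \<open>Determinant forms and decomposable vectors\<close>

text \<open>The wedge product of the covectors \<open>l 0\<close>, ..., \<open>l (p - 1)\<close>,
  evaluated on \<open>p\<close> vectors.\<close>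

definition det_form :: "nat \<Rightarrow> 'v set \<Rightarrow> (nat \<Rightarrow> 'v \<Rightarrow> real) \<Rightarrow> 'v form" where
  "det_form p V l = (\<lambda>vs. if vs \<in> tuples p V then Determinant.det (Matrix.mat p p (\<lambda>(a, b). l a (vs ! b))) else 0)"

lemma det_form_alt:
  assumes V: "subspace V" and l: "\<And>a. a < p \<Longrightarrow> linear_between V UNIV (l a)"
  shows "det_form p V l \<in> alt_forms p V"
proof -
  \<comment> \<open>Leibniz formula by columns with the factor of column \<open>i\<close> taken out,
    so that every summand is visibly linear in \<open>v\<close>.\<close>
  have expand: "det_form p V l (vs[i := v]) =
      (\<Sum>\<pi> | \<pi> permutes {0..<p}. signof \<pi> * (l (\<pi> i) v * (\<Prod>j\<in>{..<p} - {i}. l (\<pi> j) (vs ! j))))"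
    if vs: "vs \<in> tuples p V" and i: "i < p" and v: "v \<in> V" for vs i v
  proof -
    have "(\<Prod>j<p. Matrix.mat p p (\<lambda>(a, b). l a (vs[i := v] ! b)) $$ (\<pi> j, j))
        = l (\<pi> i) v * (\<Prod>j\<in>{..<p} - {i}. l (\<pi> j) (vs ! j))" if \<pi>: "\<pi> permutes {0..<p}" for \<pi>
    proof -
      have \<pi>j: "\<pi> j < p" if "j < p" for j using permutes_in_image[OF \<pi>, of j] that by simp
      have "(\<Prod>j<p. Matrix.mat p p (\<lambda>(a, b). l a (vs[i := v] ! b)) $$ (\<pi> j, j)) = (\<Prod>j<p. l (\<pi> j) (vs[i := v] ! j))"
        by (intro prod.cong) (auto simp: \<pi>j)
      also have "\<dots> = l (\<pi> i) (vs[i := v] ! i) * (\<Prod>j\<in>{..<p} - {i}. l (\<pi> j) (vs[i := v] ! j))"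
        using i by (subst prod.remove[of _ i]) auto
      also have "\<dots> = l (\<pi> i) v * (\<Prod>j\<in>{..<p} - {i}. l (\<pi> j) (vs ! j))"
        using i tuples_length[OF vs] by (auto intro!: arg_cong2[where f = "(*)"] prod.cong)
      finally show ?thesis .
    qed
    then show ?thesis using tuples_update[OF vs v]
      by (simp add: det_form_def det_col[of _ p])
  qed
  have "linear_between V UNIV (\<lambda>v. det_form p V l (vs[i := v]))"
    if vs: "vs \<in> tuples p V" and i: "i < p" for vs i
  proof -
    have li: "linear_between V UNIV (l (\<pi> i))" if "\<pi> permutes {0..<p}" for \<pi>
      using permutes_in_image[OF that, of i] i by (intro l) simp
    show ?thesis unfolding linear_between_def
    proof (intro conjI ballI allI)
      fix v w assume "v \<in> V" "w \<in> V"
      then show "det_form p V l (vs[i := v + w]) = det_form p V l (vs[i := v]) + det_form p V l (vs[i := w])"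
        using li by (auto simp: expand[OF vs i] subspace_add[OF V] subspace_mul[OF V] sum.distrib[symmetric] linear_between_def algebra_simps intro!: sum.cong)
    next
      fix r v assume "v \<in> V"
      then show "det_form p V l (vs[i := r *\<^sub>R v]) = r *\<^sub>R det_form p V l (vs[i := v])"
        using li by (auto simp: expand[OF vs i] subspace_add[OF V] subspace_mul[OF V] sum_distrib_left linear_between_def algebra_simps intro!: sum.cong)
    qed simp
  qed
  moreover have "det_form p V l vs = 0"
    if "vs \<in> tuples p V" "i < p" "j < p" "i \<noteq> j" "vs ! i = vs ! j" for vs i j
    using that unfolding det_form_def
    by (simp, intro det_identical_columns[of _ p i j]) (auto simp: col_def)
  ultimately show ?thesis using subspace_add[OF V] subspace_mul[OF V] unfolding alt_forms_def
    by (auto simp: det_form_def[of p V l])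
qed

lemma det_form_dual:
  assumes "vs \<in> tuples p V" and "\<And>a b. a < p \<Longrightarrow> b < p \<Longrightarrow> l a (vs ! b) = (if a = b then 1 else 0)"
  shows "det_form p V l vs = 1"
proof -
  have "Matrix.mat p p (\<lambda>(a, b). l a (vs ! b)) = 1\<^sub>m p" using assms(2) by (intro eq_matI) auto
  then show ?thesis using assms(1) by (simp add: det_form_def)
qed

text \<open>Cramer's rule: replacing the functional of row \<open>c\<close> leaves all other rows of
  an identity matrix intact. With a coordinate functional for \<open>f\<close>, the determinant
  reads off a coordinate of \<open>vs ! c\<close>.\<close>

lemma det_form_dual_update:
  assumes vs: "vs \<in> tuples p V" and dual: "\<And>a b. a < p \<Longrightarrow> b < p \<Longrightarrow> l a (vs ! b) = (if a = b then 1 else 0)"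
    and c: "c < p"
  shows "det_form p V (l(c := f)) vs = f (vs ! c)"
proof -
  let ?M = "Matrix.mat p p (\<lambda>(a, b). (l(c := f)) a (vs ! b))"
  have zero: "(\<Prod>i = 0..<p. ?M $$ (i, \<pi> i)) = 0" if \<pi>: "\<pi> permutes {0..<p}" and "\<pi> \<noteq> id" for \<pi>
  proof -
    \<comment> \<open>A permutation that fixes every row other than \<open>c\<close> fixes
      \<open>c\<close> as well, by injectivity; any other one meets an off-diagonal zero of an
      unchanged row.\<close>
    have "\<exists>i<p. i \<noteq> c \<and> \<pi> i \<noteq> i"
    proof (rule ccontr)
      assume *: "\<not> ?thesis"
      have "\<pi> i = i" for i
      proof (cases "i < p \<and> i = c")
        case True
        have "\<pi> c < p" using permutes_in_image[OF \<pi>, of c] c by simp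
        then have "\<pi> (\<pi> c) = \<pi> c \<or> \<pi> c = c" using * by blast
        then show ?thesis using permutes_inj[OF \<pi>] True by (metis injD)
      next
        case False
        then show ?thesis using * permutes_not_in[OF \<pi>, of i] by force
      qed
      then show False using \<open>\<pi> \<noteq> id\<close> by auto
    qed
    then obtain i where i: "i < p" "i \<noteq> c" "\<pi> i \<noteq> i" by blast
    moreover have "\<pi> i < p" using permutes_in_image[OF \<pi>, of i] i by simp
    ultimately have "?M $$ (i, \<pi> i) = 0" using dual by auto
    then show ?thesis using i by (auto intro!: prod_zero)
  qed
  have "Determinant.det ?M = (\<Sum>\<pi> | \<pi> permutes {0..<p}. signof \<pi> * (\<Prod>i = 0..<p. ?M $$ (i, \<pi> i)))"
    by (rule det_def') simp
  also have "\<dots> = (\<Sum>\<pi>\<in>{id}. signof \<pi> * (\<Prod>i = 0..<p. ?M $$ (i, \<pi> i)))"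
  proof (rule sum.mono_neutral_right)
    show "\<forall>\<pi>\<in>{\<pi>. \<pi> permutes {0..<p}} - {id}. signof \<pi> * (\<Prod>i = 0..<p. ?M $$ (i, \<pi> i)) = 0"
    proof
      fix \<pi> assume "\<pi> \<in> {\<pi>. \<pi> permutes {0..<p}} - {id}"
      then have "(\<Prod>i = 0..<p. ?M $$ (i, \<pi> i)) = 0" by (intro zero) auto
      then show "signof \<pi> * (\<Prod>i = 0..<p. ?M $$ (i, \<pi> i)) = 0" by (simp only: mult_zero_right)
    qed
  qed (auto simp: permutes_id finite_permutations)
  also have "\<dots> = (\<Prod>i = 0..<p. (l(c := f)) i (vs ! i))" by simp
  also have "\<dots> = f (vs ! c) * (\<Prod>i\<in>{0..<p} - {c}. (l(c := f)) i (vs ! i))"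
    using c by (subst prod.remove[of _ c]) auto
  also have "(\<Prod>i\<in>{0..<p} - {c}. (l(c := f)) i (vs ! i)) = 1"
    by (intro prod.neutral) (auto simp: dual)
  finally show ?thesis using vs by (simp add: det_form_def)
qed

section \<open>Alternating forms on the span of \<open>p\<close> vectors\<close>

lemma alt_forms_swap:
  assumes \<alpha>: "\<alpha> \<in> alt_forms p V" and V: "subspace V" and vs: "vs \<in> tuples p V" and ij: "i < p" "j < p" "i \<noteq> j"
  shows "\<alpha> (vs[i := vs ! j, j := vs ! i]) = - \<alpha> vs"
proof -
  note ml = alt_forms_multilin[OF \<alpha>]
  define x y where "x = vs ! i" and "y = vs ! j"
  have xy: "x \<in> V" "y \<in> V" "x + y \<in> V" using tuples_nth[OF vs] ij V by (auto simp: x_def y_def subspace_add)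
  note len = tuples_length[OF vs]
  have alt: "\<alpha> (vs[i := z, j := z]) = 0" if "z \<in> V" for z
    using \<alpha> tuples_update[OF tuples_update[OF vs that] that, of i j] ij len unfolding alt_forms_def by force
  have e: "\<alpha> (vs[i := u + u', j := v]) = \<alpha> (vs[i := u, j := v]) + \<alpha> (vs[i := u', j := v])"
    if "u \<in> V" "u' \<in> V" "v \<in> V" for u u' v
    using multilin_add[OF ml tuples_update[OF vs that(3)] ij(1) that(1,2), of j] ij(3)
    by (simp add: list_update_swap)
  have "0 = \<alpha> (vs[i := x + y, j := x + y])" using alt xy by simp
  also have "\<dots> = \<alpha> (vs[i := x + y, j := x]) + \<alpha> (vs[i := x + y, j := y])"
    using multilin_add[OF ml tuples_update[OF vs xy(3)] ij(2) xy(1,2)] by simp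
  also have "\<dots> = \<alpha> (vs[i := x, j := y]) + \<alpha> (vs[i := y, j := x])"
    using alt xy by (simp add: e)
  finally show ?thesis by (simp add: x_def y_def)
qed

text \<open>Sorting by transpositions: \<open>k\<close> counts the trailing positions not yet known
  to agree with \<open>es\<close>, and each step puts the right vector into the first of them at the
  cost of a sign. A repeated entry gives constant 0. The constant does not depend on
  \<open>\<alpha>\<close>, so this is a relation between \<open>p\<close>-vectors.\<close>

lemma proportional_of_elements:
  assumes V: "subspace V" and es: "es \<in> tuples p V" and d: "distinct es"
    and vs: "vs \<in> tuples p (set es)"
  shows "\<exists>c. \<forall>\<alpha>\<in>alt_forms p V. \<alpha> vs = c * \<alpha> es"
proof -
  have esV: "set es \<subseteq> V" and len: "length es = p" using es by (auto simp: tuples_def)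
  have "\<exists>c. \<forall>\<alpha>\<in>alt_forms p V. \<alpha> vs = c * \<alpha> es"
    if "vs \<in> tuples p (set es)" "k \<le> p" "\<forall>i<p - k. vs ! i = es ! i" for k vs
    using that
  proof (induction k arbitrary: vs)
    case 0
    then have "vs = es" using len by (auto simp: tuples_iff intro!: nth_equalityI)
    then show ?case by (intro exI[of _ 1]) simp
  next
    case (Suc k)
    note vs = Suc.prems(1)
    have vsV: "vs \<in> tuples p V" using vs esV by (auto simp: tuples_def)
    show ?case
    proof (cases "distinct vs")
      case False
      then obtain i j where "i < p" "j < p" "i \<noteq> j" "vs ! i = vs ! j"
        using tuples_length[OF vs] by (metis distinct_conv_nth)
      then show ?thesis using vsV by (intro exI[of _ 0]) (auto simp: alt_forms_def)
    next
      case True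
      define m where "m = p - Suc k"
      have m: "m < p" "p - k = Suc m" using Suc.prems(2) by (auto simp: m_def)
      have "card (set vs) = p" "card (set es) = p"
        using True d tuples_length[OF vs] len by (simp_all add: distinct_card)
      moreover have "set vs \<subseteq> set es" using vs by (simp add: tuples_def)
      ultimately have "set vs = set es" by (intro card_subset_eq) auto
      then have "es ! m \<in> set vs" using m len by (metis nth_mem)
      then obtain j where j: "j < p" "vs ! j = es ! m" using tuples_length[OF vs] by (metis in_set_conv_nth)
      \<comment> \<open>The wanted vector cannot stand among the first \<open>m\<close> positions:
        these hold earlier entries of the distinct list \<open>es\<close>.\<close>
      have jm: "m \<le> j"
      proof (rule ccontr)
        assume "\<not> m \<le> j"
        then have "es ! j = es ! m" using Suc.prems(3) j by (simp add: m_def)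
        then show False using d j m len \<open>\<not> m \<le> j\<close> by (metis nth_eq_iff_index_eq order_refl)
      qed
      define ws where "ws = vs[m := vs ! j, j := vs ! m]"
      have ws: "ws \<in> tuples p (set es)" unfolding ws_def by (intro tuples_update vs tuples_nth[OF vs] j m)
      have agree: "\<forall>i<p - k. ws ! i = es ! i"
        using Suc.prems(3) j jm m tuples_length[OF vs]
        by (auto simp: ws_def nth_list_update m_def[symmetric] less_Suc_eq)
      obtain c where c: "\<forall>\<alpha>\<in>alt_forms p V. \<alpha> ws = c * \<alpha> es"
        using Suc.IH[OF ws _ agree] Suc.prems(2) by auto
      show ?thesis
      proof (cases "j = m")
        case True
        then have "ws = vs" by (simp add: ws_def)
        then show ?thesis using c by auto
      next
        case False
        then have "\<alpha> ws = - \<alpha> vs" if "\<alpha> \<in> alt_forms p V" for \<alpha>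
          unfolding ws_def using alt_forms_swap[OF that V vsV m(1) j(1)] by simp
        then show ?thesis using c by (intro exI[of _ "- c"]) (metis minus_equation_iff mult_minus_left)
      qed
    qed
  qed
  from this[of vs p] show ?thesis using vs by simp
qed

text \<open>The \<open>p\<close>-th exterior power of a space spanned by \<open>p\<close> vectors is
  spanned by their wedge product. Slots are freed one at a time: entries before \<open>k\<close>
  already range over the span, and the vectors admissible in slot \<open>k\<close> form a subspace
  \<open>Q\<close> containing \<open>es\<close>.\<close>

lemma alt_forms_proportional:
  assumes V: "subspace V" and es: "es \<in> tuples p V" and d: "distinct es"
    and vs: "vs \<in> tuples p (span (set es))"
  shows "\<exists>c. \<forall>\<alpha>\<in>alt_forms p V. \<alpha> vs = c * \<alpha> es"
proof -
  have esV: "set es \<subseteq> V" using es by (auto simp: tuples_def)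
  then have spV: "span (set es) \<subseteq> V" using V by (simp add: span_minimal)
  have "\<exists>c. \<forall>\<alpha>\<in>alt_forms p V. \<alpha> vs = c * \<alpha> es"
    if "length vs = p" "\<forall>i<k. i < p \<longrightarrow> vs ! i \<in> span (set es)" "\<forall>i<p. k \<le> i \<longrightarrow> vs ! i \<in> set es" for k vs
    using that
  proof (induction k arbitrary: vs)
    case 0
    then show ?case by (intro proportional_of_elements V es d) (auto simp: tuples_iff)
  next
    case (Suc k)
    show ?case
    proof (cases "k < p")
      case False
      then show ?thesis using Suc.prems by (intro Suc.IH) auto
    next
      case True
      have vsV: "vs \<in> tuples p V" unfolding tuples_iff
        using Suc.prems esV spV by (metis not_less subsetD)
      define Q where "Q = {v \<in> V. \<exists>c. \<forall>\<alpha>\<in>alt_forms p V. \<alpha> (vs[k := v]) = c * \<alpha> es}"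
      have "set es \<subseteq> Q"
      proof
        fix e assume e: "e \<in> set es"
        have "\<exists>c. \<forall>\<alpha>\<in>alt_forms p V. \<alpha> (vs[k := e]) = c * \<alpha> es"
          using Suc.prems e True by (intro Suc.IH) (auto simp: nth_list_update)
        then show "e \<in> Q" using e esV by (auto simp: Q_def)
      qed
      moreover have "subspace Q"
      proof (rule subspaceI)
        have "\<alpha> (vs[k := 0]) = 0" if "\<alpha> \<in> alt_forms p V" for \<alpha>
          using multilin_scaleR[OF alt_forms_multilin[OF that] vsV True subspace_0[OF V], of 0] by simp
        then show "0 \<in> Q" using subspace_0[OF V] by (auto simp: Q_def intro!: exI[of _ 0])
        fix v assume v: "v \<in> Q"
        then obtain c where vV: "v \<in> V" and c: "\<forall>\<alpha>\<in>alt_forms p V. \<alpha> (vs[k := v]) = c * \<alpha> es"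
          by (auto simp: Q_def)
        show "r *\<^sub>R v \<in> Q" for r
          using c multilin_scaleR[OF alt_forms_multilin vsV True vV] subspace_mul[OF V vV]
          unfolding Q_def by (auto intro!: exI[of _ "r * c"]) (metis mult.assoc)
        fix w assume w: "w \<in> Q"
        then obtain c' where wV: "w \<in> V" and c': "\<forall>\<alpha>\<in>alt_forms p V. \<alpha> (vs[k := w]) = c' * \<alpha> es"
          by (auto simp: Q_def)
        show "v + w \<in> Q"
          using c c' multilin_add[OF alt_forms_multilin vsV True vV wV] subspace_add[OF V vV wV]
          unfolding Q_def by (auto intro!: exI[of _ "c + c'"] simp: distrib_right)
      qed
      ultimately have "span (set es) \<subseteq> Q" by (rule span_minimal)
      then have "vs ! k \<in> Q" using Suc.prems True by auto
      then show ?thesis by (simp add: Q_def)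
    qed
  qed
  from this[of vs p] vs show ?thesis by (auto simp: tuples_iff)
qed

lemma det_has_derivative_zero:
  assumes "\<And>a b. a < p \<Longrightarrow> b < p \<Longrightarrow> ((\<lambda>t. q a b t) has_real_derivative 0) (at z)"
  shows "((\<lambda>t. Determinant.det (Matrix.mat p p (\<lambda>(a, b). q a b t))) has_real_derivative 0) (at z)"
proof -
  have in_p: "\<pi> i < p" if "\<pi> permutes {0..<p}" "i < p" for \<pi> i
    using permutes_in_image[OF that(1), of i] that(2) by simp
  have eq: "Determinant.det (Matrix.mat p p (\<lambda>(a, b). q a b t)) =
    (\<Sum>\<pi> | \<pi> permutes {0..<p}. signof \<pi> * (\<Prod>i = 0..<p. q i (\<pi> i) t))" for t
    by (subst det_def'[of _ p]) (auto intro!: sum.cong prod.cong simp: in_p)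
  have "((\<lambda>t. \<Sum>\<pi> | \<pi> permutes {0..<p}. signof \<pi> * (\<Prod>i = 0..<p. q i (\<pi> i) t)) has_real_derivative
      (\<Sum>\<pi> | \<pi> permutes {0..<p}. signof \<pi> * (\<Sum>i\<in>{0..<p}. 0 * (\<Prod>j\<in>{0..<p} - {i}. q j (\<pi> j) z)))) (at z)"
    by (intro DERIV_sum DERIV_cmult has_field_derivative_prod assms) (auto simp: in_p)
  then show ?thesis by (simp add: eq)
qed

section \<open>Critical points on the Grassmannian\<close>

lemma Ck_on_subset: "Ck_on k S f \<Longrightarrow> T \<subseteq> S \<Longrightarrow> Ck_on k T f"
  by (induction k arbitrary: f) (auto intro: continuous_on_subset)

text \<open>Both coefficients are kept general because differentiation mixes them.\<close>

lemma Ck_on_cos_sin: "Ck_on k S (\<lambda>t::real. a * cos t + b * sin t :: real)"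
proof (induction k arbitrary: a b)
  case 0
  show ?case by (auto intro!: continuous_intros)
next
  case (Suc k)
  have D: "((\<lambda>t. a * cos t + b * sin t) has_derivative (\<lambda>v. v * (b * cos x - a * sin x))) (at x)" for x
    by (auto intro!: derivative_eq_intros simp: algebra_simps)
  have "frechet_derivative (\<lambda>t. a * cos t + b * sin t) (at x) v = (v * b) * cos x + (- v * a) * sin x" for x v
    using frechet_derivative_at[OF D[of x], symmetric] by (simp add: algebra_simps)
  then show ?case using Suc[of "_ * b" "- _ * a"] differentiableI[OF D] by auto
qed

lemma smooth_on_real_derivative:
  fixes f :: "real \<Rightarrow> real"
  assumes "smooth_on S f" "x \<in> S"
  obtains D where "(f has_real_derivative D) (at x)"
proof -
  have "Ck_on (Suc 0) S f" using assms(1) by (auto simp: smooth_on_def)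
  then have "f differentiable (at x)" using assms(2) by simp
  then show ?thesis using that by (auto simp: real_differentiable_def)
qed

lemma inner_product_on_linear: "inner_product_on V ip \<Longrightarrow> v \<in> V \<Longrightarrow> linear_between V UNIV (ip v)"
  and inner_product_on_sym: "inner_product_on V ip \<Longrightarrow> v \<in> V \<Longrightarrow> w \<in> V \<Longrightarrow> ip v w = ip w v"
  and inner_product_on_pos: "inner_product_on V ip \<Longrightarrow> v \<in> V \<Longrightarrow> v \<noteq> 0 \<Longrightarrow> ip v v > 0"
  by (auto simp: inner_product_on_def)

lemma inner_product_on_sum_right:
  "inner_product_on V ip \<Longrightarrow> subspace V \<Longrightarrow> v \<in> V \<Longrightarrow> (\<And>j. j \<in> J \<Longrightarrow> b j \<in> V) \<Longrightarrow>
    ip v (\<Sum>j\<in>J. c j *\<^sub>R b j) = (\<Sum>j\<in>J. c j * ip v (b j))"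
  using linear_between_sum[OF _ inner_product_on_linear[of V ip v], of J b c] by simp

text \<open>Symmetry supplies linearity in slot 0. The list form makes the inner product a case of
  \<open>multilin_has_derivative\<close>.\<close>

lemma inner_product_on_multilin:
  assumes V: "subspace V" and "inner_product_on V ip"
  shows "multilin 2 V (\<lambda>vs. ip (vs ! 0) (vs ! 1))"
proof -
  have "linear_between V UNIV (\<lambda>v. ip v w)" if w: "w \<in> V" for w
    unfolding linear_between_def
  proof (intro conjI ballI allI subset_UNIV)
    fix v v' assume v: "v \<in> V" "v' \<in> V"
    show "ip (v + v') w = ip v w + ip v' w"
      using inner_product_on_linear[OF assms(2) w] v
        inner_product_on_sym[OF assms(2) w subspace_add[OF V v]]
        inner_product_on_sym[OF assms(2) w v(1)] inner_product_on_sym[OF assms(2) w v(2)]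
      by (simp add: linear_between_def)
  next
    fix r v assume v: "v \<in> V"
    show "ip (r *\<^sub>R v) w = r *\<^sub>R ip v w"
      using inner_product_on_linear[OF assms(2) w] v
        inner_product_on_sym[OF assms(2) w subspace_mul[OF V v]] inner_product_on_sym[OF assms(2) w v]
      by (simp add: linear_between_def)
  qed
  then show ?thesis using inner_product_on_linear[OF assms(2)]
    by (auto simp: multilin_def tuples_iff less_2_cases_iff)
qed

lemma orthonormal_distinct:
  assumes "orthonormal ip es" shows "distinct es"
  unfolding distinct_conv_nth
proof (intro allI impI notI)
  fix i j assume "i < length es" "j < length es" "i \<noteq> j" "es ! i = es ! j"
  then have "ip (es ! i) (es ! i) = 1" "ip (es ! i) (es ! i) = 0"
    using assms unfolding orthonormal_def by (metis, metis)
  then show False by simp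
qed

lemma critical_pointsD:
  assumes V: "subspace V" and ip: "inner_product_on V ip" and es: "es \<in> tuples p V" and on: "orthonormal ip es"
    and \<phi>: "\<phi> \<in> alt_forms p V" and crit: "wedge p V es \<in> critical_points p V ip \<phi>"
    and a: "a < p" and w: "w \<in> V" and orth: "\<And>i. i < p \<Longrightarrow> ip (es ! i) w = 0"
  shows "\<phi> (es[a := w]) = 0"
proof (cases "w = 0")
  case True
  then show ?thesis
    using multilin_scaleR[OF alt_forms_multilin[OF \<phi>] es a w, of 0] by simp
next
  case False
  note len = tuples_length[OF es]
  note lin = inner_product_on_linear[OF ip]
  have add: "ip v (x + y) = ip v x + ip v y" if "v \<in> V" "x \<in> V" "y \<in> V" for v x y
    using lin[OF that(1)] that by (auto simp: linear_between_def)
  have scl: "ip v (r *\<^sub>R x) = r * ip v x" if "v \<in> V" "x \<in> V" for v x r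
    using lin[OF that(1)] that by (auto simp: linear_between_def)
  \<comment> \<open>Normalising \<open>w\<close> keeps the frame, rotated in the plane of
    \<open>es ! a\<close> and \<open>u\<close>, orthonormal for all \<open>t\<close>.\<close>
  define s where "s = sqrt (ip w w)"
  have pos: "ip w w > 0" by (rule inner_product_on_pos[OF ip w False])
  define u where "u = (1 / s) *\<^sub>R w"
  have uV: "u \<in> V" unfolding u_def by (rule subspace_mul[OF V w])
  have "s > 0" "s * s = ip w w" using pos by (auto simp: s_def)
  then have uu: "ip u u = 1"
    using w uV scl[OF uV w, of "1 / s"] inner_product_on_sym[OF ip uV w] scl[OF w w, of "1 / s"]
    pos unfolding u_def by (simp add: field_simps)
  have eu: "ip (es ! i) u = 0" if "i < p" for i
    unfolding u_def using scl[OF tuples_nth[OF es that] w] orth[OF that] by simp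
  define f where "f t = es[a := cos t *\<^sub>R es ! a + sin t *\<^sub>R u]" for t
  have ea: "es ! a \<in> V" by (rule tuples_nth[OF es a])
  have xV: "cos t *\<^sub>R es ! a + sin t *\<^sub>R u \<in> V" for t
    using V ea uV by (auto intro!: subspace_add subspace_mul)
  have fV: "f t \<in> tuples p V" for t unfolding f_def by (intro tuples_update es xV)
  have eon: "ip (es ! i) (es ! j) = (if i = j then 1 else 0)" if "i < p" "j < p" for i j
    using on that len by (simp add: orthonormal_def)
  have vx: "ip v (cos t *\<^sub>R es ! a + sin t *\<^sub>R u) = cos t * ip v (es ! a) + sin t * ip v u" if "v \<in> V" for v t
    using add[OF that subspace_mul[OF V ea] subspace_mul[OF V uV]] scl[OF that ea] scl[OF that uV] by simp
  have ix: "ip (es ! i) (cos t *\<^sub>R es ! a + sin t *\<^sub>R u) = (if i = a then cos t else 0)" if "i < p" for i t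
    using vx[OF tuples_nth[OF es that]] eu[OF that] eon[OF that a] by simp
  have ux: "ip u (cos t *\<^sub>R es ! a + sin t *\<^sub>R u) = sin t" for t
    using vx[OF uV] uu eu[OF a] inner_product_on_sym[OF ip uV ea] by simp
  have xx: "ip (cos t *\<^sub>R es ! a + sin t *\<^sub>R u) (cos t *\<^sub>R es ! a + sin t *\<^sub>R u) = 1" for t
    using vx[OF xV[of t], of t]
      inner_product_on_sym[OF ip xV[of t] ea] inner_product_on_sym[OF ip xV[of t] uV] ix[OF a, of t] ux[of t]
    by (simp flip: power2_eq_square)
  have fon: "orthonormal ip (f t)" for t
    unfolding orthonormal_def
    using len a eon xx[of t] ix[of _ t] inner_product_on_sym[OF ip xV[of t] tuples_nth[OF es]]
    by (auto simp: f_def nth_list_update)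
  define \<gamma> where "\<gamma> t = wedge p V (f t)" for t
  \<comment> \<open>Only slot \<open>a\<close> moves, so every form is trigonometric along the
    curve; this gives smoothness for all forms and the derivative of \<open>\<phi>\<close> at
    once.\<close>
  have pair: "pairing \<alpha> (\<gamma> t) = \<alpha> es * cos t + \<alpha> (es[a := u]) * sin t" if "\<alpha> \<in> alt_forms p V" for \<alpha> t
    using multilin_add[OF alt_forms_multilin[OF that] es a subspace_mul[OF V ea, of "cos t"] subspace_mul[OF V uV, of "sin t"]]
      multilin_scaleR[OF alt_forms_multilin[OF that] es a ea] multilin_scaleR[OF alt_forms_multilin[OF that] es a uV] that
    by (simp add: pairing_def \<gamma>_def wedge_def f_def)
  have "Ck_on k {-1<..<1} (\<lambda>t. pairing \<alpha> (\<gamma> t))" if "\<alpha> \<in> alt_forms p V" for \<alpha> k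
    by (simp add: pair[OF that] Ck_on_cos_sin)
  moreover have "\<gamma> t \<in> Gr_o p V ip" for t
    unfolding Gr_o_def \<gamma>_def using fV fon by blast
  ultimately have curve: "Gr_curve p V ip 1 \<gamma>"
    by (simp add: Gr_curve_def smooth_on_def)
  have \<gamma>0: "\<gamma> 0 = wedge p V es" by (simp add: \<gamma>_def f_def)
  have crit': "\<forall>\<epsilon>>0. \<forall>\<gamma>. Gr_curve p V ip \<epsilon> \<gamma> \<and> \<gamma> 0 = wedge p V es \<longrightarrow>
      ((\<lambda>t. pairing \<phi> (\<gamma> t)) has_real_derivative 0) (at 0)"
    using crit by (simp add: critical_points_def)
  have "((\<lambda>t. pairing \<phi> (\<gamma> t)) has_real_derivative 0) (at 0)"
    by (rule crit'[rule_format, of 1, OF _ conjI[OF curve \<gamma>0]]) simp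
  moreover have "((\<lambda>t. pairing \<phi> (\<gamma> t)) has_real_derivative \<phi> (es[a := u])) (at 0)"
    unfolding pair[OF \<phi>] by (auto intro!: derivative_eq_intros)
  ultimately have "\<phi> (es[a := u]) = 0" by (metis DERIV_unique)
  moreover have "w = s *\<^sub>R u" using \<open>s > 0\<close> by (simp add: u_def)
  ultimately show ?thesis
    using multilin_scaleR[OF alt_forms_multilin[OF \<phi>] es a uV, of s] by simp
qed

text \<open>Bridges criticality, which concerns vectors orthogonal to the whole frame, and skew
  endomorphisms, whose value at \<open>es ! a\<close> is orthogonal to \<open>es ! a\<close> alone.
  The projection \<open>y\<close> of \<open>w\<close> to the plane contributes nothing: its term
  along \<open>es ! a\<close> has coefficient 0 and the other terms repeat an entry of
  \<open>es\<close>.\<close>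

lemma alt_form_vanish_of_orthogonal:
  assumes V: "subspace V" and ip: "inner_product_on V ip" and es: "es \<in> tuples p V" and on: "orthonormal ip es"
    and \<phi>: "\<phi> \<in> alt_forms p V"
    and crit: "\<And>w. w \<in> V \<Longrightarrow> (\<And>i. i < p \<Longrightarrow> ip (es ! i) w = 0) \<Longrightarrow> \<phi> (es[a := w]) = 0"
    and a: "a < p" and w: "w \<in> V" and orth: "ip (es ! a) w = 0"
  shows "\<phi> (es[a := w]) = 0"
proof -
  note len = tuples_length[OF es] and ml = alt_forms_multilin[OF \<phi>]
  have eon: "ip (es ! i) (es ! j) = (if i = j then 1 else 0)" if "i < p" "j < p" for i j
    using on that len by (simp add: orthonormal_def)
  define y where "y = (\<Sum>b<p. ip (es ! b) w *\<^sub>R es ! b)"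
  have esV: "es ! b \<in> V" if "b < p" for b by (rule tuples_nth[OF es that])
  have yV: "y \<in> V" unfolding y_def using V esV by (auto intro!: subspace_sum subspace_mul)
  have wyV: "w - y \<in> V" by (rule subspace_diff[OF V w yV])
  have "ip (es ! i) (w - y) = 0" if "i < p" for i
  proof -
    have "ip (es ! i) y = (\<Sum>b<p. ip (es ! b) w * ip (es ! i) (es ! b))"
      unfolding y_def by (rule inner_product_on_sum_right[OF ip V esV[OF that]]) (simp add: esV)
    also have "\<dots> = ip (es ! i) w"
      using that by (simp add: eon if_distrib[of "(*) _"] cong: if_cong)
    finally show ?thesis
      using inner_product_on_linear[OF ip esV[OF that]] wyV yV unfolding linear_between_def
      by (metis add_cancel_left_left diff_add_cancel)
  qed
  then have 1: "\<phi> (es[a := w - y]) = 0" by (intro crit wyV)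
  have "\<phi> (es[a := y]) = (\<Sum>b<p. ip (es ! b) w * \<phi> (es[a := es ! b]))"
    unfolding y_def by (rule multilin_sum[OF V ml es a]) (simp add: esV)
  also have "\<dots> = 0"
  proof (rule sum.neutral, rule ballI)
    fix b assume "b \<in> {..<p}"
    then have b: "b < p" by simp
    show "ip (es ! b) w * \<phi> (es[a := es ! b]) = 0"
    proof (cases "b = a")
      case False
      then have "\<phi> (es[a := es ! b]) = 0"
        using \<phi> tuples_update[OF es esV[OF b], of a] a b len unfolding alt_forms_def
        by (auto simp: nth_list_update)
      then show ?thesis by simp
    qed (simp add: orth)
  qed
  finally show ?thesis using 1 multilin_add[OF ml es a wyV yV] by simp
qed

text \<open>\<open>B\<close> is the matrix of pairings of the two frames; multiplying
  \<open>fs\<close> by its inverse gives vectors of the span of \<open>fs\<close> that are dual to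
  \<open>es\<close>. For orthonormal \<open>es\<close> this describes the plane as a graph over that
  of \<open>es\<close>.\<close>

lemma dual_frame_exists:
  assumes V: "subspace V" and ip: "inner_product_on V ip" and es: "es \<in> tuples p V" and fs: "fs \<in> tuples p V"
    and nz: "det_form p V (\<lambda>a. ip (es ! a)) fs \<noteq> 0"
  obtains h where "h \<in> tuples p V" "h \<in> tuples p (span (set fs))"
    "\<And>a b. a < p \<Longrightarrow> b < p \<Longrightarrow> ip (es ! a) (h ! b) = (if a = b then 1 else 0)"
proof -
  define B where "B = Matrix.mat p p (\<lambda>(a, b). ip (es ! a) (fs ! b))"
  have Bc: "B \<in> carrier_mat p p" by (simp add: B_def)
  have "Determinant.det B \<noteq> 0" using nz fs by (simp add: det_form_def B_def)
  from det_non_zero_imp_unit[OF Bc this, of undefined]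
  obtain C where C: "C \<in> carrier_mat p p" and BC: "B * C = 1\<^sub>m p"
    unfolding Units_def by (auto simp: ring_mat_def)
  define h where "h = map (\<lambda>b. \<Sum>c<p. C $$ (c, b) *\<^sub>R fs ! c) [0..<p]"
  have fsV: "fs ! c \<in> V" if "c < p" for c by (rule tuples_nth[OF fs that])
  have fsp: "fs ! c \<in> span (set fs)" if "c < p" for c
    using that tuples_length[OF fs] by (intro span_base) simp
  have hV: "h \<in> tuples p V"
    unfolding tuples_iff h_def using V fsV by (auto intro!: subspace_sum subspace_mul)
  moreover have "h \<in> tuples p (span (set fs))"
    unfolding tuples_iff h_def using fsp by (auto intro!: span_sum span_scale)
  moreover have "ip (es ! a) (h ! b) = (if a = b then 1 else 0)" if "a < p" "b < p" for a b
  proof -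
    have "ip (es ! a) (h ! b) = (\<Sum>c<p. C $$ (c, b) * ip (es ! a) (fs ! c))"
      using inner_product_on_sum_right[OF ip V tuples_nth[OF es \<open>a < p\<close>], of "{..<p}" "\<lambda>c. fs ! c" "\<lambda>c. C $$ (c, b)"]
        that(2) fsV by (simp add: h_def)
    also have "\<dots> = (B * C) $$ (a, b)"
      using that Bc C by (auto simp: scalar_prod_def B_def mult.commute lessThan_atLeast0 intro!: sum.cong)
    finally show ?thesis using that by (simp add: BC)
  qed
  ultimately show ?thesis by (rule that)
qed

text \<open>The squared norm of a unit \<open>p\<close>-vector is 1. The determinant of the products
  of \<open>fs\<close> with \<open>h\<close> is a form in either argument, so \<open>D\<close> comes
  out twice, once on each side of a transposition.\<close>

lemma orthonormal_gram_identity: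
  assumes V: "subspace V" and ip: "inner_product_on V ip"
    and fs: "fs \<in> tuples p V" and on: "orthonormal ip fs" and h: "h \<in> tuples p V"
    and D: "\<And>\<alpha>. \<alpha> \<in> alt_forms p V \<Longrightarrow> \<alpha> fs = D * \<alpha> h"
  shows "D * D * det_form p V (\<lambda>a. ip (h ! a)) h = 1"
proof -
  have alt: "det_form p V (\<lambda>a. ip (vs ! a)) \<in> alt_forms p V" if "vs \<in> tuples p V" for vs
    by (rule det_form_alt[OF V inner_product_on_linear[OF ip tuples_nth[OF that]]])
  have "1 = det_form p V (\<lambda>a. ip (fs ! a)) fs"
    using on tuples_length[OF fs] by (subst det_form_dual[OF fs]) (auto simp: orthonormal_def)
  also have "\<dots> = D * det_form p V (\<lambda>a. ip (fs ! a)) h" by (rule D[OF alt[OF fs]])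
  also have "det_form p V (\<lambda>a. ip (fs ! a)) h = det_form p V (\<lambda>a. ip (h ! a)) fs"
  proof -
    let ?M = "Matrix.mat p p (\<lambda>(a, b). ip (fs ! a) (h ! b))"
    have "Matrix.mat p p (\<lambda>(a, b). ip (h ! a) (fs ! b)) = transpose_mat ?M"
      using inner_product_on_sym[OF ip tuples_nth[OF h] tuples_nth[OF fs]] by (intro eq_matI) auto
    then show ?thesis using fs h det_transpose[of ?M p] by (simp add: det_form_def)
  qed
  also have "\<dots> = D * det_form p V (\<lambda>a. ip (h ! a)) h" by (rule D[OF alt[OF h]])
  finally show ?thesis by simp
qed

text \<open>\<open>b\<close> and \<open>k\<close> are a finite frame of \<open>V\<close> with its
  coordinate functionals. In the proof, \<open>\<omega>\<close> and \<open>\<omega>'\<close> provide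
  the denominator and the numerators of Cramer's rule.\<close>

lemma critical_pointsI:
  fixes k :: "'j \<Rightarrow> 'v::real_vector \<Rightarrow> real"
  assumes V: "subspace V" and ip: "inner_product_on V ip" and es: "es \<in> tuples p V" and on: "orthonormal ip es"
    and b: "\<And>j. j \<in> J \<Longrightarrow> b j \<in> V" and k: "\<And>j. j \<in> J \<Longrightarrow> linear_between V UNIV (k j)"
    and frame: "\<And>v. v \<in> V \<Longrightarrow> v = (\<Sum>j\<in>J. k j v *\<^sub>R b j)"
    and \<phi>: "\<phi> \<in> alt_forms p V"
    and crit: "\<And>a w. a < p \<Longrightarrow> w \<in> V \<Longrightarrow> (\<And>i. i < p \<Longrightarrow> ip (es ! i) w = 0) \<Longrightarrow> \<phi> (es[a := w]) = 0"
  shows "wedge p V es \<in> critical_points p V ip \<phi>"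
proof -
  have dual: "ip (es ! i) (es ! j) = (if i = j then 1 else 0)" if "i < p" "j < p" for i j
    using on that tuples_length[OF es] by (simp add: orthonormal_def)
  define e where "e a = ip (es ! a)" for a
  have e: "linear_between V UNIV (e a)" if "a < p" for a
    unfolding e_def by (rule inner_product_on_linear[OF ip tuples_nth[OF es that]])
  define \<omega> where "\<omega> = det_form p V e"
  have \<omega>: "\<omega> \<in> alt_forms p V" unfolding \<omega>_def using e by (rule det_form_alt[OF V])
  define \<omega>' where "\<omega>' a j = det_form p V (e(a := k j))" for a j
  have \<omega>': "\<omega>' a j \<in> alt_forms p V" if "j \<in> J" for a j
    unfolding \<omega>'_def using e k[OF that] by (intro det_form_alt[OF V]) simp
  have "((\<lambda>t. pairing \<phi> (\<gamma> t)) has_real_derivative 0) (at 0)"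
    if "\<epsilon> > 0" and \<gamma>: "Gr_curve p V ip \<epsilon> \<gamma>" and \<gamma>0: "\<gamma> 0 = wedge p V es" for \<epsilon> \<gamma>
  proof -
    have "\<exists>d. ((\<lambda>t. pairing \<alpha> (\<gamma> t)) has_real_derivative d) (at 0)" if "\<alpha> \<in> alt_forms p V" for \<alpha>
    proof -
      have "smooth_on {-\<epsilon><..<\<epsilon>} (\<lambda>t. pairing \<alpha> (\<gamma> t))" using \<gamma> that by (simp add: Gr_curve_def)
      then show ?thesis using \<open>\<epsilon> > 0\<close> by (auto elim!: smooth_on_real_derivative[where x = 0])
    qed
    then obtain der where der: "\<And>\<alpha>. \<alpha> \<in> alt_forms p V \<Longrightarrow> ((\<lambda>t. pairing \<alpha> (\<gamma> t)) has_real_derivative der \<alpha>) (at 0)"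
      by metis
    \<comment> \<open>The frame \<open>H t\<close> of the plane \<open>\<gamma> t\<close> that is dual to \<open>es\<close> is recovered from \<open>\<gamma> t\<close> by Cramer's rule;
      its coordinates are quotients of forms evaluated on \<open>\<gamma> t\<close>, hence differentiable.\<close>
    define D where "D t = pairing \<omega> (\<gamma> t)" for t
    define m where "m a j t = pairing (\<omega>' a j) (\<gamma> t) / D t" for a j t
    define H where "H t = map (\<lambda>a. \<Sum>j\<in>J. m a j t *\<^sub>R b j) [0..<p]" for t
    have D0: "D 0 = 1"
      using det_form_dual[OF es, of e] dual \<omega> by (simp add: D_def \<gamma>0 pairing_def wedge_def \<omega>_def e_def)
    have dD: "(D has_real_derivative der \<omega>) (at 0)" unfolding D_def[abs_def] by (rule der[OF \<omega>])
    \<comment> \<open>The plane at \<open>t\<close> is a graph over the plane of \<open>es\<close>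
      as long as \<open>D t\<close> is nonzero, hence for all \<open>t\<close> in a neighbourhood
      \<open>T\<close> of 0.\<close>
    have "eventually (\<lambda>t. D t \<noteq> 0) (at 0)"
      using tendsto_imp_eventually_ne[of D "D 0" "at 0" 0] DERIV_isCont[OF dD] D0 by (simp add: isCont_def)
    then obtain \<delta> where "\<delta> > 0" and \<delta>: "\<And>t. t \<noteq> 0 \<Longrightarrow> \<bar>t\<bar> < \<delta> \<Longrightarrow> D t \<noteq> 0"
      by (auto simp: eventually_at dist_real_def)
    define T where "T = {-min \<delta> \<epsilon><..<min \<delta> \<epsilon>}"
    have T: "open T" "0 \<in> T" using \<open>\<delta> > 0\<close> \<open>\<epsilon> > 0\<close> by (auto simp: T_def)
    have DT: "D t \<noteq> 0" if "t \<in> T" for t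
      using that \<delta>[of t] D0 by (cases "t = 0"; cases "\<bar>t\<bar> < \<delta>") (auto simp: T_def abs_less_iff)
    have at_T: "at 0 within T = at (0::real)" using T at_within_open by blast
    have key: "H t \<in> tuples p V \<and> (\<forall>c<p. \<forall>a<p. ip (es ! c) (H t ! a) = (if c = a then 1 else 0)) \<and>
        (\<forall>\<alpha>\<in>alt_forms p V. pairing \<alpha> (\<gamma> t) = D t * \<alpha> (H t)) \<and>
        D t * D t * det_form p V (\<lambda>a. ip (H t ! a)) (H t) = 1" if t: "t \<in> T" for t
    proof -
      have "\<gamma> t \<in> Gr_o p V ip" using \<gamma> t by (auto simp: Gr_curve_def T_def)
      then obtain fs where fs: "fs \<in> tuples p V" "orthonormal ip fs" and \<gamma>t: "\<gamma> t = wedge p V fs"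
        unfolding Gr_o_def by blast
      have pair: "pairing \<alpha> (\<gamma> t) = \<alpha> fs" if "\<alpha> \<in> alt_forms p V" for \<alpha>
        using that by (simp add: \<gamma>t pairing_def wedge_def)
      have "det_form p V (\<lambda>a. ip (es ! a)) fs \<noteq> 0"
        using DT[OF t] pair[OF \<omega>] unfolding D_def by (simp add: \<omega>_def e_def[abs_def])
      from dual_frame_exists[OF V ip es fs(1) this]
      obtain h where h: "h \<in> tuples p V" "h \<in> tuples p (span (set fs))"
        and hdual: "\<And>a b. a < p \<Longrightarrow> b < p \<Longrightarrow> ip (es ! a) (h ! b) = (if a = b then 1 else 0)"
        by blast
      from alt_forms_proportional[OF V fs(1) orthonormal_distinct[OF fs(2)] h(2)]
      obtain c where c: "\<And>\<alpha>. \<alpha> \<in> alt_forms p V \<Longrightarrow> \<alpha> h = c * \<alpha> fs" by blast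
      have "c * D t = 1"
        using c[OF \<omega>] det_form_dual[OF h(1), of e] hdual by (simp add: D_def pair[OF \<omega>]) (simp add: \<omega>_def e_def)
      then have Dh: "\<alpha> fs = D t * \<alpha> h" if "\<alpha> \<in> alt_forms p V" for \<alpha>
        using c[OF that] mult.assoc[of "D t" c "\<alpha> fs"] by (simp add: mult.commute)
      have "m a j t = k j (h ! a)" if "a < p" "j \<in> J" for a j
        using Dh[OF \<omega>'[OF that(2)], of a] det_form_dual_update[OF h(1), of e a "k j"] hdual that DT[OF t]
        by (simp add: m_def pair[OF \<omega>'[OF that(2)]]) (simp add: \<omega>'_def e_def)
      then have "H t = h"
        using tuples_length[OF h(1)] frame[OF tuples_nth[OF h(1)]]
        by (auto simp: H_def intro!: nth_equalityI)
      then show ?thesis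
        using h(1) hdual Dh pair orthonormal_gram_identity[OF V ip fs h(1) Dh] by auto
    qed
    have H0: "H 0 = es"
    proof -
      have "m a j 0 = k j (es ! a)" if "a < p" "j \<in> J" for a j
        using det_form_dual_update[OF es, of e a "k j"] dual that D0 \<omega>'[OF that(2), of a]
        by (simp add: m_def \<gamma>0 pairing_def wedge_def \<omega>'_def e_def)
      then show ?thesis
        using tuples_length[OF es] frame[OF tuples_nth[OF es]]
        by (auto simp: H_def intro!: nth_equalityI)
    qed
    define m' where "m' a j = (der (\<omega>' a j) * D 0 - pairing (\<omega>' a j) (\<gamma> 0) * der \<omega>) / (D 0 * D 0)" for a j
    have dm: "((\<lambda>t. m a j t) has_real_derivative m' a j) (at 0 within T)" if "j \<in> J" for a j
      unfolding m_def m'_def at_T using that D0 by (intro DERIV_divide der \<omega>' dD) simp_all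
    define h' where "h' a = (\<Sum>j\<in>J. m' a j *\<^sub>R b j)" for a
    have h'V: "h' a \<in> V" for a unfolding h'_def using V b by (auto intro!: subspace_sum subspace_mul)
    have Hn: "H t ! a = (\<Sum>j\<in>J. m a j t *\<^sub>R b j)" if "a < p" for a t using that by (simp add: H_def)
    have sum_ip: "ip v (\<Sum>j\<in>J. c j *\<^sub>R b j) = (\<Sum>j\<in>J. c j * ip v (b j))" if "v \<in> V" for v and c :: "'j \<Rightarrow> real"
      by (rule inner_product_on_sum_right[OF ip V that b])
    \<comment> \<open>The products of \<open>es ! c\<close> with \<open>H t ! a\<close> are constant
      in \<open>t\<close> by duality, so the velocities are orthogonal to the frame.\<close>
    have orth: "ip (es ! c) (h' a) = 0" if "c < p" "a < p" for a c
    proof -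
      note ecV = tuples_nth[OF es that(1)]
      have "((\<lambda>t. \<Sum>j\<in>J. m a j t * ip (es ! c) (b j)) has_real_derivative (\<Sum>j\<in>J. m' a j * ip (es ! c) (b j))) (at 0 within T)"
        by (intro DERIV_sum DERIV_cmult_right dm)
      then have "((\<lambda>t. if c = a then 1 else 0) has_real_derivative (\<Sum>j\<in>J. m' a j * ip (es ! c) (b j))) (at 0 within T)"
        by (rule has_field_derivative_transform_within[where d = 1])
           (use T key that in \<open>simp_all flip: sum_ip[OF ecV] Hn[OF that(2)]\<close>)
      moreover have "((\<lambda>t. if c = a then 1 else 0) has_real_derivative 0) (at 0 within T)" by simp
      ultimately have "(\<Sum>j\<in>J. m' a j * ip (es ! c) (b j)) = 0"
        unfolding at_T by (rule DERIV_unique)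
      then show ?thesis unfolding h'_def by (simp add: sum_ip[OF ecV])
    qed
    have d\<phi>: "((\<lambda>t. \<phi> (H t)) has_real_derivative 0) (at 0)"
    proof -
      have "((\<lambda>t. \<phi> (H t)) has_real_derivative
            0 + (\<Sum>a<p. \<phi> ((H 0)[a := \<Sum>j\<in>J. m' a j *\<^sub>R b j]))) (at 0 within T)"
        by (rule multilin_has_derivative[OF V b, where \<alpha> = "\<lambda>_. \<phi>" and \<alpha>' = "\<lambda>_. 0" and m = m])
           (use T key dm Hn alt_forms_multilin[OF \<phi>] at_T in auto)
      then show ?thesis
        using crit orth h'V by (simp add: at_T H0 flip: h'_def)
    qed
    \<comment> \<open>The squared norm of the wedge product of \<open>H t\<close>. It is stationary
      at 0, because the velocities \<open>h' a\<close> are orthogonal to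
      \<open>H 0 = es\<close>.\<close>
    define Gr where "Gr t = Determinant.det (Matrix.mat p p (\<lambda>(a, c). ip (H t ! a) (H t ! c)))" for t
    have dGr: "(Gr has_real_derivative 0) (at 0)"
      unfolding Gr_def[abs_def]
    proof (rule det_has_derivative_zero)
      fix a c assume ac: "a < p" "c < p"
      \<comment> \<open>The two slots of the inner product carry \<open>H t ! a\<close> and
        \<open>H t ! c\<close>, so the coefficients are selected by slot.\<close>
      define m2 where "m2 i = m (if i = (0::nat) then a else c)" for i
      define m2' where "m2' i = m' (if i = (0::nat) then a else c)" for i
      have "((\<lambda>t. (\<lambda>vs. ip (vs ! 0) (vs ! 1)) [H t ! a, H t ! c]) has_real_derivative
          0 + (\<Sum>i<2. (\<lambda>vs. ip (vs ! 0) (vs ! 1)) ([H 0 ! a, H 0 ! c][i := \<Sum>j\<in>J. m2' i j *\<^sub>R b j]))) (at 0 within T)"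
        by (rule multilin_has_derivative[OF V b, where \<alpha> = "\<lambda>_ vs. ip (vs ! 0) (vs ! 1)" and \<alpha>' = "\<lambda>_. 0" and m = m2])
           (use T dm inner_product_on_multilin[OF V ip] at_T key ac Hn in
             \<open>auto simp: m2_def m2'_def less_2_cases_iff tuples_iff\<close>)
      moreover have "(\<Sum>i<2. (\<lambda>vs. ip (vs ! 0) (vs ! 1)) ([H 0 ! a, H 0 ! c][i := \<Sum>j\<in>J. m2' i j *\<^sub>R b j])) = 0"
        using orth[OF ac(2,1)] orth[OF ac] inner_product_on_sym[OF ip h'V tuples_nth[OF es ac(2)]]
        by (simp add: numeral_2_eq_2 m2'_def H0 flip: h'_def)
      ultimately show "((\<lambda>t. ip (H t ! a) (H t ! c)) has_real_derivative 0) (at 0)"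
        by (simp add: at_T)
    qed
    have DG: "D t * D t * Gr t = 1" if "t \<in> T" for t
      using key[OF that] by (auto simp: Gr_def det_form_def)
    then have Gr0: "Gr 0 = 1" using D0 T by force
    have "((\<lambda>t. D t * D t * Gr t) has_real_derivative (der \<omega> * D 0 + D 0 * der \<omega>) * Gr 0 + D 0 * D 0 * 0) (at 0)"
      using dD dGr by (auto intro!: derivative_eq_intros simp: algebra_simps)
    then have "((\<lambda>t. 1) has_real_derivative 2 * der \<omega>) (at 0)"
      using has_field_derivative_transform_within_open[OF _ T, of "\<lambda>t. D t * D t * Gr t" _ "\<lambda>t. 1"] DG
      by (simp add: D0 Gr0)
    then have "der \<omega> = 0" using DERIV_unique[OF _ DERIV_const, of 1 "2 * der \<omega>"] by simp
    have "((\<lambda>t. D t * \<phi> (H t)) has_real_derivative der \<omega> * \<phi> (H 0) + 0 * D 0) (at 0)"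
      by (rule DERIV_mult[OF dD d\<phi>])
    then show ?thesis
      using has_field_derivative_transform_within_open[OF _ T, of "\<lambda>t. D t * \<phi> (H t)" _ "\<lambda>t. pairing \<phi> (\<gamma> t)"] key \<phi>
      by (simp add: \<open>der \<omega> = 0\<close>)
  qed
  then show ?thesis unfolding critical_points_def Gr_o_def using es on by blast
qed

text \<open>Fermat's criterion; smoothness along the curve provides the derivative. A calibrated
  plane is a maximum because it attains the bound 1.\<close>

lemma critical_points_maximum:
  assumes \<phi>: "\<phi> \<in> alt_forms p V" and \<xi>: "\<xi> \<in> Gr_o p V ip"
    and le: "\<And>\<eta>. \<eta> \<in> Gr_o p V ip \<Longrightarrow> pairing \<phi> \<eta> \<le> pairing \<phi> \<xi>"
  shows "\<xi> \<in> critical_points p V ip \<phi>"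
  unfolding critical_points_def
proof (intro CollectI conjI \<xi> allI impI, elim conjE)
  fix \<epsilon> :: real and \<gamma> assume \<epsilon>: "\<epsilon> > 0" and \<gamma>: "Gr_curve p V ip \<epsilon> \<gamma>" "\<gamma> 0 = \<xi>"
  have "smooth_on {-\<epsilon><..<\<epsilon>} (\<lambda>t. pairing \<phi> (\<gamma> t))" using \<gamma> \<phi> by (simp add: Gr_curve_def)
  then obtain D where D: "((\<lambda>t. pairing \<phi> (\<gamma> t)) has_real_derivative D) (at 0)"
    using \<epsilon> by (auto elim!: smooth_on_real_derivative[where x = 0])
  have "D = 0"
    by (rule DERIV_local_max[OF D \<epsilon>]) (use \<gamma> le in \<open>auto simp: Gr_curve_def abs_less_iff\<close>)
  then show "((\<lambda>t. pairing \<phi> (\<gamma> t)) has_real_derivative 0) (at 0)" using D by simp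
qed

section \<open>Smooth functions and bump functions\<close>

text \<open>\<open>Ck_on\<close> differentiates with \<open>at x\<close>, so equality on
  \<open>S\<close> passes to the derivatives because \<open>S\<close> is open.\<close>

lemma Ck_on_cong:
  assumes "open S" "\<And>x. x \<in> S \<Longrightarrow> f x = g x" "Ck_on k S f"
  shows "Ck_on k S g"
  using assms(2,3)
proof (induction k arbitrary: f g)
  case 0
  then show ?case by (auto cong: continuous_on_cong)
next
  case (Suc k)
  have eq: "frechet_derivative f (at x) = frechet_derivative g (at x)" if "x \<in> S" for x
    using Suc.prems that by (intro frechet_derivative_transform_within_open[OF _ assms(1)]) auto
  have "g differentiable at x" if "x \<in> S" for x
  proof -
    have "(f has_derivative frechet_derivative f (at x)) (at x)"
      using Suc.prems that by (simp add: frechet_derivative_works)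
    then have "(g has_derivative frechet_derivative f (at x)) (at x)"
      by (rule has_derivative_transform_within_open[OF _ assms(1) that]) (simp add: Suc.prems)
    then show ?thesis by (rule differentiableI)
  qed
  moreover have "Ck_on k S (\<lambda>x. frechet_derivative g (at x) v)" for v
    by (rule Suc.IH[of "\<lambda>x. frechet_derivative f (at x) v"]) (use Suc.prems(2) eq in auto)
  ultimately show ?case by simp
qed

lemma Ck_on_Suc_imp: "Ck_on (Suc k) S f \<Longrightarrow> Ck_on k S f"
proof (induction k arbitrary: f)
  case 0
  then show ?case by (auto intro!: continuous_at_imp_continuous_on differentiable_imp_continuous_within)
qed simp

lemma Ck_on_const: "Ck_on k S (\<lambda>x. c)"
  by (induction k arbitrary: c) auto

lemma Ck_on_bounded_linear: "bounded_linear f \<Longrightarrow> Ck_on k S f"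
proof (cases k)
  case (Suc n)
  assume f: "bounded_linear f"
  have D: "(f has_derivative f) (at x)" for x by (rule bounded_linear_imp_has_derivative[OF f])
  have "frechet_derivative f (at x) v = f v" for x v using frechet_derivative_at[OF D[of x]] by simp
  then show ?thesis unfolding Suc using D by (auto simp: Ck_on_const intro: differentiableI)
qed (simp add: linear_continuous_on)

text \<open>Lets the inductions below work with an explicit derivative \<open>f'\<close> in place of
  \<open>frechet_derivative\<close>.\<close>

lemma Ck_on_Suc_cong:
  assumes "open S" and "\<And>x. x \<in> S \<Longrightarrow> (f has_derivative f' x) (at x)"
    and "\<And>v. Ck_on k S (\<lambda>x. f' x v)"
  shows "Ck_on (Suc k) S f"
proof -
  have "frechet_derivative f (at x) = f' x" if "x \<in> S" for x
    using frechet_derivative_at[OF assms(2)[OF that]] by simp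
  then have "Ck_on k S (\<lambda>x. frechet_derivative f (at x) v)" for v
    by (intro Ck_on_cong[OF assms(1) _ assms(3)[of v]]) simp
  then show ?thesis using assms(2) by (auto intro: differentiableI)
qed

lemma Ck_on_has_derivative:
  "Ck_on (Suc k) S f \<Longrightarrow> x \<in> S \<Longrightarrow> (f has_derivative frechet_derivative f (at x)) (at x)"
  by (simp add: frechet_derivative_works)

lemma Ck_on_add:
  assumes S: "open S" shows "Ck_on k S f \<Longrightarrow> Ck_on k S g \<Longrightarrow> Ck_on k S (\<lambda>x. f x + g x)"
proof (induction k arbitrary: f g)
  case 0
  then show ?case by (auto intro: continuous_on_add)
next
  case (Suc k)
  show ?case
  proof (rule Ck_on_Suc_cong[OF S])
    show "((\<lambda>x. f x + g x) has_derivative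
        (\<lambda>v. frechet_derivative f (at x) v + frechet_derivative g (at x) v)) (at x)" if "x \<in> S" for x
      by (rule has_derivative_add[OF Ck_on_has_derivative[OF Suc.prems(1) that] Ck_on_has_derivative[OF Suc.prems(2) that]])
    show "Ck_on k S (\<lambda>x. frechet_derivative f (at x) v + frechet_derivative g (at x) v)" for v
      using Suc.prems by (intro Suc.IH) simp_all
  qed
qed

lemma Ck_on_sum:
  assumes S: "open S" shows "(\<And>i. i \<in> I \<Longrightarrow> Ck_on k S (f i)) \<Longrightarrow> Ck_on k S (\<lambda>x. \<Sum>i\<in>I. f i x)"
  by (induction I rule: infinite_finite_induct) (auto simp: Ck_on_const intro!: Ck_on_add[OF S])

lemma Ck_on_bilinear:
  assumes b: "bounded_bilinear b" and S: "open S"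
  shows "Ck_on k S f \<Longrightarrow> Ck_on k S g \<Longrightarrow> Ck_on k S (\<lambda>x. b (f x) (g x))"
proof (induction k arbitrary: f g)
  case 0
  then show ?case by (auto intro: bounded_bilinear.continuous_on[OF b])
next
  case (Suc k)
  show ?case
  proof (rule Ck_on_Suc_cong[OF S])
    show "((\<lambda>x. b (f x) (g x)) has_derivative
        (\<lambda>v. b (f x) (frechet_derivative g (at x) v) + b (frechet_derivative f (at x) v) (g x))) (at x)" if "x \<in> S" for x
      by (rule bounded_bilinear.FDERIV[OF b Ck_on_has_derivative[OF Suc.prems(1) that] Ck_on_has_derivative[OF Suc.prems(2) that]])
    show "Ck_on k S (\<lambda>x. b (f x) (frechet_derivative g (at x) v) + b (frechet_derivative f (at x) v) (g x))" for v
      using Suc.prems Suc.prems[THEN Ck_on_Suc_imp] by (intro Ck_on_add[OF S] Suc.IH) simp_all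
  qed
qed

lemmas Ck_on_mult = Ck_on_bilinear[OF bounded_bilinear_mult]
  and Ck_on_scaleR = Ck_on_bilinear[OF bounded_bilinear_scaleR]
  and Ck_on_inner = Ck_on_bilinear[OF bounded_bilinear_inner]

lemma Ck_on_compose:
  fixes g :: "'a::real_normed_vector \<Rightarrow> 'b::euclidean_space"
  assumes S: "open S" and T: "open T" and gS: "g ` S \<subseteq> T"
  shows "Ck_on k S g \<Longrightarrow> Ck_on k T f \<Longrightarrow> Ck_on k S (\<lambda>x. f (g x))"
proof (induction k arbitrary: f)
  case 0
  then show ?case using gS by (auto intro: continuous_on_compose2)
next
  case (Suc k)
  have lin: "linear (frechet_derivative f (at (g x)))" if "x \<in> S" for x
    using Ck_on_has_derivative[OF Suc.prems(2), of "g x"] gS that by (auto dest: has_derivative_linear)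
  show ?case
  proof (rule Ck_on_Suc_cong[OF S])
    fix x assume x: "x \<in> S"
    then have "g x \<in> T" using gS by auto
    show "((\<lambda>x. f (g x)) has_derivative (\<lambda>v. frechet_derivative f (at (g x)) (frechet_derivative g (at x) v))) (at x)"
      by (rule has_derivative_compose[OF Ck_on_has_derivative[OF Suc.prems(1) x] Ck_on_has_derivative[OF Suc.prems(2) \<open>g x \<in> T\<close>]])
  next
    fix v
    \<comment> \<open>\<open>Ck_on\<close> speaks of derivatives in fixed directions, whereas the
      chain rule evaluates the outer derivative in a direction depending on \<open>x\<close>;
      expanding that direction in \<open>Basis\<close> reduces it to fixed ones.\<close>
    have "Ck_on k S (\<lambda>x. \<Sum>j\<in>Basis. inner (frechet_derivative g (at x) v) j *\<^sub>R frechet_derivative f (at (g x)) j)"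
    proof (intro Ck_on_sum[OF S] Ck_on_scaleR[OF S] Ck_on_inner[OF S] Ck_on_const)
      show "Ck_on k S (\<lambda>x. frechet_derivative g (at x) v)" using Suc.prems(1) by simp
      show "Ck_on k S (\<lambda>x. frechet_derivative f (at (g x)) j)" for j
        by (rule Suc.IH[OF Ck_on_Suc_imp[OF Suc.prems(1)]]) (use Suc.prems(2) in simp)
    qed
    moreover have "(\<Sum>j\<in>Basis. inner (frechet_derivative g (at x) v) j *\<^sub>R frechet_derivative f (at (g x)) j)
        = frechet_derivative f (at (g x)) (frechet_derivative g (at x) v)" if "x \<in> S" for x
    proof -
      have "frechet_derivative f (at (g x)) (\<Sum>j\<in>Basis. inner (frechet_derivative g (at x) v) j *\<^sub>R j)
        = (\<Sum>j\<in>Basis. inner (frechet_derivative g (at x) v) j *\<^sub>R frechet_derivative f (at (g x)) j)"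
        by (simp add: linear_sum[OF lin[OF that]] linear_scale[OF lin[OF that]])
      then show ?thesis by (simp add: euclidean_representation)
    qed
    ultimately show "Ck_on k S (\<lambda>x. frechet_derivative f (at (g x)) (frechet_derivative g (at x) v))"
      by (rule Ck_on_cong[OF S, rotated])
  qed
qed

lemma Ck_on_Un:
  assumes "open S" "open T" shows "Ck_on k S f \<Longrightarrow> Ck_on k T f \<Longrightarrow> Ck_on k (S \<union> T) f"
  by (induction k arbitrary: f) (auto intro: continuous_on_open_Un assms)

section \<open>A smooth function that vanishes outside a ball\<close>

definition flat_exp :: "nat \<Rightarrow> real \<Rightarrow> real" where
  "flat_exp n x = (if x > 0 then exp (- inverse x) * inverse x ^ n else 0)"

lemma tendsto_flat_exp_0: "(flat_exp n \<longlongrightarrow> 0) (at 0)"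
proof -
  have "((\<lambda>x. inverse x ^ n / exp (inverse x)) \<longlongrightarrow> 0) (at_right (0::real))"
    by (rule filterlim_compose[OF tendsto_power_div_exp_0 filterlim_inverse_at_top_right])
  then have "(flat_exp n \<longlongrightarrow> 0) (at_right 0)"
    by (rule Lim_transform_eventually)
       (auto simp: eventually_at_filter flat_exp_def exp_minus field_simps)
  moreover have "(flat_exp n \<longlongrightarrow> 0) (at_left 0)"
    by (rule Lim_transform_eventually[OF tendsto_const])
       (auto simp: eventually_at_filter flat_exp_def)
  ultimately show ?thesis by (simp add: filterlim_split_at)
qed

lemma flat_exp_has_derivative:
  "(flat_exp n has_real_derivative flat_exp (n + 2) x - real n * flat_exp (n + 1) x) (at x)"
proof -
  consider "x > 0" | "x = 0" | "x < 0" by linarith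
  then show ?thesis
  proof cases
    case 1
    have "((\<lambda>x. exp (- inverse x) * inverse x ^ n) has_real_derivative
        flat_exp (n + 2) x - real n * flat_exp (n + 1) x) (at x)"
      using 1 by (cases n)
        (auto intro!: derivative_eq_intros simp: flat_exp_def power2_eq_square field_simps, metis One_nat_def power_eq_if)
    then show ?thesis
      by (rule has_field_derivative_transform_within_open[of _ _ _ "{0<..}"]) (use 1 in \<open>auto simp: flat_exp_def\<close>)
  next
    case 2
    \<comment> \<open>The difference quotient at 0 belongs to the family again: it is
      \<open>flat_exp (Suc n)\<close>.\<close>
    have "((\<lambda>h. flat_exp n h / h) \<longlongrightarrow> 0) (at 0)"
      by (rule Lim_transform_eventually[OF tendsto_flat_exp_0[of "Suc n"]])
         (auto simp: flat_exp_def divide_inverse eventually_at_filter)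
    then show ?thesis by (simp add: DERIV_def 2 flat_exp_def)
  next
    case 3
    have "((\<lambda>x. 0) has_real_derivative flat_exp (n + 2) x - real n * flat_exp (n + 1) x) (at x)"
      using 3 by (simp add: flat_exp_def)
    then show ?thesis
      by (rule has_field_derivative_transform_within_open[of _ _ _ "{..<0}"]) (use 3 in \<open>auto simp: flat_exp_def\<close>)
  qed
qed

text \<open>The factor \<open>inverse x ^ n\<close> in \<open>flat_exp\<close> is there for this
  induction: it makes the family closed under differentiation, up to linear combinations.\<close>

lemma Ck_on_flat_exp: "Ck_on k UNIV (flat_exp n)"
proof (induction k arbitrary: n)
  case 0
  show ?case using flat_exp_has_derivative
    by (auto intro!: continuous_at_imp_continuous_on DERIV_isCont)
next
  case (Suc k)
  show ?case
  proof (rule Ck_on_Suc_cong)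
    show "(flat_exp n has_derivative (\<lambda>v. (flat_exp (n + 2) x - real n * flat_exp (n + 1) x) * v)) (at x)" for x
      using flat_exp_has_derivative[of n x] by (simp add: has_field_derivative_def)
    have "Ck_on k UNIV (\<lambda>x. (flat_exp (n + 2) x + (- real n) * flat_exp (n + 1) x) * v)" for v
      by (intro Ck_on_mult Ck_on_add Ck_on_const Suc.IH) auto
    then show "Ck_on k UNIV (\<lambda>x. (flat_exp (n + 2) x - real n * flat_exp (n + 1) x) * v)" for v
      by simp
  qed simp
qed

text \<open>The norm enters squared, as a polynomial, so that smoothness does not fail at the
  centre.\<close>

definition bump :: "'a::euclidean_space \<Rightarrow> real \<Rightarrow> 'a \<Rightarrow> real" where
  "bump z0 r z = flat_exp 0 (r\<^sup>2 - (norm (z - z0))\<^sup>2)"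

lemma bump_center: "r > 0 \<Longrightarrow> bump z0 r z0 > 0"
  by (simp add: bump_def flat_exp_def)

lemma bump_outside: "r > 0 \<Longrightarrow> z \<notin> cball z0 r \<Longrightarrow> bump z0 r z = 0"
  by (auto simp: bump_def flat_exp_def dist_norm norm_minus_commute dest!: power2_less_imp_less)

lemma Ck_on_bump: "Ck_on k UNIV (bump z0 r)"
proof -
  have "Ck_on k UNIV (\<lambda>z. r\<^sup>2 + (- 1) * inner (z + - z0) (z + - z0))"
    by (intro Ck_on_add Ck_on_mult Ck_on_inner Ck_on_const open_UNIV Ck_on_bounded_linear bounded_linear_ident)
  then have "Ck_on k UNIV (\<lambda>z. flat_exp 0 (r\<^sup>2 + (- 1) * inner (z + - z0) (z + - z0)))"
    by (intro Ck_on_compose[OF _ _ _ _ Ck_on_flat_exp]) auto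
  then show ?thesis by (simp add: bump_def[abs_def] power2_norm_eq_inner)
qed

section \<open>Tangent spaces and submanifolds\<close>

lemma is_chart_inj:
  assumes "is_chart M c" shows "inj_on (snd c) (fst c)"
proof -
  have "inj_on (snd c) (topspace (subtopology M (fst c)))"
    using assms by (auto simp only: is_chart_def intro: homeomorphic_imp_injective_map)
  moreover have "topspace (subtopology M (fst c)) = fst c"
    using assms openin_subset[of M "fst c"] by (intro topspace_subtopology_subset) (auto simp: is_chart_def)
  ultimately show ?thesis by simp
qed

lemma chart_inv_chart: "is_chart M c \<Longrightarrow> x \<in> fst c \<Longrightarrow> chart_inv c (snd c x) = x"
  unfolding chart_inv_def by (rule inv_into_f_f[OF is_chart_inj])

lemma chart_inv_in: "y \<in> snd c ` fst c \<Longrightarrow> chart_inv c y \<in> fst c"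
  unfolding chart_inv_def by (rule inv_into_into)

lemma is_chart_open_image:
  assumes c: "is_chart M c" and U: "openin M U"
  shows "open (snd c ` (fst c \<inter> U))"
proof -
  have "open_map (subtopology M (fst c)) (top_of_set (snd c ` fst c)) (snd c)"
    using c homeomorphic_imp_open_map by (auto simp: is_chart_def)
  moreover have "openin (subtopology M (fst c)) (fst c \<inter> U)"
    using U by (metis openin_subtopology Int_commute)
  ultimately have "openin (top_of_set (snd c ` fst c)) (snd c ` (fst c \<inter> U))"
    by (simp add: open_map_def)
  moreover have "open (snd c ` fst c)" using c by (simp add: is_chart_def)
  ultimately show ?thesis by (metis openin_open_eq)
qed

definition dtrans :: "('m, 'e::euclidean_space) chart \<Rightarrow> ('m, 'e) chart \<Rightarrow> 'm \<Rightarrow> 'e \<Rightarrow> 'e" where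
  "dtrans c c' x = frechet_derivative (transition c c') (at (snd c x))"

locale manifold =
  fixes M :: "'m topology" and A :: "('m, 'e::euclidean_space) chart set"
  assumes smooth: "smooth_manifold M A"
begin

lemma chart: "c \<in> A \<Longrightarrow> is_chart M c"
  using smooth unfolding smooth_manifold_def by blast

lemma ex_chart: "x \<in> topspace M \<Longrightarrow> \<exists>c\<in>A. x \<in> fst c"
  using smooth unfolding smooth_manifold_def by blast

lemma chart_open: "c \<in> A \<Longrightarrow> openin M (fst c)"
  using chart unfolding is_chart_def by blast

lemma chart_topspace: "c \<in> A \<Longrightarrow> x \<in> fst c \<Longrightarrow> x \<in> topspace M"
  using chart_open openin_subset by blast

lemma transition_apply: "c \<in> A \<Longrightarrow> x \<in> fst c \<Longrightarrow> transition c c' (snd c x) = snd c' x"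
  by (simp add: transition_def chart_inv_chart[OF chart])

lemma overlap_open: "c \<in> A \<Longrightarrow> c' \<in> A \<Longrightarrow> open (snd c ` (fst c \<inter> fst c'))"
  by (rule is_chart_open_image[OF chart chart_open])

lemma transition_Ck: "c \<in> A \<Longrightarrow> c' \<in> A \<Longrightarrow> Ck_on k (snd c ` (fst c \<inter> fst c')) (transition c c')"
proof -
  assume "c \<in> A" "c' \<in> A"
  then have "compatible c c'" using smooth unfolding smooth_manifold_def by blast
  then show ?thesis by (simp add: compatible_def smooth_on_def)
qed

lemma transition_has_derivative:
  assumes "c \<in> charts_at A x" "c' \<in> charts_at A x"
  shows "(transition c c' has_derivative dtrans c c' x) (at (snd c x))"
  unfolding dtrans_def using assms transition_Ck[of c c' "Suc 0"]
  by (intro Ck_on_has_derivative[of 0 "snd c ` (fst c \<inter> fst c')"]) (auto simp: charts_at_def)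

lemma dtrans_linear: "c \<in> charts_at A x \<Longrightarrow> c' \<in> charts_at A x \<Longrightarrow> linear (dtrans c c' x)"
  using transition_has_derivative by (rule has_derivative_linear)

lemma dtrans_compose:
  assumes c: "c \<in> charts_at A x" "c' \<in> charts_at A x" "c'' \<in> charts_at A x"
  shows "dtrans c' c'' x (dtrans c c' x v) = dtrans c c'' x v"
proof -
  have cA: "c \<in> A" "x \<in> fst c" "c' \<in> A" "x \<in> fst c'" "c'' \<in> A" using c by (auto simp: charts_at_def)
  have "((\<lambda>y. transition c' c'' (transition c c' y)) has_derivative (\<lambda>v. dtrans c' c'' x (dtrans c c' x v))) (at (snd c x))"
    using has_derivative_compose[OF transition_has_derivative[OF c(1,2)]] transition_has_derivative[OF c(2,3)]
    by (simp add: transition_apply[OF cA(1,2)])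
  then have "(transition c c'' has_derivative (\<lambda>v. dtrans c' c'' x (dtrans c c' x v))) (at (snd c x))"
  proof (rule has_derivative_transform_within_open[OF _ overlap_open[OF cA(1,3)]])
    fix y assume "y \<in> snd c ` (fst c \<inter> fst c')"
    then show "transition c' c'' (transition c c' y) = transition c c'' y"
      using cA by (auto simp: transition_apply)
  qed (use cA in auto)
  from has_derivative_unique[OF this transition_has_derivative[OF c(1,3)]] show ?thesis by (rule fun_cong)
qed

lemma dtrans_same:
  assumes c: "c \<in> charts_at A x" shows "dtrans c c x v = v"
proof -
  have cA: "c \<in> A" "x \<in> fst c" using c by (auto simp: charts_at_def)
  have "(transition c c has_derivative (\<lambda>v. v)) (at (snd c x))"
    by (rule has_derivative_transform_within_open[OF has_derivative_ident overlap_open[OF cA(1) cA(1)]])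
       (use cA in \<open>auto simp: transition_apply\<close>)
  from has_derivative_unique[OF this transition_has_derivative[OF c c]] show ?thesis by (metis)
qed

lemma coord_vec_eq: "coord_vec A c x e = (\<lambda>c'. if c' \<in> charts_at A x then dtrans c c' x e else 0)"
  unfolding coord_vec_def dtrans_def ..

lemma tangent_space_iff:
  "v \<in> tangent_space A x \<longleftrightarrow> (\<forall>c\<in>charts_at A x. \<forall>c'\<in>charts_at A x. v c' = dtrans c c' x (v c)) \<and>
    (\<forall>c. c \<notin> charts_at A x \<longrightarrow> v c = 0)"
  by (simp add: tangent_space_def dtrans_def)

lemma tangent_space_transition:
  "v \<in> tangent_space A x \<Longrightarrow> c \<in> charts_at A x \<Longrightarrow> c' \<in> charts_at A x \<Longrightarrow> v c' = dtrans c c' x (v c)"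
  unfolding tangent_space_iff by blast

lemma tangent_space_outside: "v \<in> tangent_space A x \<Longrightarrow> c \<notin> charts_at A x \<Longrightarrow> v c = 0"
  unfolding tangent_space_iff by blast

lemma subspace_tangent_space: "subspace (tangent_space A x)"
proof (rule subspaceI)
  show "0 \<in> tangent_space A x"
    by (simp add: tangent_space_iff zero_fun_def linear_0[OF dtrans_linear])
  fix v assume v: "v \<in> tangent_space A x"
  show "r *\<^sub>R v \<in> tangent_space A x" for r
    unfolding tangent_space_iff scaleR_fun_def
  proof (intro conjI ballI allI impI)
    fix c c' assume c: "c \<in> charts_at A x" "c' \<in> charts_at A x"
    show "r *\<^sub>R v c' = dtrans c c' x (r *\<^sub>R v c)"
      unfolding linear_scale[OF dtrans_linear[OF c]] tangent_space_transition[OF v c] ..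
  qed (simp add: tangent_space_outside[OF v])
  fix w assume w: "w \<in> tangent_space A x"
  show "v + w \<in> tangent_space A x"
    unfolding tangent_space_iff plus_fun_def
  proof (intro conjI ballI allI impI)
    fix c c' assume c: "c \<in> charts_at A x" "c' \<in> charts_at A x"
    show "v c' + w c' = dtrans c c' x (v c + w c)"
      unfolding linear_add[OF dtrans_linear[OF c]]
      using tangent_space_transition[OF v c] tangent_space_transition[OF w c] by (rule arg_cong2)
  qed (simp add: tangent_space_outside[OF v] tangent_space_outside[OF w])
qed

context
  fixes c x assumes c: "c \<in> charts_at A x"
begin

lemma coord_vec_in: "coord_vec A c x e \<in> tangent_space A x"
  unfolding tangent_space_iff coord_vec_eq using dtrans_compose[OF c] by simp

lemma coord_vec_apply [simp]: "coord_vec A c x e c = e"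
  using c by (simp add: coord_vec_eq dtrans_same)

lemma coord_vec_tangent: "v \<in> tangent_space A x \<Longrightarrow> coord_vec A c x (v c) = v"
  unfolding coord_vec_eq
  by (rule ext) (auto simp: tangent_space_outside intro: tangent_space_transition[OF _ c, symmetric])

lemma linear_coord_vec: "linear (coord_vec A c x)"
  by (rule linearI)
     (auto simp: coord_vec_eq fun_eq_iff plus_fun_def scaleR_fun_def linear_add[OF dtrans_linear[OF c]]
       linear_scale[OF dtrans_linear[OF c]])

lemma coord_vec_transition: "c' \<in> charts_at A x \<Longrightarrow> coord_vec A c x e = coord_vec A c' x (dtrans c c' x e)"
  unfolding coord_vec_eq fun_eq_iff using dtrans_compose[OF c] by simp

lemma coord_vec_eqI:
  assumes "v \<in> tangent_space A x" "w \<in> tangent_space A x" "v c = w c"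
  shows "v = w"
  using coord_vec_tangent[OF assms(1)] coord_vec_tangent[OF assms(2)] unfolding assms(3) by (rule trans[OF sym])

lemma map_coord_vec_tuples: "length es = p \<Longrightarrow> map (coord_vec A c x) es \<in> tuples p (tangent_space A x)"
  by (auto simp: tuples_def coord_vec_in)

lemma tangent_tuples_coord:
  "vs \<in> tuples p (tangent_space A x) \<Longrightarrow> map (coord_vec A c x) (map (\<lambda>v. v c) vs) = vs"
  by (auto simp: tuples_def coord_vec_tangent intro!: map_idI)

text \<open>The finite frame and the coordinate functionals that \<open>critical_pointsI\<close>
  asks for.\<close>

lemma tangent_frame:
  assumes "v \<in> tangent_space A x"
  shows "v = (\<Sum>j\<in>Basis. inner (v c) j *\<^sub>R coord_vec A c x j)"
proof -
  have "coord_vec A c x (\<Sum>j\<in>Basis. inner (v c) j *\<^sub>R j) = (\<Sum>j\<in>Basis. inner (v c) j *\<^sub>R coord_vec A c x j)"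
    by (simp add: linear_sum[OF linear_coord_vec] linear_scale[OF linear_coord_vec])
  then show ?thesis using coord_vec_tangent[OF assms] by (simp add: euclidean_representation)
qed

end

text \<open>\<open>tangent_sub\<close> admits any slice, so all slices through \<open>x\<close> must
  agree on the tangent space. A coordinate line in \<open>S\<close> through \<open>x\<close> stays
  in both slices for a short time; the transition map therefore takes it into \<open>S'\<close>, and
  its velocity lies in \<open>S'\<close> too.\<close>

lemma slice_tangent:
  assumes s: "slice M A p N c S W" "x \<in> W" and s': "slice M A p N c' S' W'" "x \<in> W'" and e: "e \<in> S"
  shows "dtrans c c' x e \<in> S'"
proof -
  have cA: "c \<in> A" "x \<in> fst c" "c' \<in> A" "x \<in> fst c'" using s s' by (auto simp: slice_def)
  then have cx: "c \<in> charts_at A x" "c' \<in> charts_at A x" by (auto simp: charts_at_def)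
  have S: "subspace S" "subspace S'" using s s' by (auto simp: slice_def)
  have W: "snd c ` W = snd c ` fst c \<inter> S" "W \<subseteq> fst c" using s by (auto simp: slice_def)
  have W': "snd c' ` W' = snd c' ` fst c' \<inter> S'" using s' by (auto simp: slice_def)
  \<comment> \<open>\<open>N\<close> may be finer than the topology induced from \<open>M\<close>,
    but on a slice the two coincide. Hence an \<open>M\<close>-open set \<open>G\<close> cuts
    \<open>W \<inter> W'\<close> out of \<open>W\<close>, and the coordinate line stays in
    \<open>G\<close> for short times.\<close>
  have "openin (subtopology N W) (W \<inter> W')"
    using s' by (auto simp: slice_def openin_subtopology_Int2)
  then have "openin (subtopology M W) (W \<inter> W')" using s by (simp add: slice_def)
  then obtain G where G: "openin M G" "W \<inter> W' = G \<inter> W" by (auto simp: openin_subtopology)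
  define Ob where "Ob = snd c ` (fst c \<inter> (fst c' \<inter> G))"
  have "open Ob" unfolding Ob_def using G cA by (intro is_chart_open_image[OF chart] openin_Int chart_open)
  have "x \<in> G" using G s s' by blast
  then have xO: "snd c x \<in> Ob" using cA by (auto simp: Ob_def)
  have cxS: "snd c x \<in> S" using W s(2) by blast
  have curve: "transition c c' (snd c x + t *\<^sub>R e) \<in> S'" if t: "snd c x + t *\<^sub>R e \<in> Ob" for t
  proof -
    obtain m where m: "m \<in> fst c" "m \<in> fst c'" "m \<in> G" "snd c x + t *\<^sub>R e = snd c m" using t by (auto simp: Ob_def)
    have "snd c m \<in> S" using S cxS e by (simp flip: m(4) add: subspace_add subspace_mul)
    then have "snd c m \<in> snd c ` W" using W m by auto
    then have "m \<in> W" using is_chart_inj[OF chart[OF cA(1)]] W m(1) by (auto dest: inj_onD)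
    then have "m \<in> W'" using G m by blast
    then have "snd c' m \<in> S'" using W' by blast
    then show ?thesis using m by (simp add: transition_apply[OF cA(1)])
  qed
  define T where "T = (\<lambda>t. snd c x + t *\<^sub>R e) -` Ob"
  have T: "open T" "0 \<in> T"
    unfolding T_def using \<open>open Ob\<close> xO by (auto intro!: open_vimage continuous_intros)
  \<comment> \<open>Membership in \<open>S'\<close> is tested against the orthogonal complement,
    where the velocity becomes the derivative of a function vanishing near 0.\<close>
  have "inner w (dtrans c c' x e) = 0" if w: "w \<in> orthogonal_comp S'" for w
  proof -
    have "((\<lambda>t. snd c x + t *\<^sub>R e) has_derivative (\<lambda>t. t *\<^sub>R e)) (at 0)"
      by (auto intro!: derivative_eq_intros)
    from has_derivative_compose[OF this, of "transition c c'" "dtrans c c' x"] transition_has_derivative[OF cx]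
    have "((\<lambda>t. inner w (transition c c' (snd c x + t *\<^sub>R e))) has_derivative (\<lambda>t. inner w (dtrans c c' x (t *\<^sub>R e)))) (at 0)"
      by (auto intro: has_derivative_inner_right)
    then have "((\<lambda>t. 0) has_derivative (\<lambda>t. inner w (dtrans c c' x (t *\<^sub>R e)))) (at 0)"
      by (rule has_derivative_transform_within_open[OF _ T])
         (use w curve in \<open>auto simp: T_def orthogonal_comp_def real_inner_class.orthogonal_def inner_commute\<close>)
    from has_derivative_unique[OF this has_derivative_const] show ?thesis by (metis scaleR_one)
  qed
  then have "dtrans c c' x e \<in> orthogonal_comp (orthogonal_comp S')"
    by (auto simp: orthogonal_comp_def real_inner_class.orthogonal_def)
  then show ?thesis using S by (simp add: orthogonal_comp_self)
qed

lemma tangent_sub_slice: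
  assumes "slice M A p N c S W" "x \<in> W"
  shows "tangent_sub M A p N x = {v \<in> tangent_space A x. v c \<in> S}"
proof -
  have "v c \<in> S" if v: "v \<in> tangent_space A x" and s': "slice M A p N c' S' W'" "x \<in> W'" "v c' \<in> S'" for v c' S' W'
  proof -
    have "c \<in> charts_at A x" "c' \<in> charts_at A x" using assms s' by (auto simp: slice_def charts_at_def)
    then have "v c = dtrans c' c x (v c')" using v by (intro tangent_space_transition)
    then show ?thesis using slice_tangent[OF s'(1,2) assms s'(3)] by simp
  qed
  then show ?thesis using assms unfolding tangent_sub_def by blast
qed

text \<open>Dimension count in a slice chart, where \<open>dim S = p\<close> is available:
  orthonormality makes the coordinate vectors of \<open>es\<close> independent, since pairing a
  vanishing combination with one vector isolates its coefficient.\<close>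

lemma tangent_sub_span:
  assumes sl: "slice M A p N c S W" "x \<in> W" and ip: "inner_product_on (tangent_space A x) ip"
    and es: "es \<in> tuples p (tangent_sub M A p N x)" and on: "orthonormal ip es"
  shows "tangent_sub M A p N x \<subseteq> span (set es)"
proof
  let ?T = "tangent_space A x"
  have c: "c \<in> charts_at A x" using sl by (auto simp: slice_def charts_at_def)
  note sub = tangent_sub_slice[OF sl]
  note V = subspace_tangent_space[of x]
  have esT: "v \<in> ?T" "v c \<in> S" if "v \<in> set es" for v using es that by (auto simp: tuples_def sub)
  define E where "E = (\<lambda>v. v c) ` set es"
  have inj: "inj_on (\<lambda>v. v c) (set es)" using coord_vec_eqI[OF c] esT by (auto simp: inj_on_def)
  have card: "card E = p"
    using tuples_length[OF es] distinct_card[OF orthonormal_distinct[OF on]] by (simp add: E_def card_image[OF inj])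
  have "independent E"
  proof (rule independent_if_scalars_zero)
    fix f e assume sum0: "(\<Sum>e\<in>E. f e *\<^sub>R e) = 0" and "e \<in> E"
    then obtain v where v: "v \<in> set es" "e = v c" by (auto simp: E_def)
    then obtain i where i: "i < length es" "es ! i = v" by (auto simp: in_set_conv_nth)
    have "(\<Sum>w\<in>set es. f (w c) *\<^sub>R w) = coord_vec A c x (\<Sum>e\<in>E. f e *\<^sub>R e)"
      using esT by (simp add: linear_sum[OF linear_coord_vec[OF c]] linear_scale[OF linear_coord_vec[OF c]]
          E_def sum.reindex[OF inj] coord_vec_tangent[OF c])
    then have "0 = ip v (\<Sum>w\<in>set es. f (w c) *\<^sub>R w)"
      using sum0 linear_0[OF linear_coord_vec[OF c]] inner_product_on_sum_right[OF ip V esT(1)[OF v(1)], of "{}"] by simp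
    also have "\<dots> = (\<Sum>w\<in>set es. f (w c) * ip v w)"
      by (rule inner_product_on_sum_right[OF ip V esT(1)[OF v(1)]]) (rule esT)
    also have "\<dots> = (\<Sum>w\<in>set es. if w = v then f (w c) else 0)"
    proof (rule sum.cong)
      fix w assume "w \<in> set es"
      then obtain j where "j < length es" "es ! j = w" by (auto simp: in_set_conv_nth)
      then show "f (w c) * ip v w = (if w = v then f (w c) else 0)"
        using on i orthonormal_distinct[OF on] by (auto simp: orthonormal_def nth_eq_iff_index_eq)
    qed simp
    also have "\<dots> = f e" using v by (simp add: sum.delta)
    finally show "f e = 0" by simp
  qed (simp add: E_def)
  moreover have "E \<subseteq> S" using esT by (auto simp: E_def)
  ultimately have SE: "S \<subseteq> span E"
    using sl card by (intro card_ge_dim_independent) (auto simp: slice_def)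
  fix v assume "v \<in> tangent_sub M A p N x"
  then have v: "v \<in> ?T" "v c \<in> S" by (auto simp: sub)
  then have "coord_vec A c x (v c) \<in> coord_vec A c x ` span E" using SE by auto
  also have "\<dots> = span (coord_vec A c x ` E)" by (rule linear_span_image[OF linear_coord_vec[OF c], symmetric])
  also have "coord_vec A c x ` E = set es" using esT by (force simp: E_def image_image coord_vec_tangent[OF c])
  finally show "v \<in> span (set es)" using coord_vec_tangent[OF c v(1)] by simp
qed

end

section \<open>Linear differential equations and the Levi-Civita connection\<close>

text \<open>The time interval has length 1 and \<open>norm (A t) \<le> 1/2\<close>, so the integral
  operator contracts by 1/2 and one fixed point covers the whole interval. Solving for operators
  rather than vectors makes the flow linear by construction.\<close>

lemma linear_ode_exists:
  fixes A :: "real \<Rightarrow> 'e::euclidean_space \<Rightarrow>\<^sub>L 'e"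
  assumes A: "continuous_on UNIV A" and bound: "\<And>t. norm (A t) \<le> 1/2"
  obtains X where "X 0 = id_blinfun"
    "\<And>t. t \<in> {0..1} \<Longrightarrow> (X has_vector_derivative (A t o\<^sub>L X t)) (at t within {0..1})"
proof -
  \<comment> \<open>Clamping time to the unit interval turns the integral into a bounded continuous
    function on the whole line, an element of the complete space \<open>bcontfun\<close>.\<close>
  define cl where "cl t = max 0 (min 1 t)" for t :: real
  have cl: "cl t \<in> {0..1}" for t by (auto simp: cl_def)
  have cl_cont: "continuous_on UNIV cl" unfolding cl_def by (intro continuous_intros)
  define h where "h X t = integral {0..cl t} (\<lambda>s. A s o\<^sub>L apply_bcontfun X s)" for X :: "(real, 'e \<Rightarrow>\<^sub>L 'e) bcontfun" and t
  have cont: "continuous_on S (\<lambda>s. A s o\<^sub>L apply_bcontfun X s)" for S and X :: "(real, 'e \<Rightarrow>\<^sub>L 'e) bcontfun"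
    by (intro bounded_bilinear.continuous_on[OF bounded_bilinear_blinfun_compose]
        continuous_on_apply_bcontfun continuous_on_subset[OF A subset_UNIV])
  have h_cont: "continuous_on UNIV (h X)" for X
  proof -
    have "continuous_on {0..1} (\<lambda>x. integral {0..x} (\<lambda>s. A s o\<^sub>L apply_bcontfun X s))"
      by (intro indefinite_integral_continuous_1 integrable_continuous_interval cont)
    then show ?thesis unfolding h_def[abs_def]
      by (rule continuous_on_compose2[OF _ cl_cont]) (use cl in auto)
  qed
  have h_bound: "norm (integral {0..cl t} (\<lambda>s. A s o\<^sub>L Y s)) \<le> B / 2"
    if Y: "continuous_on UNIV Y" "\<And>s. norm (Y s) \<le> B" for Y :: "real \<Rightarrow> 'e \<Rightarrow>\<^sub>L 'e" and B t
  proof -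
    have B0: "0 \<le> B" by (rule order_trans[OF norm_ge_zero Y(2)[of 0]])
    have "norm (integral {0..cl t} (\<lambda>s. A s o\<^sub>L Y s)) \<le> (B / 2) * (cl t - 0)"
    proof (rule integral_bound)
      show "norm (A s o\<^sub>L Y s) \<le> B / 2" for s
        using norm_blinfun_compose[of "A s" "Y s"] mult_mono[OF bound[of s] Y(2)[of s]] B0 by simp
    qed (use cl[of t] in \<open>auto intro!: bounded_bilinear.continuous_on[OF bounded_bilinear_blinfun_compose]
            continuous_on_subset[OF A subset_UNIV] continuous_on_subset[OF Y(1) subset_UNIV]\<close>)
    also have "\<dots> \<le> (B / 2) * 1" using cl[of t] B0 by (intro mult_left_mono) auto
    finally show ?thesis by simp
  qed
  define T where "T X = Bcontfun (\<lambda>t. id_blinfun + h X t)" for X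
  have T: "apply_bcontfun (T X) = (\<lambda>t. id_blinfun + h X t)" for X
    unfolding T_def
  proof (rule Bcontfun_inverse, rule bcontfun_normI)
    show "continuous_on UNIV (\<lambda>t. id_blinfun + h X t)" by (intro continuous_intros h_cont)
    show "norm (id_blinfun + h X t) \<le> norm (id_blinfun :: 'e \<Rightarrow>\<^sub>L 'e) + norm X / 2" for t
      unfolding h_def by (intro norm_triangle_le add_left_mono h_bound norm_bounded) auto
  qed
  have "dist (T X) (T Y) \<le> 1/2 * dist X Y" for X Y
  proof (rule dist_bound)
    fix t
    have "h X t - h Y t = integral {0..cl t} (\<lambda>s. (A s o\<^sub>L apply_bcontfun X s) - (A s o\<^sub>L apply_bcontfun Y s))"
      unfolding h_def by (intro Henstock_Kurzweil_Integration.integral_diff[symmetric] integrable_continuous_interval cont)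
    also have "\<dots> = integral {0..cl t} (\<lambda>s. A s o\<^sub>L (apply_bcontfun X s - apply_bcontfun Y s))"
      by (simp add: bounded_bilinear.diff_right[OF bounded_bilinear_blinfun_compose])
    finally have "norm (h X t - h Y t) = norm (integral {0..cl t} (\<lambda>s. A s o\<^sub>L (apply_bcontfun X s - apply_bcontfun Y s)))"
      by simp
    also have "\<dots> \<le> dist X Y / 2"
      by (rule h_bound) (auto intro!: continuous_intros simp: dist_bounded simp flip: dist_norm)
    finally have "norm (h X t - h Y t) \<le> dist X Y / 2" .
    then show "dist (apply_bcontfun (T X) t) (apply_bcontfun (T Y) t) \<le> 1/2 * dist X Y"
      by (simp add: T dist_norm)
  qed
  then have "\<exists>!X. T X = X" by (intro banach_fix_type[of "1/2"]) auto
  then obtain X where "T X = X" by blast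
  then have X: "apply_bcontfun X = (\<lambda>t. id_blinfun + h X t)" using T[of X] by simp
  show ?thesis
  proof (rule that)
    show "apply_bcontfun X 0 = id_blinfun" unfolding X by (simp add: h_def cl_def)
    fix t :: real assume t: "t \<in> {0..1}"
    have "((\<lambda>t. integral {0..t} (\<lambda>s. A s o\<^sub>L apply_bcontfun X s)) has_vector_derivative (A t o\<^sub>L apply_bcontfun X t)) (at t within {0..1})"
      by (rule integral_has_vector_derivative[OF cont t])
    then have "((\<lambda>t. id_blinfun + integral {0..t} (\<lambda>s. A s o\<^sub>L apply_bcontfun X s)) has_vector_derivative (A t o\<^sub>L apply_bcontfun X t)) (at t within {0..1})"
      by (auto intro!: derivative_eq_intros)
    then show "(apply_bcontfun X has_vector_derivative (A t o\<^sub>L apply_bcontfun X t)) (at t within {0..1})"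
    proof (rule has_vector_derivative_transform[OF t, rotated])
      fix s :: real assume "s \<in> {0..1}"
      then have "cl s = s" by (simp add: cl_def)
      then show "apply_bcontfun X s = id_blinfun + integral {0..s} (\<lambda>s. A s o\<^sub>L apply_bcontfun X s)"
        by (subst X) (simp add: h_def)
    qed
  qed
qed

text \<open>Definiteness makes \<open>L\<close>, which represents \<open>B z\<close> in the standard
  inner product, injective and hence onto. The result justifies the \<open>THE\<close> in the
  Christoffel symbol.\<close>

lemma inner_product_riesz:
  fixes B :: "'e::euclidean_space \<Rightarrow> 'e \<Rightarrow> real"
  assumes B: "inner_product_on UNIV B" and r: "linear r"
  shows "\<exists>!z. \<forall>e. B z e = r e"
proof -
  have lin: "linear (B v)" for v
    using inner_product_on_linear[OF B, of v] by (intro linearI) (auto simp: linear_between_def)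
  have sym: "B v w = B w v" for v w using inner_product_on_sym[OF B] by simp
  have zero: "z = 0" if "\<And>e. B z e = 0" for z using inner_product_on_pos[OF B, of z] that[of z] by force
  define L where "L z = (\<Sum>b\<in>Basis. B z b *\<^sub>R b)" for z
  have "linear L" unfolding L_def
    by (rule linearI) (simp_all add: sym[of _ "_ :: 'e"] linear_add[OF lin] linear_scale[OF lin] scaleR_add_left sum.distrib scaleR_sum_right)
  have Lb: "inner (L z) b = B z b" if "b \<in> Basis" for z b
    using that unfolding L_def by (simp add: inner_sum_left inner_Basis if_distrib sum.delta cong: if_cong)
  have ext: "r1 e = r2 e" if "linear r1" "linear r2" "\<And>b. b \<in> Basis \<Longrightarrow> r1 b = r2 b" for r1 r2 :: "'e \<Rightarrow> real" and e
    using linear_eq_stdbasis[OF that] by simp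
  have "z = 0" if "L z = 0" for z
  proof (rule zero)
    fix e show "B z e = 0"
      by (rule ext[OF lin linear_zero]) (simp add: that flip: Lb)
  qed
  then have "inj L" using \<open>linear L\<close> by (simp add: linear_injective_0)
  with \<open>linear L\<close> have "surj L" by (rule linear_injective_imp_surjective) simp
  then obtain z where z: "L z = (\<Sum>b\<in>Basis. r b *\<^sub>R b)" by (metis surjD)
  have "B z e = r e" for e
  proof (rule ext[OF lin r])
    fix b :: 'e assume b: "b \<in> Basis"
    have "B z b = inner (\<Sum>b\<in>Basis. r b *\<^sub>R b) b" using Lb[OF b, of z] by (simp add: z)
    then show "B z b = r b" using b by (simp add: inner_sum_left inner_Basis if_distrib sum.delta cong: if_cong)
  qed
  moreover have "y = z" if "\<forall>e. B y e = r e" for y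
  proof -
    have "B (y - z) e = 0" for e
      using that calculation by (simp add: sym[of "y - z"] linear_diff[OF lin]) (simp add: sym)
    then show ?thesis using zero[of "y - z"] by simp
  qed
  ultimately show ?thesis by blast
qed

section \<open>The Levi-Civita connection on an open subset of Euclidean space\<close>

locale metric_field =
  fixes \<Omega> :: "'e::euclidean_space set" and G :: "'e \<Rightarrow> 'e \<Rightarrow> 'e \<Rightarrow> real"
  assumes \<Omega>: "open \<Omega>"
    and G_inner: "\<And>y. y \<in> \<Omega> \<Longrightarrow> inner_product_on UNIV (G y)"
    and G_C1: "\<And>v w. Ck_on (Suc 0) \<Omega> (\<lambda>y. G y v w)"
begin

lemma G_linear: "y \<in> \<Omega> \<Longrightarrow> linear (G y v)"
  using inner_product_on_linear[OF G_inner, of y v] by (intro linearI) (auto simp: linear_between_def)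

lemma G_sym: "y \<in> \<Omega> \<Longrightarrow> G y v w = G y w v"
  using inner_product_on_sym[OF G_inner] by simp

definition DG :: "'e \<Rightarrow> 'e \<Rightarrow> 'e \<Rightarrow> 'e \<Rightarrow> real" where
  "DG y u v w = frechet_derivative (\<lambda>t. G t v w) (at y) u"

lemma DG_has_derivative: "y \<in> \<Omega> \<Longrightarrow> ((\<lambda>t. G t v w) has_derivative (\<lambda>u. DG y u v w)) (at y)"
  unfolding DG_def by (rule Ck_on_has_derivative[OF G_C1])

lemma DG_continuous: "continuous_on \<Omega> (\<lambda>y. DG y u v w)"
  unfolding DG_def using G_C1[of v w] by simp

lemma G_continuous: "continuous_on \<Omega> (\<lambda>y. G y v w)"
  using Ck_on_Suc_imp[OF G_C1] by simp

lemma DG_linear1: "y \<in> \<Omega> \<Longrightarrow> linear (\<lambda>u. DG y u v w)"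
  by (rule has_derivative_linear[OF DG_has_derivative])

lemma DG_sym: "y \<in> \<Omega> \<Longrightarrow> DG y u v w = DG y u w v"
  using has_derivative_unique[OF DG_has_derivative has_derivative_transform_within_open[OF DG_has_derivative \<Omega> _ G_sym]]
  by (metis (no_types))

lemma DG_linear3:
  assumes y: "y \<in> \<Omega>" shows "linear (\<lambda>w. DG y u v w)"
proof (rule linearI)
  fix w w'
  have "((\<lambda>t. G t v w + G t v w') has_derivative (\<lambda>u. DG y u v w + DG y u v w')) (at y)"
    by (intro has_derivative_add DG_has_derivative y)
  then have "((\<lambda>t. G t v (w + w')) has_derivative (\<lambda>u. DG y u v w + DG y u v w')) (at y)"
    by (rule has_derivative_transform_within_open[OF _ \<Omega> y]) (simp add: linear_add[OF G_linear])
  from has_derivative_unique[OF DG_has_derivative[OF y] this]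
  show "DG y u v (w + w') = DG y u v w + DG y u v w'" by (rule fun_cong)
next
  fix r w
  have "((\<lambda>t. r * G t v w) has_derivative (\<lambda>u. r * DG y u v w)) (at y)"
    by (intro has_derivative_mult_right DG_has_derivative y)
  then have "((\<lambda>t. G t v (r *\<^sub>R w)) has_derivative (\<lambda>u. r * DG y u v w)) (at y)"
    by (rule has_derivative_transform_within_open[OF _ \<Omega> y]) (simp add: linear_scale[OF G_linear])
  from has_derivative_unique[OF DG_has_derivative[OF y] this]
  show "DG y u v (r *\<^sub>R w) = r *\<^sub>R DG y u v w" by (simp add: fun_eq_iff)
qed

lemma DG_linear2: "y \<in> \<Omega> \<Longrightarrow> linear (\<lambda>v. DG y u v w)"
  using DG_linear3[of y u w] by (simp add: DG_sym[of y u _ w])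

definition koszul :: "'e \<Rightarrow> 'e \<Rightarrow> 'e \<Rightarrow> 'e \<Rightarrow> real" where
  "koszul y u w e = (DG y u w e + DG y w u e - DG y e u w) / 2"

text \<open>Kept literally parallel to \<open>christoffel\<close>, so that the two agree by
  unfolding in a chart.\<close>

definition chr :: "'e \<Rightarrow> 'e \<Rightarrow> 'e \<Rightarrow> 'e" where
  "chr y u w = (THE z. \<forall>e. 2 * G y z e =
       frechet_derivative (\<lambda>t. G t w e) (at y) u +
       frechet_derivative (\<lambda>t. G t u e) (at y) w -
       frechet_derivative (\<lambda>t. G t u w) (at y) e)"

context
  fixes y assumes y: "y \<in> \<Omega>"
begin

lemma koszul_linear: "linear (koszul y u w)" "linear (\<lambda>u. koszul y u w e)" "linear (\<lambda>w. koszul y u w e)"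
proof -
  note lins = DG_linear1[OF y] DG_linear2[OF y] DG_linear3[OF y]
  show "linear (koszul y u w)" "linear (\<lambda>u. koszul y u w e)" "linear (\<lambda>w. koszul y u w e)"
    by (rule linearI; simp add: koszul_def linear_add[OF lins(1)] linear_add[OF lins(2)] linear_add[OF lins(3)]
      linear_scale[OF lins(1)] linear_scale[OF lins(2)] linear_scale[OF lins(3)] field_simps)+
qed

lemma chr_unique: "\<exists>!z. \<forall>e. G y z e = koszul y u w e"
  by (rule inner_product_riesz[OF G_inner[OF y] koszul_linear(1)])

lemma chr_eq: "chr y u w = (THE z. \<forall>e. G y z e = koszul y u w e)"
  unfolding chr_def koszul_def DG_def by (simp add: field_simps)

lemma G_chr: "G y (chr y u w) e = koszul y u w e"
  using theI'[OF chr_unique[of u w]] unfolding chr_eq by blast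

lemma chr_eqI: "(\<And>e. G y z e = koszul y u w e) \<Longrightarrow> chr y u w = z"
  unfolding chr_eq using chr_unique[of u w] by (intro the1_equality) auto

lemma chr_linear: "linear (chr y u)" "linear (\<lambda>u. chr y u w)"
proof -
  have G1: "G y (v + v') e = G y v e + G y v' e" "G y (r *\<^sub>R v) e = r * G y v e" for v v' e r
    using linear_add[OF G_linear[OF y], of e v v'] linear_scale[OF G_linear[OF y], of e r v]
    by (simp_all add: G_sym[OF y, of _ e])
  show "linear (chr y u)"
    by (rule linearI; rule chr_eqI)
       (simp_all add: G1 G_chr linear_add[OF koszul_linear(3)] linear_scale[OF koszul_linear(3)])
  show "linear (\<lambda>u. chr y u w)"
    by (rule linearI; rule chr_eqI)
       (simp_all add: G1 G_chr linear_add[OF koszul_linear(2)] linear_scale[OF koszul_linear(2)])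
qed

text \<open>In the sum of the two Koszul expressions the derivatives in the directions
  \<open>v\<close> and \<open>w\<close> cancel, and the two in the direction \<open>u\<close> agree
  by symmetry.\<close>

lemma metric_compatible: "DG y u v w = G y (chr y u v) w + G y v (chr y u w)"
  using G_sym[OF y, of v "chr y u w"] DG_sym[OF y, of u w v] DG_sym[OF y, of w u v] DG_sym[OF y, of v u w]
  by (simp add: G_chr koszul_def field_simps)

end

end

lemma bilinear_expand:
  fixes B :: "'e::euclidean_space \<Rightarrow> 'e \<Rightarrow> 'b::real_vector"
  assumes "\<And>v. linear (B v)" "\<And>w. linear (\<lambda>v. B v w)"
  shows "B v w = (\<Sum>i\<in>Basis. \<Sum>j\<in>Basis. (inner v i * inner w j) *\<^sub>R B i j)"
proof -
  have "B v w = B (\<Sum>i\<in>Basis. inner v i *\<^sub>R i) w" by (simp add: euclidean_representation)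
  also have "\<dots> = (\<Sum>i\<in>Basis. inner v i *\<^sub>R B i w)"
    by (simp add: linear_sum[OF assms(2)] linear_scale[OF assms(2)])
  also have "\<dots> = (\<Sum>i\<in>Basis. inner v i *\<^sub>R B i (\<Sum>j\<in>Basis. inner w j *\<^sub>R j))"
    by (simp add: euclidean_representation)
  also have "\<dots> = (\<Sum>i\<in>Basis. \<Sum>j\<in>Basis. (inner v i * inner w j) *\<^sub>R B i j)"
    by (simp add: linear_sum[OF assms(1)] linear_scale[OF assms(1)] scaleR_sum_right)
  finally show ?thesis .
qed

context metric_field
begin

lemma G_expand: "y \<in> \<Omega> \<Longrightarrow> G y v w = (\<Sum>i\<in>Basis. \<Sum>j\<in>Basis. (inner v i * inner w j) * G y i j)"
proof -
  assume y: "y \<in> \<Omega>"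
  have "linear (\<lambda>v. G y v w)" for w using G_linear[OF y, of w] by (simp add: G_sym[OF y, of _ w])
  from bilinear_expand[of "G y" v w, OF G_linear[OF y] this] show ?thesis by simp
qed

text \<open>\<open>G y d d\<close> attains a positive minimum on the product of \<open>K\<close>
  with the unit sphere; homogeneity in \<open>d\<close> does the rest.\<close>

lemma G_coercive:
  assumes "compact K" "K \<subseteq> \<Omega>"
  obtains \<mu> where "\<mu> > 0" "\<And>y d. y \<in> K \<Longrightarrow> \<mu> * (norm d)\<^sup>2 \<le> G y d d"
proof (cases "K = {}")
  case False
  \<comment> \<open>Continuity of \<open>G\<close> is known for fixed arguments; the expansion in
    \<open>Basis\<close> yields joint continuity in \<open>y\<close> and \<open>d\<close>.\<close>
  let ?f = "\<lambda>(y, d). \<Sum>i\<in>Basis. \<Sum>j\<in>Basis. (inner d i * inner d j) * G y i j"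
  have cont: "continuous_on (K \<times> sphere (0::'e) 1) ?f"
    unfolding case_prod_beta
    by (intro continuous_intros continuous_on_compose2[OF continuous_on_subset[OF G_continuous assms(2)]]) auto
  have cpt: "compact (K \<times> sphere (0::'e) 1)" using assms by (intro compact_Times compact_sphere)
  obtain b :: 'e where "norm b = 1" using norm_Basis SOME_Basis by blast
  then have ne: "K \<times> sphere (0::'e) 1 \<noteq> {}" using False by auto
  obtain q where q: "q \<in> K \<times> sphere (0::'e) 1"
    and min_q: "\<And>q'. q' \<in> K \<times> sphere (0::'e) 1 \<Longrightarrow> ?f q \<le> ?f q'"
    using continuous_attains_inf[OF cpt ne cont] by blast
  obtain y0 d0 where yd: "q = (y0, d0)" by (cases q)
  have m: "y0 \<in> K" "norm d0 = 1" using q by (auto simp: yd)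
  have min: "?f (y0, d0) \<le> ?f (y, d)" if "y \<in> K" "norm d = 1" for y d
    using min_q[of "(y, d)"] that unfolding yd by simp
  have y0: "y0 \<in> \<Omega>" using m assms by blast
  have "d0 \<noteq> 0" using m by auto
  then have pos: "G y0 d0 d0 > 0" using inner_product_on_pos[OF G_inner[OF y0]] by simp
  show ?thesis
  proof (rule that[OF pos])
    fix y d assume y: "y \<in> K"
    then have y\<Omega>: "y \<in> \<Omega>" using assms by blast
    show "G y0 d0 d0 * (norm d)\<^sup>2 \<le> G y d d"
    proof (cases "d = 0")
      case True
      then show ?thesis using linear_0[OF G_linear[OF y\<Omega>]] by simp
    next
      case False
      define e where "e = (1 / norm d) *\<^sub>R d"
      have "norm e = 1" using False by (simp add: e_def)
      then have le: "G y0 d0 d0 \<le> G y e e" using min[OF y, of e] G_expand[OF y0, of d0 d0] G_expand[OF y\<Omega>, of e e] by simp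
      have d: "norm d *\<^sub>R e = d" using False by (simp add: e_def)
      have "G y (a *\<^sub>R e) (a *\<^sub>R e) = a * a * G y e e" for a
        using linear_scale[OF G_linear[OF y\<Omega>], of "a *\<^sub>R e" a e] linear_scale[OF G_linear[OF y\<Omega>], of e a e]
          G_sym[OF y\<Omega>, of "a *\<^sub>R e" e] by simp
      from this[of "norm d"] have "G y d d = (norm d * norm d) * G y e e" unfolding d .
      also have "\<dots> \<ge> (norm d * norm d) * G y0 d0 d0" by (rule mult_left_mono[OF le]) simp
      finally show ?thesis by (simp add: power2_eq_square mult.commute)
    qed
  qed
qed (use that[of 1] in auto)

text \<open>Uniform positivity of the metric on a compact set bounds the difference of the
  Christoffel symbols at two points by the variation of the Koszul expression.\<close>

lemma chr_continuous: "continuous_on \<Omega> (\<lambda>y. chr y u w)"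
proof (rule continuous_at_imp_continuous_on, rule ballI)
  fix y0 assume y0: "y0 \<in> \<Omega>"
  obtain r where r: "r > 0" "cball y0 r \<subseteq> \<Omega>" using \<Omega> y0 open_contains_cball by blast
  obtain \<mu> where \<mu>: "\<mu> > 0" "\<And>y d. y \<in> cball y0 r \<Longrightarrow> \<mu> * (norm d)\<^sup>2 \<le> G y d d"
    using G_coercive[OF compact_cball r(2)] by blast
  define z where "z = chr y0 u w"
  \<comment> \<open>\<open>\<epsilon> y\<close> measures how far the fixed vector \<open>z\<close>
    is from solving the Koszul equation at \<open>y\<close>.\<close>
  define \<epsilon> where "\<epsilon> y = (\<Sum>b\<in>Basis. \<bar>koszul y u w b - G y z b\<bar>)" for y
  have "continuous_on \<Omega> \<epsilon>"
    unfolding \<epsilon>_def[abs_def] koszul_def by (intro continuous_intros DG_continuous G_continuous) auto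
  then have "isCont \<epsilon> y0" using \<Omega> y0 continuous_on_eq_continuous_at by blast
  moreover have "\<epsilon> y0 = 0" by (simp add: \<epsilon>_def z_def G_chr[OF y0])
  ultimately have lim: "((\<lambda>y. \<epsilon> y / \<mu>) \<longlongrightarrow> 0) (at y0)"
    using tendsto_divide[of \<epsilon> "\<epsilon> y0" "at y0" "\<lambda>_. \<mu>" \<mu>] \<mu>(1) by (simp add: isCont_def)
  have "norm (chr y u w - z) \<le> \<epsilon> y / \<mu>" if "y \<in> ball y0 r" for y
  proof -
    have y: "y \<in> \<Omega>" "y \<in> cball y0 r" using that r(2) by auto
    define d where "d = chr y u w - z"
    have "G y d e = koszul y u w e - G y z e" for e
      using linear_diff[OF G_linear[OF y(1)], of e "chr y u w" z]
      by (simp add: d_def G_sym[OF y(1), of _ e] flip: G_chr[OF y(1)])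
    then have "\<bar>G y d b\<bar> = \<bar>koszul y u w b - G y z b\<bar>" for b by simp
    then have \<epsilon>: "\<epsilon> y = (\<Sum>b\<in>Basis. \<bar>G y d b\<bar>)" by (simp add: \<epsilon>_def)
    have "\<mu> * (norm d)\<^sup>2 \<le> G y d d" by (rule \<mu>(2)[OF y(2)])
    also have "G y d d = G y d (\<Sum>b\<in>Basis. inner d b *\<^sub>R b)" by (simp add: euclidean_representation)
    also have "\<dots> = (\<Sum>b\<in>Basis. inner d b * G y d b)"
      by (simp add: linear_sum[OF G_linear[OF y(1)]] linear_scale[OF G_linear[OF y(1)]])
    also have "\<dots> \<le> (\<Sum>b\<in>Basis. norm d * \<bar>G y d b\<bar>)"
    proof (rule sum_mono)
      fix b :: 'e assume "b \<in> Basis"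
      then have "\<bar>inner d b\<bar> * \<bar>G y d b\<bar> \<le> norm d * \<bar>G y d b\<bar>" by (intro mult_right_mono Basis_le_norm) auto
      then show "inner d b * G y d b \<le> norm d * \<bar>G y d b\<bar>" by (metis abs_ge_self abs_mult order_trans)
    qed
    also have "\<dots> = norm d * \<epsilon> y" by (simp add: \<epsilon> sum_distrib_left)
    finally have "norm d * (\<mu> * norm d) \<le> norm d * \<epsilon> y" by (simp add: power2_eq_square mult.left_commute)
    moreover have "0 \<le> \<epsilon> y" by (simp add: \<epsilon>_def sum_nonneg)
    ultimately have "\<mu> * norm d \<le> \<epsilon> y" using mult_le_cancel_left_pos[of "norm d"] by (cases "d = 0") auto
    then show ?thesis using \<mu>(1) by (simp add: d_def field_simps)
  qed
  then have "eventually (\<lambda>y. norm (chr y u w - z) \<le> \<epsilon> y / \<mu>) (at y0)"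
    using r(1) by (intro eventually_at_in_open'[THEN eventually_mono, of "ball y0 r"]) auto
  from Lim_null_comparison[OF this lim]
  show "isCont (\<lambda>y. chr y u w) y0" by (simp add: isCont_def LIM_zero_iff z_def)
qed

section \<open>Parallel tensors and parallel transport along short segments\<close>

definition parallel :: "nat \<Rightarrow> ('e \<Rightarrow> 'e list \<Rightarrow> real) \<Rightarrow> bool" where
  "parallel p F \<longleftrightarrow> (\<forall>y\<in>\<Omega>. multilin p UNIV (F y)) \<and>
     (\<forall>y\<in>\<Omega>. \<forall>es. length es = p \<longrightarrow> (\<lambda>t. F t es) differentiable (at y)) \<and>
     (\<forall>y\<in>\<Omega>. \<forall>u es. length es = p \<longrightarrow>
        frechet_derivative (\<lambda>t. F t es) (at y) u = (\<Sum>a<p. F y (es[a := chr y u (es ! a)])))"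

text \<open>Metric compatibility in the form in which a single transport preserves the metric
  together with a parallel form.\<close>

lemma parallel_metric: "parallel 2 (\<lambda>y vs. G y (vs ! 0) (vs ! 1))"
  unfolding parallel_def
proof (intro conjI ballI allI impI)
  fix y assume y: "y \<in> \<Omega>"
  show "multilin 2 UNIV (\<lambda>vs. G y (vs ! 0) (vs ! 1))"
    by (rule inner_product_on_multilin[OF subspace_UNIV G_inner[OF y]])
  fix es :: "'e list"
  show "(\<lambda>t. G t (es ! 0) (es ! 1)) differentiable (at y)"
    using DG_has_derivative[OF y] by (rule differentiableI)
  fix u assume "length es = 2"
  then show "frechet_derivative (\<lambda>t. G t (es ! 0) (es ! 1)) (at y) u
      = (\<Sum>a<2. G y (es[a := chr y u (es ! a)] ! 0) (es[a := chr y u (es ! a)] ! 1))"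
    using metric_compatible[OF y, of u "es ! 0" "es ! 1"] by (simp add: numeral_2_eq_2 DG_def)
qed

text \<open>The equation for \<open>X\<close> says that its values are parallel along the segment.
  In the product rule, the moving base point contributes a sum of Christoffel terms, by parallelism
  of \<open>F\<close>, and the moving arguments contribute the same sum with the opposite
  sign.\<close>

lemma parallel_constant:
  assumes F: "parallel p F" and y: "\<And>t. t \<in> {0..1} \<Longrightarrow> y0 + t *\<^sub>R u \<in> \<Omega>"
    and X: "\<And>t v. t \<in> {0..1} \<Longrightarrow> ((\<lambda>t. X t v) has_vector_derivative - chr (y0 + t *\<^sub>R u) u (X t v)) (at t within {0..1})"
    and es: "length es = p"
  shows "F (y0 + u) (map (X 1) es) = F y0 (map (X 0) es)"
proof -
  define m where "m a j t = inner (X t (es ! a)) j" for a j t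
  have cov: "frechet_derivative (\<lambda>t. F t vs) (at y) u = (\<Sum>a<p. F y (vs[a := chr y u (vs ! a)]))"
    if "y \<in> \<Omega>" "length vs = p" for y u vs
    using F that unfolding parallel_def by blast
  have D: "((\<lambda>t. F (y0 + t *\<^sub>R u) (map (X t) es)) has_real_derivative 0) (at t within {0..1})"
    if t: "t \<in> {0..1}" for t
  proof -
    have ml: "multilin p UNIV (F (y0 + t *\<^sub>R u))" if "t \<in> {0..1}" for t
      using F y[OF that] by (simp add: parallel_def)
    have nb: "at t within {0..1} \<noteq> bot" using t by (simp add: trivial_limit_within islimpt_Icc)
    have dF: "((\<lambda>s. F (y0 + s *\<^sub>R u) vs) has_real_derivative frechet_derivative (\<lambda>y. F y vs) (at (y0 + t *\<^sub>R u)) u) (at t within {0..1})"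
      if "vs \<in> tuples p UNIV" for vs
    proof -
      have "(\<lambda>y. F y vs) differentiable (at (y0 + t *\<^sub>R u))"
        using F y[OF t] that by (simp add: parallel_def tuples_def)
      then have f: "((\<lambda>y. F y vs) has_derivative frechet_derivative (\<lambda>y. F y vs) (at (y0 + t *\<^sub>R u))) (at (y0 + t *\<^sub>R u))"
        by (simp add: frechet_derivative_works)
      have "((\<lambda>s. y0 + s *\<^sub>R u) has_derivative (\<lambda>s. s *\<^sub>R u)) (at t within {0..1})"
        by (auto intro!: derivative_eq_intros)
      from has_derivative_compose[OF this f] show ?thesis
        unfolding has_field_derivative_def
        by (simp add: linear_scale[OF has_derivative_linear[OF f]] mult_commute_abs)
    qed
    have dm: "((\<lambda>t. m a j t) has_real_derivative inner (- chr (y0 + t *\<^sub>R u) u (X t (es ! a))) j) (at t within {0..1})" for a j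
      unfolding m_def has_real_derivative_iff_has_vector_derivative
      using bounded_linear.has_vector_derivative[OF bounded_linear_inner_left X[OF t]] by simp
    have "((\<lambda>t. F (y0 + t *\<^sub>R u) (map (X t) es)) has_real_derivative
       frechet_derivative (\<lambda>y. F y (map (X t) es)) (at (y0 + t *\<^sub>R u)) u
       + (\<Sum>a<p. F (y0 + t *\<^sub>R u) ((map (X t) es)[a := \<Sum>j\<in>Basis. inner (- chr (y0 + t *\<^sub>R u) u (X t (es ! a))) j *\<^sub>R j])))
       (at t within {0..1})"
      by (rule multilin_has_derivative[OF subspace_UNIV UNIV_I t nb ml dF dm])
         (use es in \<open>auto simp: tuples_def m_def euclidean_representation\<close>)
    also have "frechet_derivative (\<lambda>y. F y (map (X t) es)) (at (y0 + t *\<^sub>R u)) u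
       + (\<Sum>a<p. F (y0 + t *\<^sub>R u) ((map (X t) es)[a := \<Sum>j\<in>Basis. inner (- chr (y0 + t *\<^sub>R u) u (X t (es ! a))) j *\<^sub>R j])) = 0"
    proof -
      have "F (y0 + t *\<^sub>R u) ((map (X t) es)[a := - chr (y0 + t *\<^sub>R u) u (X t (es ! a))])
          = - F (y0 + t *\<^sub>R u) ((map (X t) es)[a := chr (y0 + t *\<^sub>R u) u (map (X t) es ! a)])" if "a < p" for a
        using multilin_scaleR[OF ml[OF t], of "map (X t) es" a "chr (y0 + t *\<^sub>R u) u (X t (es ! a))" "-1"] that es
        by (simp add: tuples_def)
      moreover have "frechet_derivative (\<lambda>y. F y (map (X t) es)) (at (y0 + t *\<^sub>R u)) u
          = (\<Sum>a<p. F (y0 + t *\<^sub>R u) ((map (X t) es)[a := chr (y0 + t *\<^sub>R u) u (map (X t) es ! a)]))"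
        by (rule cov[OF y[OF t]]) (simp add: es)
      ultimately show ?thesis by (simp add: euclidean_representation sum_negf)
    qed
    finally show ?thesis .
  qed
  obtain k where "\<And>t. t \<in> {0..1} \<Longrightarrow> F (y0 + t *\<^sub>R u) (map (X t) es) = k"
    using has_field_derivative_zero_constant[of "{0..1}", OF _ D] by auto
  from this[of 0] this[of 1] show ?thesis by simp
qed

text \<open>The order of quantifiers is the point: \<open>X\<close> depends on \<open>y\<close>
  alone and serves all parallel \<open>F\<close> simultaneously, so one solution yields an isometry
  that also respects \<open>\<phi>\<close>.\<close>

lemma parallel_transport:
  assumes y0: "y0 \<in> \<Omega>"
  obtains \<delta> where "\<delta> > 0" "ball y0 \<delta> \<subseteq> \<Omega>"
    "\<And>y. y \<in> ball y0 \<delta> \<Longrightarrow> \<exists>X. linear X \<and>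
        (\<forall>p F es. parallel p F \<longrightarrow> length es = p \<longrightarrow> F y (map X es) = F y0 es)"
proof -
  obtain r where r: "r > 0" "cball y0 r \<subseteq> \<Omega>" using \<Omega> y0 open_contains_cball by blast
  have "\<exists>B. \<forall>y\<in>cball y0 r. norm (chr y i j) \<le> B" for i j
    using compact_continuous_image[OF continuous_on_subset[OF chr_continuous r(2)] compact_cball]
    by (meson bounded_iff compact_imp_bounded imageI)
  then obtain B where B: "\<And>y i j. y \<in> cball y0 r \<Longrightarrow> norm (chr y i j) \<le> B i j" by metis
  define K where "K = 1 + (\<Sum>i\<in>Basis. \<Sum>j\<in>Basis. \<bar>B i j\<bar>)"
  have K: "K \<ge> 1" by (simp add: K_def sum_nonneg)
  have bound: "norm (chr y u w) \<le> K * norm u * norm w" if y: "y \<in> cball y0 r" for y u w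
  proof -
    have y\<Omega>: "y \<in> \<Omega>" using y r by blast
    have "norm (chr y u w) = norm (\<Sum>i\<in>Basis. \<Sum>j\<in>Basis. (inner u i * inner w j) *\<^sub>R chr y i j)"
      using bilinear_expand[of "chr y" u w, OF chr_linear(1)[OF y\<Omega>] chr_linear(2)[OF y\<Omega>]] by simp
    also have "\<dots> \<le> (\<Sum>i\<in>Basis. \<Sum>j\<in>Basis. norm ((inner u i * inner w j) *\<^sub>R chr y i j))"
      by (intro sum_norm_le norm_sum)
    also have "\<dots> \<le> (\<Sum>i\<in>Basis. \<Sum>j\<in>Basis. (norm u * norm w) * \<bar>B i j\<bar>)"
    proof (intro sum_mono)
      fix i j :: 'e assume "i \<in> Basis" "j \<in> Basis"
      then show "norm ((inner u i * inner w j) *\<^sub>R chr y i j) \<le> (norm u * norm w) * \<bar>B i j\<bar>"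
        using B[OF y, of i j] unfolding norm_scaleR abs_mult
        by (intro mult_mono) (auto intro: Basis_le_norm)
    qed
    also have "\<dots> = (norm u * norm w) * (K - 1)" by (simp add: K_def sum_distrib_left)
    also have "\<dots> \<le> (norm u * norm w) * K" by (intro mult_left_mono) auto
    finally show ?thesis by (simp add: mult_ac)
  qed
  \<comment> \<open>\<open>r\<close> keeps the segment where \<open>K\<close> bounds the Christoffel
    symbols, and length below \<open>1 / (2 * K)\<close> gives the transport equation a coefficient
    operator of norm at most 1/2, as \<open>linear_ode_exists\<close> demands.\<close>
  define \<delta> where "\<delta> = min r (1 / (2 * K))"
  show ?thesis
  proof (rule that)
    show "\<delta> > 0" using r K by (simp add: \<delta>_def)
    show "ball y0 \<delta> \<subseteq> \<Omega>" using r by (auto simp: \<delta>_def)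
    fix y assume y: "y \<in> ball y0 \<delta>"
    define u where "u = y - y0"
    have u: "norm u < r" "norm u < 1 / (2 * K)" using y by (auto simp: \<delta>_def u_def dist_norm norm_minus_commute)
    \<comment> \<open>\<open>linear_ode_exists\<close> takes a coefficient operator continuous and
      bounded on the whole line, so the path is frozen at its endpoints outside the unit
      interval.\<close>
    define cl where "cl t = max 0 (min 1 t)" for t :: real
    have cl: "cl t \<in> {0..1}" for t by (auto simp: cl_def)
    have path: "y0 + cl t *\<^sub>R u \<in> cball y0 r" for t
    proof -
      have "cl t * norm u \<le> 1 * norm u" using cl[of t] by (intro mult_right_mono) auto
      then show ?thesis using u cl[of t] by (simp add: dist_norm)
    qed
    then have path\<Omega>: "y0 + cl t *\<^sub>R u \<in> \<Omega>" for t using r by blast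
    define A where "A t = Blinfun (\<lambda>w. - chr (y0 + cl t *\<^sub>R u) u w)" for t
    have A: "blinfun_apply (A t) = (\<lambda>w. - chr (y0 + cl t *\<^sub>R u) u w)" for t
      unfolding A_def
      by (intro bounded_linear_Blinfun_apply bounded_linear_minus linear_linear[THEN iffD2] chr_linear(1) path\<Omega>)
    have cont_A: "continuous_on UNIV A"
    proof (rule continuous_on_blinfun_componentwise)
      fix i :: 'e
      have "continuous_on UNIV (\<lambda>t. y0 + cl t *\<^sub>R u)" unfolding cl_def by (intro continuous_intros)
      then have "continuous_on UNIV (\<lambda>t. chr (y0 + cl t *\<^sub>R u) u i)"
        by (rule continuous_on_compose2[OF chr_continuous]) (use path\<Omega> in auto)
      then show "continuous_on UNIV (\<lambda>t. blinfun_apply (A t) i)" unfolding A by (intro continuous_intros)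
    qed
    have norm_A: "norm (A t) \<le> 1/2" for t
    proof (rule norm_blinfun_bound)
      fix w
      have "norm (blinfun_apply (A t) w) \<le> (K * norm u) * norm w" using bound[OF path] by (simp add: A)
      also have "K * norm u \<le> 1/2" using u(2) K by (simp add: field_simps)
      then have "(K * norm u) * norm w \<le> 1/2 * norm w" by (rule mult_right_mono) simp
      finally show "norm (blinfun_apply (A t) w) \<le> 1/2 * norm w" .
    qed simp
    obtain X where X0: "X 0 = id_blinfun"
      and X: "\<And>t. t \<in> {0..1} \<Longrightarrow> (X has_vector_derivative (A t o\<^sub>L X t)) (at t within {0..1})"
      using linear_ode_exists[OF cont_A norm_A] by blast
    have dX: "((\<lambda>t. blinfun_apply (X t) v) has_vector_derivative - chr (y0 + t *\<^sub>R u) u (blinfun_apply (X t) v)) (at t within {0..1})"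
      if t: "t \<in> {0..1}" for t v
    proof -
      have "cl t = t" using t by (simp add: cl_def)
      then show ?thesis
        using bounded_linear.has_vector_derivative[OF blinfun.bounded_linear_left X[OF t], of v] by (simp add: A)
    qed
    have pt: "y0 + t *\<^sub>R u \<in> \<Omega>" if "t \<in> {0..1}" for t using path\<Omega>[of t] that by (simp add: cl_def)
    have "F y (map (blinfun_apply (X 1)) es) = F y0 es" if "parallel p F" "length es = p" for p F es
      using parallel_constant[OF that(1) pt dX that(2)] by (simp add: X0 u_def)
    then show "\<exists>X. linear X \<and> (\<forall>p F es. parallel p F \<longrightarrow> length es = p \<longrightarrow> F y (map X es) = F y0 es)"
      by (intro exI[of _ "blinfun_apply (X 1)"]) (auto intro: bounded_linear.linear blinfun.bounded_linear_right)
  qed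
qed

end

section \<open>Isometries, parallel transport and the bundle of forms\<close>

lemma linear_isometry_inj:
  assumes V: "subspace V" and ip: "inner_product_on V ip" and u: "linear_isometry V ip W ip' u"
  shows "inj_on u V"
proof (rule inj_onI)
  fix v w assume v: "v \<in> V" and w: "w \<in> V" and eq: "u v = u w"
  have d: "v - w \<in> V" by (rule subspace_diff[OF V v w])
  have "u v = u (v - w) + u w"
    using u d w unfolding linear_isometry_def linear_between_def by (metis diff_add_cancel)
  then have 0: "u (v - w) = 0" using eq by simp
  have "u (0 *\<^sub>R v) = 0 *\<^sub>R u v" using u v unfolding linear_isometry_def linear_between_def by blast
  then have "u 0 = 0" by simp
  then have "ip (v - w) (v - w) = ip (v - w) 0"
    using u d subspace_0[OF V] 0 unfolding linear_isometry_def by metis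
  also have "\<dots> = 0" using inner_product_on_sum_right[OF ip V d, of "{}"] by simp
  finally show "v = w" using inner_product_on_pos[OF ip d] by force
qed

lemma linear_isometry_inv:
  assumes V: "subspace V" and ip: "inner_product_on V ip" and u: "linear_isometry V ip W ip' u"
  shows "linear_isometry W ip' V ip (inv_into V u)"
proof -
  let ?w = "inv_into V u"
  have lin: "\<And>v w. v \<in> V \<Longrightarrow> w \<in> V \<Longrightarrow> u (v + w) = u v + u w" "\<And>r v. v \<in> V \<Longrightarrow> u (r *\<^sub>R v) = r *\<^sub>R u v"
    and img: "u ` V = W" and iso: "\<And>v w. v \<in> V \<Longrightarrow> w \<in> V \<Longrightarrow> ip' (u v) (u w) = ip v w"
    using u by (auto simp: linear_isometry_def linear_between_def)
  have inj: "inj_on u V" by (rule linear_isometry_inj[OF assms])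
  have w: "?w z \<in> V" "u (?w z) = z" if "z \<in> W" for z
    using that img by (auto intro: inv_into_into f_inv_into_f)
  have wu: "?w (u v) = v" if "v \<in> V" for v using that inj by (rule inv_into_f_f[rotated])
  show ?thesis
    unfolding linear_isometry_def linear_between_def
  proof (intro conjI ballI allI)
    show "?w ` W = V" using inj img by (metis inv_into_image_cancel subset_refl)
    then show "?w ` W \<subseteq> V" by simp
    fix z assume z: "z \<in> W"
    show "?w (r *\<^sub>R z) = r *\<^sub>R ?w z" for r
      using wu[OF subspace_mul[OF V w(1)[OF z], of r]] lin(2)[OF w(1)[OF z], of r] w(2)[OF z] by simp
    fix z' assume z': "z' \<in> W"
    show "?w (z + z') = ?w z + ?w z'"
      using wu[OF subspace_add[OF V w(1)[OF z] w(1)[OF z']]] lin(1)[OF w(1)[OF z] w(1)[OF z']] w(2)[OF z] w(2)[OF z'] by simp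
    show "ip (?w z) (?w z') = ip' z z'"
      using iso[OF w(1)[OF z] w(1)[OF z']] w(2)[OF z] w(2)[OF z'] by simp
  qed
qed

lemma linear_isometry_compose:
  assumes "linear_isometry V ip W ip' u" "linear_isometry W ip' Z ip'' v"
  shows "linear_isometry V ip Z ip'' (\<lambda>x. v (u x))"
proof -
  have "u x \<in> W" if "x \<in> V" for x using assms(1) that by (auto simp: linear_isometry_def linear_between_def)
  moreover have "(\<lambda>x. v (u x)) ` V = v ` u ` V" by auto
  ultimately show ?thesis using assms unfolding linear_isometry_def linear_between_def by auto
qed

lemma linear_isometry_map:
  "linear_isometry V ip W ip' u \<Longrightarrow> vs \<in> tuples p V \<Longrightarrow> map u vs \<in> tuples p W"
  by (auto simp: linear_isometry_def tuples_def)

lemma pullback_apply: "vs \<in> tuples p V \<Longrightarrow> pullback p V u \<alpha> vs = \<alpha> (map u vs)"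
  by (simp add: pullback_def)

lemma pullback_inv:
  assumes u: "linear_isometry V ip W ip' u" and \<alpha>: "\<alpha> \<in> alt_forms p W"
  shows "pullback p W (inv_into V u) (pullback p V u \<alpha>) = \<alpha>"
proof
  fix vs
  have img: "u ` V = W" using u by (simp add: linear_isometry_def)
  show "pullback p W (inv_into V u) (pullback p V u \<alpha>) vs = \<alpha> vs"
  proof (cases "vs \<in> tuples p W")
    case True
    then have "inv_into V u z \<in> V" "u (inv_into V u z) = z" if "z \<in> set vs" for z
      using img that by (auto simp: tuples_def intro: inv_into_into f_inv_into_f)
    then have "map u (map (inv_into V u) vs) = vs" "map (inv_into V u) vs \<in> tuples p V"
      using True by (auto simp: tuples_def intro!: map_idI)
    then show ?thesis using True by (simp add: pullback_def del: map_map)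
  next
    case False
    then show ?thesis using \<alpha> by (simp add: pullback_def alt_forms_def)
  qed
qed

lemma pullback_compose:
  assumes "linear_isometry V ip W ip' u"
  shows "pullback p V u (pullback p W v \<alpha>) = pullback p V (\<lambda>x. v (u x)) \<alpha>"
  using linear_isometry_map[OF assms] by (auto simp: pullback_def fun_eq_iff comp_def)

text \<open>Linearity: \<open>\<theta>\<close> acts on slot \<open>i\<close> in one summand, and in
  the others the two updates commute. Alternation: when two slots agree, only the summands acting on
  one of them survive, and these differ by a swap.\<close>

lemma act_alt_forms:
  assumes V: "subspace V" and \<theta>: "linear_between V V \<theta>" and \<alpha>: "\<alpha> \<in> alt_forms p V"
  shows "act p V \<theta> \<alpha> \<in> alt_forms p V"
proof -
  note ml = alt_forms_multilin[OF \<alpha>]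
  have \<theta>V: "\<theta> v \<in> V" if "v \<in> V" for v using \<theta> that by (auto simp: linear_between_def)
  have out: "act p V \<theta> \<alpha> vs = 0" if "vs \<notin> tuples p V" for vs using that by (simp add: act_def)
  have lin: "linear_between V UNIV (\<lambda>v. act p V \<theta> \<alpha> (vs[i := v]))"
    if vs: "vs \<in> tuples p V" and i: "i < p" for vs i
  proof -
    define L where "L a = vs[a := \<theta> (vs ! a)]" for a
    have L: "L a \<in> tuples p V" if "a < p" for a unfolding L_def by (intro tuples_update vs \<theta>V tuples_nth[OF vs that])
    have expand: "act p V \<theta> \<alpha> (vs[i := v]) = \<alpha> (vs[i := \<theta> v]) + (\<Sum>a\<in>{..<p} - {i}. \<alpha> ((L a)[i := v]))" if v: "v \<in> V" for v
    proof -
      have "act p V \<theta> \<alpha> (vs[i := v]) = (\<Sum>a<p. \<alpha> (vs[i := v, a := \<theta> (vs[i := v] ! a)]))"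
        using tuples_update[OF vs v] by (simp add: act_def)
      also have "\<dots> = \<alpha> (vs[i := \<theta> v]) + (\<Sum>a\<in>{..<p} - {i}. \<alpha> (vs[i := v, a := \<theta> (vs[i := v] ! a)]))"
        using i tuples_length[OF vs] by (subst sum.remove[of _ i]) auto
      also have "(\<Sum>a\<in>{..<p} - {i}. \<alpha> (vs[i := v, a := \<theta> (vs[i := v] ! a)])) = (\<Sum>a\<in>{..<p} - {i}. \<alpha> ((L a)[i := v]))"
      proof (rule sum.cong)
        fix a assume "a \<in> {..<p} - {i}"
        then show "\<alpha> (vs[i := v, a := \<theta> (vs[i := v] ! a)]) = \<alpha> ((L a)[i := v])"
          using list_update_swap[of i a vs v "\<theta> (vs ! a)"] by (auto simp: L_def)
      qed simp
      finally show ?thesis .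
    qed
    show ?thesis
      unfolding linear_between_def
    proof (intro conjI ballI allI subset_UNIV)
      fix v w assume vw: "v \<in> V" "w \<in> V"
      have "\<theta> (v + w) = \<theta> v + \<theta> w" using \<theta> vw by (simp add: linear_between_def)
      then show "act p V \<theta> \<alpha> (vs[i := v + w]) = act p V \<theta> \<alpha> (vs[i := v]) + act p V \<theta> \<alpha> (vs[i := w])"
        using multilin_add[OF ml vs i \<theta>V[OF vw(1)] \<theta>V[OF vw(2)]] multilin_add[OF ml L i vw]
        by (simp add: expand vw subspace_add[OF V] sum.distrib)
    next
      fix r v assume v: "v \<in> V"
      have "\<theta> (r *\<^sub>R v) = r *\<^sub>R \<theta> v" using \<theta> v by (simp add: linear_between_def)
      then show "act p V \<theta> \<alpha> (vs[i := r *\<^sub>R v]) = r *\<^sub>R act p V \<theta> \<alpha> (vs[i := v])"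
        using multilin_scaleR[OF ml vs i \<theta>V[OF v]] multilin_scaleR[OF ml L i v]
        by (simp add: expand v subspace_mul[OF V] distrib_left sum_distrib_left)
    qed
  qed
  have alt: "act p V \<theta> \<alpha> vs = 0"
    if vs: "vs \<in> tuples p V" and ij: "i < p" "j < p" "i \<noteq> j" and eq: "vs ! i = vs ! j" for vs i j
  proof -
    define x where "x = vs ! i"
    have xV: "x \<in> V" unfolding x_def by (rule tuples_nth[OF vs ij(1)])
    note len = tuples_length[OF vs]
    define t where "t a = \<alpha> (vs[a := \<theta> (vs ! a)])" for a
    have zero: "t a = 0" if "a < p" "a \<noteq> i" "a \<noteq> j" for a
    proof -
      have "vs[a := \<theta> (vs ! a)] \<in> tuples p V" by (intro tuples_update vs \<theta>V tuples_nth[OF vs that(1)])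
      moreover have "vs[a := \<theta> (vs ! a)] ! i = vs[a := \<theta> (vs ! a)] ! j" using that eq by simp
      ultimately show ?thesis using \<alpha> ij unfolding alt_forms_def t_def by blast
    qed
    define L where "L = vs[i := \<theta> x]"
    have L: "L \<in> tuples p V" unfolding L_def by (intro tuples_update vs \<theta>V xV)
    have "L[i := L ! j, j := L ! i] = vs[j := \<theta> (vs ! j)]"
      using ij len eq by (intro nth_equalityI) (auto simp: L_def x_def nth_list_update)
    then have swap: "t j = - t i" using alt_forms_swap[OF \<alpha> V L ij] by (simp add: t_def L_def x_def)
    have "act p V \<theta> \<alpha> vs = (\<Sum>a<p. t a)" using vs by (simp add: act_def t_def)
    also have "\<dots> = (\<Sum>a\<in>{i, j}. t a)" using ij zero by (intro sum.mono_neutral_right) auto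
    also have "\<dots> = 0" using ij swap by simp
    finally show ?thesis .
  qed
  show ?thesis unfolding alt_forms_def using out lin alt by blast
qed

lemma act_vanish:
  assumes \<alpha>: "\<alpha> \<in> alt_forms p V" and V: "subspace V" and \<theta>: "\<And>v. v \<in> V \<Longrightarrow> \<theta> v = 0"
  shows "act p V \<theta> \<alpha> vs = 0"
proof (cases "vs \<in> tuples p V")
  case True
  have "\<alpha> (vs[i := \<theta> (vs ! i)]) = 0" if "i < p" for i
    using multilin_scaleR[OF alt_forms_multilin[OF \<alpha>] True that subspace_0[OF V], of 0] \<theta>[OF tuples_nth[OF True that]] by simp
  then show ?thesis by (simp add: act_def)
qed (simp add: act_def)

locale riemannian = manifold M A
  for M :: "'m topology" and A :: "('m, 'e::euclidean_space) chart set" +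
  fixes g :: "('m, 'e) metric"
  assumes metric: "riemannian_metric M A g"
begin

lemma metric_inner: "x \<in> topspace M \<Longrightarrow> inner_product_on (tangent_space A x) (g x)"
  using metric by (simp add: riemannian_metric_def)

lemma chart_inv_charts_at: "c \<in> A \<Longrightarrow> y \<in> snd c ` fst c \<Longrightarrow> c \<in> charts_at A (chart_inv c y)"
  by (simp add: charts_at_def chart_inv_in)

lemma local_metric_inner:
  assumes c: "c \<in> A" and y: "y \<in> snd c ` fst c"
  shows "inner_product_on UNIV (local_metric A g c y)"
proof -
  let ?x = "chart_inv c y"
  note cx = chart_inv_charts_at[OF c y]
  have ip: "inner_product_on (tangent_space A ?x) (g ?x)"
    by (rule metric_inner[OF chart_topspace[OF c chart_inv_in[OF y]]])
  note lin = linear_coord_vec[OF cx] and mem = coord_vec_in[OF cx]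
  show ?thesis unfolding inner_product_on_def
  proof (intro conjI ballI impI)
    show "linear_between UNIV UNIV (local_metric A g c y v)" for v
      using inner_product_on_linear[OF ip mem[of v]] mem
      by (simp add: linear_between_def local_metric_def linear_add[OF lin] linear_scale[OF lin])
    show "local_metric A g c y v w = local_metric A g c y w v" for v w
      unfolding local_metric_def by (rule inner_product_on_sym[OF ip mem mem])
    fix v :: 'e assume "v \<noteq> 0"
    then have "coord_vec A c ?x v \<noteq> 0" using coord_vec_apply[OF cx, of v] by (auto simp: zero_fun_def)
    then show "0 < local_metric A g c y v v"
      unfolding local_metric_def by (rule inner_product_on_pos[OF ip mem])
  qed
qed

lemma local_metric_Ck: "c \<in> A \<Longrightarrow> Ck_on k (snd c ` fst c) (\<lambda>y. local_metric A g c y v w)"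
  using metric by (simp add: riemannian_metric_def smooth_on_def)

lemma metric_field_chart: "c \<in> A \<Longrightarrow> metric_field (snd c ` fst c) (local_metric A g c)"
  using chart[of c] by unfold_locales (auto simp: is_chart_def local_metric_inner intro!: local_metric_Ck simp del: Ck_on.simps)

lemma local_form_multilin:
  assumes c: "c \<in> A" "y \<in> snd c ` fst c" and \<omega>: "\<omega> (chart_inv c y) \<in> alt_forms p (tangent_space A (chart_inv c y))"
  shows "multilin p UNIV (local_form A \<omega> c y)"
  unfolding multilin_def
proof (intro ballI allI impI)
  fix vs :: "'e list" and i assume "vs \<in> tuples p UNIV" "i < p"
  note cx = chart_inv_charts_at[OF c]
  have "map (coord_vec A c (chart_inv c y)) vs \<in> tuples p (tangent_space A (chart_inv c y))"
    using \<open>vs \<in> _\<close> by (intro map_coord_vec_tuples[OF cx]) (simp add: tuples_def)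
  from multilin_add[OF alt_forms_multilin[OF \<omega>] this \<open>i < p\<close> coord_vec_in[OF cx] coord_vec_in[OF cx]]
    multilin_scaleR[OF alt_forms_multilin[OF \<omega>] this \<open>i < p\<close> coord_vec_in[OF cx]]
  show "linear_between UNIV UNIV (\<lambda>v. local_form A \<omega> c y (vs[i := v]))"
    by (simp add: linear_between_def local_form_def map_update linear_add[OF linear_coord_vec[OF cx]]
        linear_scale[OF linear_coord_vec[OF cx]])
qed

end

locale parallel_form_manifold = riemannian M A g
  for M :: "'m topology" and A :: "('m, 'e::euclidean_space) chart set" and g :: "('m, 'e) metric" +
  fixes p :: nat and \<phi> :: "('m, 'e) diff_form"
  assumes \<phi>_smooth: "smooth_form M A p \<phi>" and \<phi>_parallel: "parallel_form A g p \<phi>"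
begin

lemma \<phi>_alt: "x \<in> topspace M \<Longrightarrow> \<phi> x \<in> alt_forms p (tangent_space A x)"
  using \<phi>_smooth by (simp add: smooth_form_def)

lemma local_form_Ck: "c \<in> A \<Longrightarrow> length es = p \<Longrightarrow> Ck_on k (snd c ` fst c) (\<lambda>y. local_form A \<phi> c y es)"
  using \<phi>_smooth by (simp add: smooth_form_def smooth_on_def)

lemma local_form_parallel:
  assumes c: "c \<in> A"
  shows "metric_field.parallel (snd c ` fst c) (local_metric A g c) p (local_form A \<phi> c)"
proof -
  interpret metric_field "snd c ` fst c" "local_metric A g c" by (rule metric_field_chart[OF c])
  have chr_eq: "christoffel A g c y u w = chr y u w" for y u w by (simp add: christoffel_def chr_def)
  show ?thesis unfolding parallel_def
  proof (intro conjI ballI allI impI)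
    fix y assume y: "y \<in> snd c ` fst c"
    show "multilin p UNIV (local_form A \<phi> c y)"
      by (rule local_form_multilin[where \<omega> = \<phi>, OF c y]) (rule \<phi>_alt[OF chart_topspace[OF c chart_inv_in[OF y]]])
    fix es :: "'e list" assume es: "length es = p"
    show "(\<lambda>t. local_form A \<phi> c t es) differentiable (at y)"
      using Ck_on_has_derivative[OF local_form_Ck[OF c es] y] by (rule differentiableI)
    fix u
    have "local_cov_deriv A g p \<phi> c y u es = 0"
      using \<phi>_parallel c y es unfolding parallel_form_def by blast
    then show "frechet_derivative (\<lambda>t. local_form A \<phi> c t es) (at y) u
        = (\<Sum>a<p. local_form A \<phi> c y (es[a := chr y u (es ! a)]))"
      by (simp add: local_cov_deriv_def chr_eq)
  qed
qed

text \<open>Says that the union defining \<open>Phi_M A g p \<phi> y x\<close> ranges over a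
  nonempty set. As a relation between points it hides the path, so holonomy never enters.\<close>

definition transportable :: "'m \<Rightarrow> 'm \<Rightarrow> bool" where
  "transportable x y \<longleftrightarrow> (\<exists>u. linear_isometry (tangent_space A x) (g x) (tangent_space A y) (g y) u \<and>
     pullback p (tangent_space A x) u (\<phi> y) = \<phi> x)"

lemma transportable_sym:
  assumes "x \<in> topspace M" "y \<in> topspace M" "transportable x y"
  shows "transportable y x"
proof -
  obtain u where u: "linear_isometry (tangent_space A x) (g x) (tangent_space A y) (g y) u"
    "pullback p (tangent_space A x) u (\<phi> y) = \<phi> x"
    using assms(3) unfolding transportable_def by blast
  show ?thesis unfolding transportable_def
    using linear_isometry_inv[OF subspace_tangent_space metric_inner[OF assms(1)] u(1)]
      pullback_inv[OF u(1) \<phi>_alt[OF assms(2)]] unfolding u(2) by blast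
qed

lemma transportable_trans:
  assumes "transportable x y" "transportable y z"
  shows "transportable x z"
proof -
  obtain u where u: "linear_isometry (tangent_space A x) (g x) (tangent_space A y) (g y) u"
    "pullback p (tangent_space A x) u (\<phi> y) = \<phi> x"
    using assms(1) unfolding transportable_def by blast
  obtain v where v: "linear_isometry (tangent_space A y) (g y) (tangent_space A z) (g z) v"
    "pullback p (tangent_space A y) v (\<phi> z) = \<phi> y"
    using assms(2) unfolding transportable_def by blast
  show ?thesis unfolding transportable_def
    using linear_isometry_compose[OF u(1) v(1)] pullback_compose[OF u(1), of p v "\<phi> z"] unfolding u(2) v(2)
    by (intro exI[of _ "\<lambda>x. v (u x)"]) simp
qed

lemma transportable_locally:
  assumes x: "x \<in> topspace M"
  shows "\<exists>U. openin M U \<and> x \<in> U \<and> (\<forall>m\<in>U. transportable x m)"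
proof -
  obtain c where c: "c \<in> A" "x \<in> fst c" using ex_chart[OF x] by blast
  interpret metric_field "snd c ` fst c" "local_metric A g c" by (rule metric_field_chart[OF c(1)])
  have cx: "c \<in> charts_at A x" using c by (simp add: charts_at_def)
  have y0: "snd c x \<in> snd c ` fst c" using c by blast
  obtain \<delta> where \<delta>: "\<delta> > 0" "ball (snd c x) \<delta> \<subseteq> snd c ` fst c"
    and ex: "\<And>y. y \<in> ball (snd c x) \<delta> \<Longrightarrow> \<exists>X. linear X \<and>
        (\<forall>p F es. parallel p F \<longrightarrow> length es = p \<longrightarrow> F y (map X es) = F (snd c x) es)"
    using parallel_transport[OF y0] by blast
  define U where "U = {m \<in> fst c. snd c m \<in> ball (snd c x) \<delta>}"
  have "openin M U"
  proof -
    have "continuous_map (subtopology M (fst c)) (top_of_set (snd c ` fst c)) (snd c)"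
      using chart[OF c(1)] homeomorphic_imp_continuous_map by (auto simp: is_chart_def)
    then have op: "openin (subtopology M (fst c)) {m \<in> topspace (subtopology M (fst c)). snd c m \<in> ball (snd c x) \<delta>}"
      by (rule openin_continuous_map_preimage) (use \<delta>(2) in \<open>auto intro: open_subset\<close>)
    have "topspace (subtopology M (fst c)) = fst c"
      using chart_topspace[OF c(1)] by auto
    then have "openin (subtopology M (fst c)) U" using op unfolding U_def by (simp only:)
    then show ?thesis using chart_open[OF c(1)] by (rule openin_trans_full)
  qed
  moreover have "x \<in> U" using c(2) \<delta>(1) by (simp add: U_def)
  moreover have "transportable x m" if m: "m \<in> U" for m
  proof -
    have mc: "m \<in> fst c" "snd c m \<in> ball (snd c x) \<delta>" using m by (auto simp: U_def)
    have cm: "c \<in> charts_at A m" using c mc by (simp add: charts_at_def)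
    have inv: "chart_inv c (snd c m) = m" "chart_inv c (snd c x) = x"
      using mc c by (simp_all add: chart_inv_chart[OF chart])
    obtain X where X: "linear X"
      and par: "\<And>p F es. parallel p F \<Longrightarrow> length es = p \<Longrightarrow> F (snd c m) (map X es) = F (snd c x) es"
      using ex[OF mc(2)] by blast
    \<comment> \<open>The metric is the parallel tensor with \<open>p = 2\<close>, so the map
      \<open>X\<close> that will preserve \<open>\<phi>\<close> is isometric as well.\<close>
    have iso: "local_metric A g c (snd c m) (X v) (X w) = local_metric A g c (snd c x) v w" for v w
      using par[OF parallel_metric, of "[v, w]"] by simp
    define u where "u v = coord_vec A c m (X (v c))" for v
    have ym: "snd c m \<in> snd c ` fst c" using mc by blast
    \<comment> \<open>Preservation of a definite metric makes \<open>X\<close> injective, hence onto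
      by dimension; \<open>linear_isometry\<close> asks for the full image.\<close>
    have "v = 0" if "X v = 0" for v
    proof (rule ccontr)
      assume "v \<noteq> 0"
      then have "0 < local_metric A g c (snd c x) v v" using inner_product_on_pos[OF G_inner[OF y0]] by simp
      also have "\<dots> = local_metric A g c (snd c m) 0 0" using iso[of v v] that by simp
      also have "\<dots> = 0" by (rule linear_0[OF G_linear[OF ym]])
      finally show False by simp
    qed
    then have "inj X" using X by (simp add: linear_injective_0)
    with X have surj: "surj X" by (rule linear_injective_imp_surjective) simp
    have "linear_isometry (tangent_space A x) (g x) (tangent_space A m) (g m) u"
      unfolding linear_isometry_def linear_between_def
    proof (intro conjI ballI allI)
      show "u ` tangent_space A x \<subseteq> tangent_space A m" by (auto simp: u_def coord_vec_in[OF cm])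
      moreover have "tangent_space A m \<subseteq> u ` tangent_space A x"
      proof
        fix w assume w: "w \<in> tangent_space A m"
        obtain e where e: "X e = w c" using surj by (metis surjD)
        have "u (coord_vec A c x e) = w" by (simp add: u_def coord_vec_apply[OF cx] e coord_vec_tangent[OF cm w])
        then show "w \<in> u ` tangent_space A x" using coord_vec_in[OF cx] by blast
      qed
      ultimately show "u ` tangent_space A x = tangent_space A m" by blast
      show "u (v + w) = u v + u w" for v w
        by (simp add: u_def plus_fun_def[of v w] linear_add[OF X] linear_add[OF linear_coord_vec[OF cm]])
      show "u (r *\<^sub>R v) = r *\<^sub>R u v" for r v
        by (simp add: u_def scaleR_fun_def[of r v] linear_scale[OF X] linear_scale[OF linear_coord_vec[OF cm]])
      fix v w assume "v \<in> tangent_space A x" "w \<in> tangent_space A x"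
      then show "g m (u v) (u w) = g x v w"
        using iso[of "v c" "w c"] by (simp add: local_metric_def inv u_def coord_vec_tangent[OF cx])
    qed
    moreover have "pullback p (tangent_space A x) u (\<phi> m) = \<phi> x"
    proof
      fix vs
      show "pullback p (tangent_space A x) u (\<phi> m) vs = \<phi> x vs"
      proof (cases "vs \<in> tuples p (tangent_space A x)")
        case True
        have "\<phi> m (map u vs) = local_form A \<phi> c (snd c m) (map X (map (\<lambda>v. v c) vs))"
          by (simp add: local_form_def inv u_def[abs_def] comp_def)
        also have "\<dots> = local_form A \<phi> c (snd c x) (map (\<lambda>v. v c) vs)"
          by (rule par[OF local_form_parallel[OF c(1)]]) (simp add: tuples_length[OF True])
        also have "\<dots> = \<phi> x vs"
          using tangent_tuples_coord[OF cx True] by (simp add: local_form_def inv)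
        finally show ?thesis using True by (simp add: pullback_def)
      next
        case False
        then show ?thesis using \<phi>_alt[OF x] by (simp add: pullback_def alt_forms_def)
      qed
    qed
    ultimately show ?thesis unfolding transportable_def by blast
  qed
  ultimately show ?thesis by blast
qed

text \<open>By \<open>transportable_locally\<close>, membership in the class of \<open>x0\<close> is
  locally constant, so the class is open and closed.\<close>

lemma transportable_connected:
  assumes "connected_space M" and x0: "x0 \<in> topspace M" and x: "x \<in> topspace M"
  shows "transportable x x0"
proof -
  define S where "S = {x \<in> topspace M. transportable x0 x}"
  have nbhd: "\<exists>U. openin M U \<and> x \<in> U \<and> (\<forall>m\<in>U. m \<in> S \<longleftrightarrow> x \<in> S)" if x: "x \<in> topspace M" for x
  proof -
    obtain U where U: "openin M U" "x \<in> U" "\<And>m. m \<in> U \<Longrightarrow> transportable x m"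
      using transportable_locally[OF x] by blast
    have "m \<in> S \<longleftrightarrow> x \<in> S" if "m \<in> U" for m
    proof -
      have m: "m \<in> topspace M" using openin_subset[OF U(1)] that by blast
      note xm = U(3)[OF that]
      have "transportable x0 m \<longleftrightarrow> transportable x0 x"
        using transportable_trans[OF _ xm] transportable_trans[OF _ transportable_sym[OF x m xm]] by blast
      then show ?thesis using m x by (simp add: S_def)
    qed
    then show ?thesis using U by blast
  qed
  have "openin M S"
  proof (subst openin_subopen, rule ballI)
    fix x assume x: "x \<in> S"
    then obtain U where U: "openin M U" "x \<in> U" "\<forall>m\<in>U. m \<in> S \<longleftrightarrow> x \<in> S"
      using nbhd[of x] unfolding S_def by blast
    then show "\<exists>T. openin M T \<and> x \<in> T \<and> T \<subseteq> S" using x by blast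
  qed
  moreover have "openin M (topspace M - S)"
  proof (subst openin_subopen, rule ballI)
    fix x assume x: "x \<in> topspace M - S"
    then obtain U where U: "openin M U" "x \<in> U" "\<forall>m\<in>U. m \<in> S \<longleftrightarrow> x \<in> S" using nbhd[of x] by blast
    then have "U \<subseteq> topspace M - S" using x openin_subset[OF U(1)] by blast
    then show "\<exists>T. openin M T \<and> x \<in> T \<and> T \<subseteq> topspace M - S" using U by blast
  qed
  then have "closedin M S" by (simp add: closedin_def S_def)
  \<comment> \<open>Reflexivity is a special case of the local statement, as \<open>x0\<close> lies
    in its own neighbourhood.\<close>
  moreover have "x0 \<in> S"
    using transportable_locally[OF x0] x0 unfolding S_def by blast
  ultimately have "S = topspace M"
    using assms(1) unfolding connected_space_clopen_in by blast
  then show ?thesis using transportable_sym[OF x0 x] x unfolding S_def by blast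
qed

text \<open>The fibre is defined through the base point, so \<open>\<theta>\<close> is conjugated by
  \<open>u\<close> to \<open>\<theta>0\<close> there; pulling back undoes the conjugation because
  \<open>u\<close> pulls \<open>\<phi> x0\<close> back to \<open>\<phi> x\<close>.\<close>

lemma act_in_Phi_M:
  assumes t: "transportable x x0" and x: "x \<in> topspace M" and \<theta>: "\<theta> \<in> skew_endos (tangent_space A x) (g x)"
  shows "act p (tangent_space A x) \<theta> (\<phi> x) \<in> Phi_M A g p \<phi> x0 x"
proof -
  let ?V = "tangent_space A x" and ?W = "tangent_space A x0"
  obtain u where u: "linear_isometry ?V (g x) ?W (g x0) u" and pb: "pullback p ?V u (\<phi> x0) = \<phi> x"
    using t by (auto simp: transportable_def)
  define w where "w = inv_into ?V u"
  note inv = linear_isometry_inv[OF subspace_tangent_space metric_inner[OF x] u, folded w_def]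
  have wu: "w (u v) = v" if "v \<in> ?V" for v
    unfolding w_def by (rule inv_into_f_f[OF linear_isometry_inj[OF subspace_tangent_space metric_inner[OF x] u] that])
  have uw: "u (w z) = z" if "z \<in> ?W" for z
  proof -
    have "z \<in> u ` ?V" using u that by (simp add: linear_isometry_def)
    then show ?thesis unfolding w_def by (rule f_inv_into_f)
  qed
  have uV: "u v \<in> ?W" if "v \<in> ?V" for v using u that by (auto simp: linear_isometry_def)
  have wW: "w z \<in> ?V" if "z \<in> ?W" for z using inv that by (auto simp: linear_isometry_def)
  have \<theta>V: "\<theta> v \<in> ?V" if "v \<in> ?V" for v using \<theta> that by (auto simp: skew_endos_def linear_between_def)
  define \<theta>0 where "\<theta>0 z = u (\<theta> (w z))" for z
  have lin: "linear_between ?W ?W \<theta>0"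
    using u inv \<theta> uV wW \<theta>V unfolding \<theta>0_def linear_between_def linear_isometry_def skew_endos_def
    by (auto simp: image_subset_iff)
  have "g x0 (\<theta>0 z) z' = - g x0 z (\<theta>0 z')" if z: "z \<in> ?W" "z' \<in> ?W" for z z'
  proof -
    have iso: "g x0 (u a) (u b) = g x a b" if "a \<in> ?V" "b \<in> ?V" for a b
      using u that by (simp add: linear_isometry_def)
    have "g x (\<theta> (w z)) (w z') = - g x (w z) (\<theta> (w z'))"
      using \<theta> wW[OF z(1)] wW[OF z(2)] by (simp add: skew_endos_def)
    then show ?thesis
      using iso[OF \<theta>V[OF wW[OF z(1)]] wW[OF z(2)]] iso[OF wW[OF z(1)] \<theta>V[OF wW[OF z(2)]]]
      by (simp add: \<theta>0_def uw z)
  qed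
  then have "\<theta>0 \<in> skew_endos ?W (g x0)" using lin by (simp add: skew_endos_def)
  then have Phi: "act p ?W \<theta>0 (\<phi> x0) \<in> Phi p ?W (g x0) (\<phi> x0)" unfolding Phi_def by blast
  have eq: "pullback p ?V u (act p ?W \<theta>0 (\<phi> x0)) = act p ?V \<theta> (\<phi> x)"
  proof
    fix vs
    show "pullback p ?V u (act p ?W \<theta>0 (\<phi> x0)) vs = act p ?V \<theta> (\<phi> x) vs"
    proof (cases "vs \<in> tuples p ?V")
      case True
      have "\<phi> x0 ((map u vs)[a := \<theta>0 (map u vs ! a)]) = \<phi> x (vs[a := \<theta> (vs ! a)])" if a: "a < p" for a
      proof -
        have va: "vs ! a \<in> ?V" by (rule tuples_nth[OF True a])
        have "(map u vs)[a := \<theta>0 (map u vs ! a)] = map u (vs[a := \<theta> (vs ! a)])"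
          using a tuples_length[OF True] by (simp add: \<theta>0_def wu[OF va] map_update)
        then show ?thesis
          using pullback_apply[OF tuples_update[OF True \<theta>V[OF va]], of u "\<phi> x0" a] by (simp add: pb)
      qed
      then show ?thesis using True linear_isometry_map[OF u True] by (simp add: pullback_def act_def)
    qed (simp add: pullback_def act_def)
  qed
  show ?thesis unfolding Phi_M_def
  proof (rule UN_I[where a = u])
    show "u \<in> {u. linear_isometry ?V (g x) ?W (g x0) u \<and> pullback p ?V u (\<phi> x0) = \<phi> x}" using u pb by simp
    show "act p ?V \<theta> (\<phi> x) \<in> pullback p ?V u ` Phi p ?W (g x0) (\<phi> x0)" using imageI[OF Phi, of "pullback p ?V u"] by (simp add: eq)
  qed
qed

text \<open>The isometry \<open>u\<close> comes with the element of \<open>Phi_M\<close>. As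
  \<open>u\<close> is onto, \<open>\<theta>\<close> sends \<open>u (es ! a)\<close> to some
  \<open>u w\<close>, and skewness makes \<open>w\<close> orthogonal to \<open>es ! a\<close>, which
  is the situation of \<open>alt_form_vanish_of_orthogonal\<close>.\<close>

lemma Phi_M_vanish:
  assumes x: "x \<in> topspace M" "x0 \<in> topspace M" and \<psi>: "\<psi> \<in> Phi_M A g p \<phi> x0 x"
    and es: "es \<in> tuples p (tangent_space A x)" and on: "orthonormal (g x) es"
    and crit: "\<And>a w. a < p \<Longrightarrow> w \<in> tangent_space A x \<Longrightarrow> (\<And>i. i < p \<Longrightarrow> g x (es ! i) w = 0) \<Longrightarrow> \<phi> x (es[a := w]) = 0"
  shows "\<psi> es = 0"
proof -
  let ?V = "tangent_space A x" and ?W = "tangent_space A x0"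
  obtain u \<theta> where u: "linear_isometry ?V (g x) ?W (g x0) u" and pb: "pullback p ?V u (\<phi> x0) = \<phi> x"
    and \<theta>: "\<theta> \<in> skew_endos ?W (g x0)" and \<psi>_eq: "\<psi> = pullback p ?V u (act p ?W \<theta> (\<phi> x0))"
    using \<psi> by (auto simp: Phi_M_def Phi_def)
  have uV: "u v \<in> ?W" if "v \<in> ?V" for v using u that by (auto simp: linear_isometry_def)
  have \<theta>W: "\<theta> z \<in> ?W" if "z \<in> ?W" for z using \<theta> that by (auto simp: skew_endos_def linear_between_def)
  have "\<phi> x0 ((map u es)[a := \<theta> (map u es ! a)]) = 0" if a: "a < p" for a
  proof -
    have ea: "es ! a \<in> ?V" by (rule tuples_nth[OF es a])
    obtain w where w: "w \<in> ?V" "u w = \<theta> (u (es ! a))"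
      using u \<theta>W[OF uV[OF ea]] unfolding linear_isometry_def by (metis imageE)
    have "g x0 (\<theta> (u (es ! a))) (u (es ! a)) = - g x0 (u (es ! a)) (\<theta> (u (es ! a)))"
      using \<theta> uV[OF ea] by (simp add: skew_endos_def)
    then have "g x0 (u (es ! a)) (\<theta> (u (es ! a))) = 0"
      using inner_product_on_sym[OF metric_inner[OF x(2)] \<theta>W[OF uV[OF ea]] uV[OF ea]] by simp
    then have "g x (es ! a) w = 0"
      using u ea w unfolding linear_isometry_def by metis
    have "\<phi> x (es[a := w]) = 0"
    proof (rule alt_form_vanish_of_orthogonal[OF subspace_tangent_space metric_inner[OF x(1)] es on \<phi>_alt[OF x(1)] _ a w(1)])
      show "\<phi> x (es[a := w']) = 0" if "w' \<in> ?V" "\<And>i. i < p \<Longrightarrow> g x (es ! i) w' = 0" for w'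
        using that by (rule crit[OF a])
    qed fact
    moreover have "(map u es)[a := \<theta> (map u es ! a)] = map u (es[a := w])"
      using a tuples_length[OF es] w by (simp add: map_update)
    ultimately show ?thesis
      using pullback_apply[OF tuples_update[OF es w(1)], of u "\<phi> x0" a] by (simp add: pb)
  qed
  then show ?thesis using es linear_isometry_map[OF u es] by (simp add: \<psi>_eq pullback_def act_def)
qed

end

section \<open>Sections through a given point\<close>

text \<open>For orthonormal \<open>a\<close> and \<open>b\<close> this generates the rotation from
  \<open>a\<close> towards \<open>b\<close>: it sends \<open>a\<close> to \<open>b\<close> and
  \<open>b\<close> to \<open>- a\<close>. The formula is skew for arbitrary \<open>a\<close> and
  \<open>b\<close>, which matters because vector fields with constant coordinates in a chart need
  not stay orthonormal.\<close>

definition rot :: "('v::real_vector \<Rightarrow> 'v \<Rightarrow> real) \<Rightarrow> 'v \<Rightarrow> 'v \<Rightarrow> 'v \<Rightarrow> 'v" where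
  "rot ip a b v = ip a v *\<^sub>R b - ip b v *\<^sub>R a"

lemma rot_skew:
  assumes V: "subspace V" and ip: "inner_product_on V ip" and ab: "a \<in> V" "b \<in> V"
  shows "(\<lambda>v. s *\<^sub>R rot ip a b v) \<in> skew_endos V ip"
proof -
  have lin: "ip v (w + w') = ip v w + ip v w'" "ip v (r *\<^sub>R w) = r * ip v w" if "v \<in> V" "w \<in> V" "w' \<in> V" for v w w' r
    using inner_product_on_linear[OF ip that(1)] that by (auto simp: linear_between_def)
  have rotV: "s *\<^sub>R rot ip a b v \<in> V" for v
    unfolding rot_def by (intro subspace_mul[OF V] subspace_diff[OF V] ab)
  have val: "ip v (s *\<^sub>R rot ip a b w) = s * (ip a w * ip v b - ip b w * ip v a)" if v: "v \<in> V" for v w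
  proof -
    have "s *\<^sub>R rot ip a b w = (s * ip a w) *\<^sub>R b + (- s * ip b w) *\<^sub>R a"
      by (simp add: rot_def algebra_simps)
    then have "ip v (s *\<^sub>R rot ip a b w) = ip v ((s * ip a w) *\<^sub>R b + (- s * ip b w) *\<^sub>R a)"
      by (rule arg_cong)
    also have "\<dots> = (s * ip a w) * ip v b + (- s * ip b w) * ip v a"
      unfolding lin(1)[OF v subspace_mul[OF V ab(2)] subspace_mul[OF V ab(1)]]
        lin(2)[OF v ab(2) ab(2)] lin(2)[OF v ab(1) ab(1)] ..
    finally show ?thesis by (simp add: algebra_simps)
  qed
  show ?thesis unfolding skew_endos_def
  proof (intro CollectI conjI ballI)
    show "linear_between V V (\<lambda>v. s *\<^sub>R rot ip a b v)"
      unfolding linear_between_def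
    proof (intro conjI ballI allI)
      fix v w assume "v \<in> V" "w \<in> V"
      then show "s *\<^sub>R rot ip a b (v + w) = s *\<^sub>R rot ip a b v + s *\<^sub>R rot ip a b w"
        using lin(1)[OF ab(1)] lin(1)[OF ab(2)] by (simp add: rot_def algebra_simps)
    next
      fix r v assume v: "v \<in> V"
      show "s *\<^sub>R rot ip a b (r *\<^sub>R v) = r *\<^sub>R s *\<^sub>R rot ip a b v"
        using lin(2)[OF ab(1) v v, of r] lin(2)[OF ab(2) v v, of r] by (simp add: rot_def algebra_simps)
    qed (use rotV in blast)
    fix v w assume v: "v \<in> V" and w: "w \<in> V"
    have "ip (s *\<^sub>R rot ip a b v) w = ip w (s *\<^sub>R rot ip a b v)"
      by (rule inner_product_on_sym[OF ip rotV w])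
    then show "ip (s *\<^sub>R rot ip a b v) w = - ip v (s *\<^sub>R rot ip a b w)"
      using inner_product_on_sym[OF ip v ab(1)] inner_product_on_sym[OF ip v ab(2)]
        inner_product_on_sym[OF ip w ab(1)] inner_product_on_sym[OF ip w ab(2)]
      by (simp add: val[OF v] val[OF w] algebra_simps)
  qed
qed

lemma zero_skew:
  assumes V: "subspace V" and ip: "inner_product_on V ip"
  shows "(\<lambda>v. 0) \<in> skew_endos V ip"
  using rot_skew[OF V ip subspace_0[OF V] subspace_0[OF V], of 0] by simp

context manifold
begin

text \<open>In a Hausdorff space the compact preimage of the ball is closed. Its complement is
  therefore open, so that a field cut off inside the chart extends smoothly by zero.\<close>

lemma chart_cball_closed:
  assumes c: "c \<in> A" and sub: "cball z r \<subseteq> snd c ` fst c"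
  shows "closedin M {m \<in> fst c. snd c m \<in> cball z r}"
proof -
  have "homeomorphic_map (subtopology M (fst c)) (top_of_set (snd c ` fst c)) (snd c)"
    using chart[OF c] by (simp add: is_chart_def)
  then obtain h where h: "homeomorphic_maps (subtopology M (fst c)) (top_of_set (snd c ` fst c)) (snd c) h"
    using homeomorphic_map_maps by blast
  have top: "topspace (subtopology M (fst c)) = fst c" using chart_topspace[OF c] by auto
  have inv: "h (snd c m) = m" if "m \<in> fst c" for m using h that top unfolding homeomorphic_maps_def by blast
  have "compactin (top_of_set (snd c ` fst c)) (cball z r)" using sub by (simp add: compactin_subtopology)
  moreover have "continuous_map (top_of_set (snd c ` fst c)) (subtopology M (fst c)) h"
    using h unfolding homeomorphic_maps_def by blast
  ultimately have "compactin (subtopology M (fst c)) (h ` cball z r)" by (rule image_compactin)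
  then have "compactin M (h ` cball z r)" by (simp add: compactin_subtopology)
  moreover have "Hausdorff_space M" using smooth unfolding smooth_manifold_def by blast
  ultimately have "closedin M (h ` cball z r)" by (metis compactin_imp_closedin)
  moreover have "h ` cball z r = {m \<in> fst c. snd c m \<in> cball z r}"
  proof
    show "h ` cball z r \<subseteq> {m \<in> fst c. snd c m \<in> cball z r}"
    proof
      fix m assume "m \<in> h ` cball z r"
      then obtain y where y: "y \<in> cball z r" "m = h y" by blast
      then obtain m' where "m' \<in> fst c" "y = snd c m'" using sub by blast
      then show "m \<in> {m \<in> fst c. snd c m \<in> cball z r}" using y inv by simp
    qed
    show "{m \<in> fst c. snd c m \<in> cball z r} \<subseteq> h ` cball z r"
      using inv by (metis (no_types, lifting) imageI mem_Collect_eq subsetI)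
  qed
  ultimately show ?thesis by simp
qed

end

context parallel_form_manifold
begin

text \<open>Smoothness has to be checked in every chart \<open>c'\<close>, whereas the vector fields
  spanning the plane of rotation have constant coordinates in \<open>c\<close>.\<close>

lemma act_rot_smooth:
  assumes c: "c \<in> A" and c': "c' \<in> A" and es: "length es = p"
    and s: "\<And>k. Ck_on k UNIV (s :: 'e \<Rightarrow> real)"
    and \<psi>: "\<And>m. m \<in> fst c \<inter> fst c' \<Longrightarrow> \<psi> m = act p (tangent_space A m)
        (\<lambda>v. s (snd c m) *\<^sub>R rot (g m) (coord_vec A c m a) (coord_vec A c m b) v) (\<phi> m)"
  shows "Ck_on k (snd c' ` (fst c' \<inter> fst c)) (\<lambda>y. local_form A \<psi> c' y es)"
proof -
  define S where "S = snd c' ` (fst c' \<inter> fst c)"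
  have S: "open S" unfolding S_def by (rule overlap_open[OF c' c])
  have sub: "S \<subseteq> snd c' ` fst c'" by (auto simp: S_def)
  \<comment> \<open>At the point with \<open>c'\<close>-coordinates \<open>y\<close>,
    \<open>d a y\<close> is the \<open>c'\<close>-coordinate vector of the field that is constantly
    \<open>a\<close> in \<open>c\<close>, \<open>gd a y e\<close> is its inner product with the
    vector of coordinates \<open>e\<close>, and \<open>\<Theta> y e\<close> is the coordinate vector
    of the image of \<open>e\<close> under the scaled rotation.\<close>
  define d where "d a y = frechet_derivative (transition c c') (at (transition c' c y)) a" for a y
  define gd where "gd a y e = (\<Sum>l\<in>Basis. inner (d a y) l * local_metric A g c' y l e)" for a y e
  define \<Theta> where "\<Theta> y e = s (transition c' c y) *\<^sub>R (gd a y e *\<^sub>R d b y + (- 1 * gd b y e) *\<^sub>R d a y)" for y e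
  have tr: "Ck_on k S (transition c' c)" for k
    unfolding S_def by (rule transition_Ck[OF c' c])
  have img: "transition c' c ` S \<subseteq> snd c ` (fst c \<inter> fst c')"
    by (auto simp: S_def transition_apply[OF c'])
  have dC: "Ck_on k S (d a)" for a k
    unfolding d_def[abs_def]
  proof (rule Ck_on_compose[OF S overlap_open[OF c c'] img tr])
    show "Ck_on k (snd c ` (fst c \<inter> fst c')) (\<lambda>z. frechet_derivative (transition c c') (at z) a)"
      using transition_Ck[OF c c', of "Suc k"] by simp
  qed
  have gC: "Ck_on k S (\<lambda>y. gd a y e)" for a e k
    unfolding gd_def
    by (intro Ck_on_sum[OF S] Ck_on_mult[OF S] Ck_on_inner[OF S] Ck_on_const dC Ck_on_subset[OF local_metric_Ck[OF c'] sub])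
  have "Ck_on k S (\<lambda>y. s (transition c' c y))" for k
    by (rule Ck_on_compose[OF S open_UNIV subset_UNIV tr s])
  then have \<Theta>C: "Ck_on k S (\<lambda>y. \<Theta> y e)" for e k
    unfolding \<Theta>_def by (intro Ck_on_scaleR[OF S] Ck_on_add[OF S] Ck_on_mult[OF S] Ck_on_const dC gC)
  have C: "Ck_on k S (\<lambda>y. \<Sum>i<p. \<Sum>j\<in>Basis. inner (\<Theta> y (es ! i)) j * local_form A \<phi> c' y (es[i := j]))"
    by (intro Ck_on_sum[OF S] Ck_on_mult[OF S] Ck_on_inner[OF S] Ck_on_const \<Theta>C Ck_on_subset[OF local_form_Ck[OF c'] sub])
       (simp add: es)
  have "local_form A \<psi> c' y es = (\<Sum>i<p. \<Sum>j\<in>Basis. inner (\<Theta> y (es ! i)) j * local_form A \<phi> c' y (es[i := j]))"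
    if y: "y \<in> S" for y
  proof -
    obtain m where m: "m \<in> fst c" "m \<in> fst c'" "y = snd c' m" using y by (auto simp: S_def)
    have cm: "c \<in> charts_at A m" "c' \<in> charts_at A m" using m c c' by (auto simp: charts_at_def)
    have mM: "m \<in> topspace M" by (rule chart_topspace[OF c m(1)])
    have inv: "chart_inv c' y = m" using m by (simp add: chart_inv_chart[OF chart[OF c']])
    have y\<Omega>: "y \<in> snd c' ` fst c'" using m by blast
    have ty: "transition c' c y = snd c m" using transition_apply[OF c' m(2), of c] m(3) by simp
    have cv: "coord_vec A c m e = coord_vec A c' m (d e y)" for e
      unfolding coord_vec_transition[OF cm] d_def dtrans_def ty ..
    have gm: "g m (coord_vec A c m e) (coord_vec A c' m e') = gd e y e'" for e e'
    proof -
      note ip = local_metric_inner[OF c' y\<Omega>]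
      have "g m (coord_vec A c m e) (coord_vec A c' m e') = local_metric A g c' y (d e y) e'"
        by (simp add: cv local_metric_def inv)
      also have "\<dots> = local_metric A g c' y e' (\<Sum>l\<in>Basis. inner (d e y) l *\<^sub>R l)"
        using inner_product_on_sym[OF ip, of "d e y" e'] by (simp add: euclidean_representation)
      also have "\<dots> = (\<Sum>l\<in>Basis. inner (d e y) l * local_metric A g c' y e' l)"
        by (rule inner_product_on_sum_right[OF ip subspace_UNIV]) simp_all
      also have "\<dots> = gd e y e'"
        unfolding gd_def using inner_product_on_sym[OF ip, of e'] by simp
      finally show ?thesis .
    qed
    note lin = linear_coord_vec[OF cm(2)]
    have rot_eq: "s (snd c m) *\<^sub>R rot (g m) (coord_vec A c m a) (coord_vec A c m b) (coord_vec A c' m e) = coord_vec A c' m (\<Theta> y e)" for e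
      by (simp add: rot_def gm \<Theta>_def ty linear_scale[OF lin] linear_add[OF lin] linear_diff[OF lin] flip: cv)
    have tup: "map (coord_vec A c' m) es \<in> tuples p (tangent_space A m)"
      by (rule map_coord_vec_tuples[OF cm(2) es])
    have \<psi>m: "\<psi> m = act p (tangent_space A m)
        (\<lambda>v. s (snd c m) *\<^sub>R rot (g m) (coord_vec A c m a) (coord_vec A c m b) v) (\<phi> m)"
      using m by (intro \<psi>) simp
    have "local_form A \<psi> c' y es = (\<Sum>i<p. local_form A \<phi> c' y (es[i := \<Theta> y (es ! i)]))"
      using tup es by (simp add: local_form_def inv \<psi>m act_def rot_eq map_update)
    also have "\<dots> = (\<Sum>i<p. \<Sum>j\<in>Basis. inner (\<Theta> y (es ! i)) j * local_form A \<phi> c' y (es[i := j]))"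
    proof (rule sum.cong)
      fix i assume "i \<in> {..<p}"
      then have i: "i < p" by simp
      have ml: "multilin p UNIV (local_form A \<phi> c' y)"
        by (rule local_form_multilin[where \<omega> = \<phi>, OF c' y\<Omega>]) (simp add: inv \<phi>_alt[OF mM])
      have "es \<in> tuples p UNIV" by (simp add: tuples_def es)
      from multilin_sum[OF subspace_UNIV ml this i, where J = Basis and b = "\<lambda>j. j" and c = "\<lambda>j. inner (\<Theta> y (es ! i)) j"]
      show "local_form A \<phi> c' y (es[i := \<Theta> y (es ! i)]) = (\<Sum>j\<in>Basis. inner (\<Theta> y (es ! i)) j * local_form A \<phi> c' y (es[i := j]))"
        by (simp add: euclidean_representation)
    qed simp
    finally show ?thesis .
  qed
  then show ?thesis unfolding S_def[symmetric] by (intro Ck_on_cong[OF S _ C]) simp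
qed

text \<open>\<open>s\<close> is the value of the bump function at \<open>x\<close>: the section
  realises the prescribed rotation up to this positive factor.\<close>

lemma exists_section:
  assumes t: "\<And>m. m \<in> topspace M \<Longrightarrow> transportable m x0" and x: "x \<in> topspace M"
    and ab: "a \<in> tangent_space A x" "b \<in> tangent_space A x"
  obtains \<psi> s where "\<psi> \<in> P_forms M A g p \<phi> x0" "s > 0"
    "\<psi> x = act p (tangent_space A x) (\<lambda>v. s *\<^sub>R rot (g x) a b v) (\<phi> x)"
proof -
  obtain c where c: "c \<in> A" "x \<in> fst c" using ex_chart[OF x] by blast
  have cx: "c \<in> charts_at A x" using c by (simp add: charts_at_def)
  have "open (snd c ` fst c)" using chart[OF c(1)] by (simp add: is_chart_def)
  moreover have "snd c x \<in> snd c ` fst c" using c by blast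
  ultimately obtain r where r: "r > 0" "cball (snd c x) r \<subseteq> snd c ` fst c" using open_contains_cball by blast
  define s where "s = bump (snd c x) r"
  define \<theta> where "\<theta> m v = (if m \<in> fst c then s (snd c m) *\<^sub>R rot (g m) (coord_vec A c m (a c)) (coord_vec A c m (b c)) v else 0)" for m v
  define \<psi> where "\<psi> m = act p (tangent_space A m) (\<theta> m) (\<phi> m)" for m
  have skew: "\<theta> m \<in> skew_endos (tangent_space A m) (g m)" if m: "m \<in> topspace M" for m
  proof (cases "m \<in> fst c")
    case True
    then have "c \<in> charts_at A m" using c by (simp add: charts_at_def)
    from rot_skew[OF subspace_tangent_space metric_inner[OF m] coord_vec_in[OF this] coord_vec_in[OF this]]
    show ?thesis using True by (simp add: \<theta>_def[abs_def])
  next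
    case False
    then show ?thesis using zero_skew[OF subspace_tangent_space metric_inner[OF m]] by (simp add: \<theta>_def[abs_def])
  qed
  have alt: "\<psi> m \<in> alt_forms p (tangent_space A m)" if m: "m \<in> topspace M" for m
    unfolding \<psi>_def using skew[OF m]
    by (intro act_alt_forms subspace_tangent_space \<phi>_alt m) (simp add: skew_endos_def)
  have smooth_\<psi>: "Ck_on k (snd c' ` fst c') (\<lambda>y. local_form A \<psi> c' y es)" if c': "c' \<in> A" and es: "length es = p" for c' es k
  proof -
    define K where "K = {m \<in> fst c. snd c m \<in> cball (snd c x) r}"
    \<comment> \<open>\<open>S1\<close> and \<open>S2\<close> cover the chart \<open>c'\<close>: the
      first is the overlap with \<open>c\<close>, where the explicit formula holds, and the second
      avoids the ball \<open>K\<close> carrying the cut-off, so the form is 0 there.\<close>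
    define S1 where "S1 = snd c' ` (fst c' \<inter> fst c)"
    define S2 where "S2 = snd c' ` (fst c' \<inter> (topspace M - K))"
    have "closedin M K" unfolding K_def by (rule chart_cball_closed[OF c(1) r(2)])
    then have S2: "open S2" unfolding S2_def by (intro is_chart_open_image[OF chart[OF c']] openin_diff openin_topspace)
    have S1: "open S1" unfolding S1_def by (rule overlap_open[OF c' c(1)])
    have "Ck_on k S1 (\<lambda>y. local_form A \<psi> c' y es)"
      unfolding S1_def
      by (rule act_rot_smooth[OF c(1) c' es, where s = s and a = "a c" and b = "b c"])
         (simp_all add: s_def Ck_on_bump \<psi>_def \<theta>_def[abs_def])
    moreover have "Ck_on k S2 (\<lambda>y. local_form A \<psi> c' y es)"
    proof (rule Ck_on_cong[OF S2 _ Ck_on_const[where c = 0]])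
      fix y assume "y \<in> S2"
      then obtain m where m: "m \<in> fst c'" "m \<in> topspace M" "m \<notin> K" "y = snd c' m" by (auto simp: S2_def)
      have "\<theta> m v = 0" for v
        using m(3) bump_outside[OF r(1), of "snd c m" "snd c x"] by (auto simp: \<theta>_def K_def s_def)
      then have "\<psi> m vs = 0" for vs
        unfolding \<psi>_def by (intro act_vanish[OF \<phi>_alt[OF m(2)] subspace_tangent_space])
      moreover have "chart_inv c' y = m" using m by (simp add: chart_inv_chart[OF chart[OF c']])
      ultimately show "0 = local_form A \<psi> c' y es" by (simp add: local_form_def)
    qed
    ultimately have "Ck_on k (S1 \<union> S2) (\<lambda>y. local_form A \<psi> c' y es)" by (rule Ck_on_Un[OF S1 S2])
    moreover have "S1 \<union> S2 = snd c' ` fst c'"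
      using chart_topspace[OF c'] unfolding S1_def S2_def K_def by blast
    ultimately show ?thesis by simp
  qed
  have "smooth_form M A p \<psi>"
    unfolding smooth_form_def smooth_on_def using alt smooth_\<psi> by blast
  moreover have "\<psi> m \<in> Phi_M A g p \<phi> x0 m" if m: "m \<in> topspace M" for m
    unfolding \<psi>_def by (rule act_in_Phi_M[OF t[OF m] m skew[OF m]])
  ultimately have "\<psi> \<in> P_forms M A g p \<phi> x0" by (simp add: P_forms_def)
  moreover have "s (snd c x) > 0" unfolding s_def by (rule bump_center[OF r(1)])
  moreover have "\<psi> x = act p (tangent_space A x) (\<lambda>v. s (snd c x) *\<^sub>R rot (g x) a b v) (\<phi> x)"
    unfolding \<psi>_def \<theta>_def[abs_def] using c(2) coord_vec_tangent[OF cx ab(1)] coord_vec_tangent[OF cx ab(2)] by simp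
  ultimately show ?thesis by (rule that)
qed

text \<open>The rotation sends \<open>es ! a\<close> to \<open>w\<close> and kills the other
  \<open>es ! i\<close>, so in the sum defining \<open>act\<close> only slot \<open>a\<close>
  survives.\<close>

lemma act_rot_orthonormal:
  assumes x: "x \<in> topspace M" and es: "es \<in> tuples p (tangent_space A x)" and on: "orthonormal (g x) es"
    and a: "a < p" and w: "w \<in> tangent_space A x" and orth: "\<And>i. i < p \<Longrightarrow> g x (es ! i) w = 0"
  shows "act p (tangent_space A x) (\<lambda>v. s *\<^sub>R rot (g x) (es ! a) w v) (\<phi> x) es = s * \<phi> x (es[a := w])"
proof -
  let ?V = "tangent_space A x"
  note V = subspace_tangent_space[of x] and ip = metric_inner[OF x] and ml = alt_forms_multilin[OF \<phi>_alt[OF x]]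
  have "\<phi> x (es[i := s *\<^sub>R rot (g x) (es ! a) w (es ! i)]) = (if i = a then s * \<phi> x (es[a := w]) else 0)" if i: "i < p" for i
  proof -
    have "g x w (es ! i) = 0" using inner_product_on_sym[OF ip w tuples_nth[OF es i]] orth[OF i] by simp
    moreover have "g x (es ! a) (es ! i) = (if a = i then 1 else 0)"
      using on a i tuples_length[OF es] by (simp add: orthonormal_def)
    ultimately have "s *\<^sub>R rot (g x) (es ! a) w (es ! i) = (if i = a then s else 0) *\<^sub>R w"
      by (simp add: rot_def)
    then show ?thesis using multilin_scaleR[OF ml es i w] by simp
  qed
  then show ?thesis using es a by (simp add: act_def)
qed

end

theorem theorem1p1:
  fixes M :: "'m topology"
    and A :: "('m, 'e::euclidean_space) chart set"
    and g :: "('m, 'e) metric"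
    and p :: nat
    and \<phi> :: "('m, 'e) diff_form"
    and x0 :: 'm
    and N :: "'m topology"
    and \<xi> :: "'m \<Rightarrow> ('m, 'e) tvec mvec"
  assumes "riemannian_manifold M A g" and "connected_space M"
    and "parallel_calibration M A g p \<phi>"
    and "x0 \<in> topspace M"
    and "oriented_submanifold M A g p N \<xi>"
  shows "(critical_submanifold A g p \<phi> N \<xi> \<longleftrightarrow> integral_manifold M A p (P_forms M A g p \<phi> x0) N) \<and>
         (calibrated_submanifold \<phi> N \<xi> \<longrightarrow> integral_manifold M A p (P_forms M A g p \<phi> x0) N)"
proof -
  let ?T = "tangent_space A" and ?TN = "tangent_sub M A p N" and ?P = "P_forms M A g p \<phi> x0"
  interpret parallel_form_manifold M A g p \<phi>
    using assms(1,3) unfolding riemannian_manifold_def parallel_calibration_def calibration_def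
    by unfold_locales auto
  have NM: "x \<in> topspace M" if "x \<in> topspace N" for x
    using assms(5) that by (auto simp: oriented_submanifold_def submanifold_def)
  have ex_slice: "\<exists>c S W. slice M A p N c S W \<and> x \<in> W" if "x \<in> topspace N" for x
    using assms(5) that unfolding oriented_submanifold_def submanifold_def by blast
  have TN_T: "?TN x \<subseteq> ?T x" for x by (auto simp: tangent_sub_def)
  have ex_frame: "\<exists>es\<in>tuples p (?TN x). orthonormal (g x) es \<and> \<xi> x = wedge p (?T x) es" if "x \<in> topspace N" for x
    using assms(5) that unfolding oriented_submanifold_def orientation_def by blast
  have crit_iff: "wedge p (?T x) es \<in> critical_points p (?T x) (g x) (\<phi> x) \<longleftrightarrow>
      (\<forall>a<p. \<forall>w\<in>?T x. (\<forall>i<p. g x (es ! i) w = 0) \<longrightarrow> \<phi> x (es[a := w]) = 0)"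
    if x: "x \<in> topspace M" and es: "es \<in> tuples p (?T x)" and on: "orthonormal (g x) es" for x es
  proof
    assume "wedge p (?T x) es \<in> critical_points p (?T x) (g x) (\<phi> x)"
    then show "\<forall>a<p. \<forall>w\<in>?T x. (\<forall>i<p. g x (es ! i) w = 0) \<longrightarrow> \<phi> x (es[a := w]) = 0"
      using critical_pointsD[OF subspace_tangent_space metric_inner[OF x] es on \<phi>_alt[OF x]] by blast
  next
    assume crit: "\<forall>a<p. \<forall>w\<in>?T x. (\<forall>i<p. g x (es ! i) w = 0) \<longrightarrow> \<phi> x (es[a := w]) = 0"
    obtain c where "c \<in> A" "x \<in> fst c" using ex_chart[OF x] by blast
    then have cx: "c \<in> charts_at A x" by (simp add: charts_at_def)
    show "wedge p (?T x) es \<in> critical_points p (?T x) (g x) (\<phi> x)"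
    proof (rule critical_pointsI[OF subspace_tangent_space metric_inner[OF x] es on, where J = Basis
          and b = "coord_vec A c x" and k = "\<lambda>j v. inner (v c) j"])
      show "linear_between (?T x) UNIV (\<lambda>v. inner (v c) j)" for j
        by (simp add: linear_between_def plus_fun_def scaleR_fun_def inner_add_left)
      show "v = (\<Sum>j\<in>Basis. inner (v c) j *\<^sub>R coord_vec A c x j)" if "v \<in> ?T x" for v
        by (rule tangent_frame[OF cx that])
      show "\<phi> x (es[a := w]) = 0" if "a < p" "w \<in> ?T x" "\<And>i. i < p \<Longrightarrow> g x (es ! i) w = 0" for a w
        using crit that by blast
    qed (use coord_vec_in[OF cx] \<phi>_alt[OF x] in auto)
  qed
  have crit_int: "integral_manifold M A p ?P N" if crit: "critical_submanifold A g p \<phi> N \<xi>"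
    unfolding integral_manifold_def
  proof (intro ballI)
    fix \<psi> x vs assume \<psi>: "\<psi> \<in> ?P" and x: "x \<in> topspace N" and vs: "vs \<in> tuples p (?TN x)"
    obtain es where es: "es \<in> tuples p (?TN x)" and on: "orthonormal (g x) es" and \<xi>: "\<xi> x = wedge p (?T x) es"
      using ex_frame[OF x] by blast
    have esT: "es \<in> tuples p (?T x)" using es TN_T by (auto simp: tuples_def)
    have "wedge p (?T x) es \<in> critical_points p (?T x) (g x) (\<phi> x)"
      using crit x unfolding critical_submanifold_def \<xi>[symmetric] by blast
    then have "\<forall>a<p. \<forall>w\<in>?T x. (\<forall>i<p. g x (es ! i) w = 0) \<longrightarrow> \<phi> x (es[a := w]) = 0"
      unfolding crit_iff[OF NM[OF x] esT on] .
    moreover have "\<psi> x \<in> Phi_M A g p \<phi> x0 x" using \<psi> NM[OF x] by (simp add: P_forms_def)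
    ultimately have 0: "\<psi> x es = 0"
      using Phi_M_vanish[OF NM[OF x] assms(4) _ esT on] by blast
    \<comment> \<open>\<open>integral_manifold\<close> tests all tuples of tangent vectors. Since
      \<open>es\<close> spans the tangent space of \<open>N\<close>, the value on any such tuple is
      a multiple of the value on \<open>es\<close>.\<close>
    obtain c S W where sl: "slice M A p N c S W" "x \<in> W" using ex_slice[OF x] by blast
    have "vs \<in> tuples p (span (set es))"
      using vs tangent_sub_span[OF sl metric_inner[OF NM[OF x]] es on] by (auto simp: tuples_def)
    then obtain k where "\<forall>\<alpha>\<in>alt_forms p (?T x). \<alpha> vs = k * \<alpha> es"
      using alt_forms_proportional[OF subspace_tangent_space esT orthonormal_distinct[OF on]] by blast
    moreover have "\<psi> x \<in> alt_forms p (?T x)" using \<psi> NM[OF x] by (simp add: P_forms_def smooth_form_def)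
    ultimately have "\<psi> x vs = k * \<psi> x es" by blast
    then show "\<psi> x vs = 0" by (simp add: 0)
  qed
  have int_crit: "critical_submanifold A g p \<phi> N \<xi>" if int: "integral_manifold M A p ?P N"
    unfolding critical_submanifold_def
  proof
    fix x assume x: "x \<in> topspace N"
    obtain es where es: "es \<in> tuples p (?TN x)" and on: "orthonormal (g x) es" and \<xi>: "\<xi> x = wedge p (?T x) es"
      using ex_frame[OF x] by blast
    have esT: "es \<in> tuples p (?T x)" using es TN_T by (auto simp: tuples_def)
    have "\<phi> x (es[a := w]) = 0" if a: "a < p" and w: "w \<in> ?T x" and orth: "\<forall>i<p. g x (es ! i) w = 0" for a w
    proof -
      obtain \<psi> s where \<psi>: "\<psi> \<in> ?P" and s: "s > 0"
        and eq: "\<psi> x = act p (?T x) (\<lambda>v. s *\<^sub>R rot (g x) (es ! a) w v) (\<phi> x)"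
        using exists_section[OF transportable_connected[OF assms(2,4)] NM[OF x] tuples_nth[OF esT a] w] by blast
      have "\<psi> x es = s * \<phi> x (es[a := w])"
        unfolding eq using orth by (intro act_rot_orthonormal[OF NM[OF x] esT on a w]) simp
      moreover have "\<psi> x es = 0" using int \<psi> x es by (simp add: integral_manifold_def)
      ultimately show ?thesis using s by simp
    qed
    then show "\<xi> x \<in> critical_points p (?T x) (g x) (\<phi> x)"
      unfolding \<xi> using crit_iff[OF NM[OF x] esT on] by blast
  qed
  have cal_crit: "critical_submanifold A g p \<phi> N \<xi>" if cal: "calibrated_submanifold \<phi> N \<xi>"
    unfolding critical_submanifold_def
  proof
    fix x assume x: "x \<in> topspace N"
    obtain es where es: "es \<in> tuples p (?TN x)" and on: "orthonormal (g x) es" and \<xi>: "\<xi> x = wedge p (?T x) es"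
      using ex_frame[OF x] by blast
    show "\<xi> x \<in> critical_points p (?T x) (g x) (\<phi> x)"
    proof (rule critical_points_maximum[OF \<phi>_alt[OF NM[OF x]]])
      show "\<xi> x \<in> Gr_o p (?T x) (g x)"
        unfolding Gr_o_def \<xi> using es on TN_T[of x] by (auto simp: tuples_def)
      show "pairing (\<phi> x) \<eta> \<le> pairing (\<phi> x) (\<xi> x)" if "\<eta> \<in> Gr_o p (?T x) (g x)" for \<eta>
        using assms(3) that cal x NM[OF x]
        by (simp add: parallel_calibration_def calibration_def calibrated_submanifold_def)
    qed
  qed
  show ?thesis using crit_int int_crit cal_crit by blast
qed

end
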